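(* Let $I:T_1\rightsquigarrow T_2$ be an open interpretation between canonical theories, let $\ell\in\mathbb N$ and $\phi\in\mathrm{Hom}^+(\mathcal A[T_2],\mathbb R)$. Then: (1) if $\phi$ is uniquely coupleable with some $\psi\in\mathrm{Hom}^+(\mathcal A[T'],\mathbb R)$ ($T'$ a canonical theory), then $\phi^I$ is uniquely coupleable with $\psi$; (2) if $\phi$ satisfies $\mathrm{Independence}[\ell]$, then so does $\phi^I$; (3) if $\phi$ satisfies $\mathrm{UCouple}[\ell]$, then so does $\phi^I$; (4) if $\phi$ satisfies $\mathrm{UInduce}[\ell]$, then so does $\phi^I$.
   Context: All languages are finite relational; predicates $P$ have arity $k(P)\ge1$. A canonical theory over $\mathcal L$ is a universal theory containing, for each $P\in\mathcal L$, the axiom that $P(x_1,\dots,x_{k(P)})$ fails whenever two $x_i$ coincide. $T_1\cup T_2$ is the disjoint union. $\mathcal K_V[T]$: models on vertex set $V$; $\mathcal M[T]$: isomorphism classes of finite models. $\mathrm{Hom}^+(\mathcal A[T],\mathbb R)$: functions $\phi:\mathcal M[T]\to[0,1]$, $\phi(M)=\lim_n p(M,N_n)$ for finite models $N_n$ of $T$ of strictly increasing size ($p(M,N)$ = probability a random $|M|$-subset of $V(N)$ induces a copy of $M$). $\phi(\langle K\rangle)=\frac{|\mathrm{Aut}(K)|}{|K|!}\phi([K])$. Theons: for an atomless complete probability space $\Omega=(X,\mathcal A,\mu)$, $\mathcal E_V(\Omega)=X^{r(V)}$ with $r(V)$ the finite nonempty subsets of $V$, $\mathcal E_{V,\ell}(\Omega)=X^{\{A\in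 r(V):|A|\le\ell\}}$, $\mathcal E_k=\mathcal E_{[k]}$, $\alpha^*(x)_A=x_{\alpha(A)}$. A $T$-on is a family of measurable $\mathcal N_P\subseteq\mathcal E_{k(P)}(\Omega)$ such that for random $\theta\in\mathcal E_{\mathbb N_+}(\Omega)$ the structure $\mathbf K$ on $\mathbb N_+$ with $R_P(\mathbf K)=\{\alpha\text{ injective}:\alpha^*(\theta)\in\mathcal N_P\}$ is a.s. a model of $T$; $\phi_{\mathcal N}(M)=\Pr[\mathbf K|_{[|M|]}\cong M]$; every $\phi$ is some $\phi_{\mathcal N}$. Peon $\mathcal N_P\subseteq\mathcal E_k(\Omega)$: rank $\le r$ if $\mathcal N_P=\mathcal H\times X^{\{A\subseteq[k]:|A|>r\}}$, $\mathcal H\subseteq \mathcal E_{k,r}(\Omega)$; $\ell$-independent if $\mathcal N_P=\mathcal E_{k,\ell}(\Omega)\times\mathcal H$. $\mathrm{rk}(\phi)$: minimal max-peon-rank of a representing $T$-on. $\mathrm{Independence}[\ell]$: represented by a $T$-on with all peons $\ell$-independent. Open interpretation $I:T_1\rightsquigarrow T_2$: assigns quantifier-free formulas $I(P)$ of the language of $T_2$ to predicates of $T_1$ so that each model $K$ of $T_2$ yields a model $I(K)$ of $T_1$ ($R_P(I(K))=\{\alpha:K\models I(P)(\alpha)\}$); $\phi^I(M)=\sum\{\phi(N):N\in\mathcal M_{|M|}[T_2],I(N)\cong M\}$. Structure-erasing interpretations $T_i\rightsquigarrow T_1\cup T_2$ map $P\mapsto P$. Coupling of $\phi_1,\phi_2$: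 $\xi$ on $T_1\cup T_2$ with $\xi^{I_i}=\phi_i$; independent coupling $(\phi_1\otimes\phi_2)(\langle M\rangle)=\phi_1(\langle I_1(M)\rangle)\phi_2(\langle I_2(M)\rangle)$; uniquely coupleable: the independent coupling is the only coupling. $\mathrm{UCouple}[\ell]$: uniquely coupleable with every limit object of rank $\le\ell$ of every canonical theory. $T_{\ell\text{-Hypergraph}}$: single symmetric $\ell$-ary predicate. For $\ell\ge1$, $\phi$ satisfies $\mathrm{UInduce}[\ell]$ if for every $\psi$ of $T_{\ell\text{-Hypergraph}}$, every coupling $\xi$ of $\phi$ and $\psi$ and every $M\in\mathcal M[T\cup T_{\ell\text{-Hypergraph}}]$ whose hypergraph part is complete, $\xi(M)=(\phi\otimes\psi)(M)$; every $\phi$ satisfies $\mathrm{UInduce}[0]$. *)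

theory Defs
  imports "HOL-Probability.Probability" "HOL-Combinatorics.Permutations"
begin

section \<open>Languages, open formulas, universal theories, structures\<close>

text \<open>
  Variables are natural numbers.  A tuple of vertices is a list, so that coordinates are numbered
  from 0: the sets \<open>[k] = {1,...,k}\<close> and the positive integers of the usual notation become
  \<open>{..<k}\<close> and \<open>UNIV :: nat set\<close>.
\<close>

datatype 'p qf =
    Falsum
  | Equal nat nat
  | Atom 'p "nat list"
  | Neg "'p qf"
  | And "'p qf" "'p qf"
  | Or "'p qf" "'p qf"

primrec qf_vars :: "'p qf \<Rightarrow> nat set" where
  "qf_vars Falsum = {}"
| "qf_vars (Equal i j) = {i, j}"
| "qf_vars (Atom P xs) = set xs"
| "qf_vars (Neg F) = qf_vars F"
| "qf_vars (And F G) = qf_vars F \<union> qf_vars G"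
| "qf_vars (Or F G) = qf_vars F \<union> qf_vars G"

record 'p language =
  preds :: "'p set"
  arity :: "'p \<Rightarrow> nat"

definition wf_language :: "('p, 'a) language_scheme \<Rightarrow> bool" where
  "wf_language L \<longleftrightarrow> finite (preds L) \<and> (\<forall>P\<in>preds L. arity L P \<ge> 1)"

primrec qf_over :: "('p, 'a) language_scheme \<Rightarrow> 'p qf \<Rightarrow> bool" where
  "qf_over L Falsum \<longleftrightarrow> True"
| "qf_over L (Equal i j) \<longleftrightarrow> True"
| "qf_over L (Atom P xs) \<longleftrightarrow> P \<in> preds L \<and> length xs = arity L P"
| "qf_over L (Neg F) \<longleftrightarrow> qf_over L F"
| "qf_over L (And F G) \<longleftrightarrow> qf_over L F \<and> qf_over L G"
| "qf_over L (Or F G) \<longleftrightarrow> qf_over L F \<and> qf_over L G"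

text \<open>An element of \<open>axioms\<close> stands for its universal closure.\<close>

record 'p univ_theory = "'p language" +
  axioms :: "'p qf set"

definition wf_theory :: "'p univ_theory \<Rightarrow> bool" where
  "wf_theory T \<longleftrightarrow> wf_language T \<and> (\<forall>F\<in>axioms T. qf_over T F)"

record 'p rel_struct =
  verts :: "nat set"
  rel :: "'p \<Rightarrow> nat list set"

text \<open>
  Relations are required to be empty outside the language, so that structures over the same
  language are equal iff they have the same vertices and the same relations.
\<close>

definition struct_over :: "('p, 'a) language_scheme \<Rightarrow> 'p rel_struct \<Rightarrow> bool" where
  "struct_over L M \<longleftrightarrow>
     (\<forall>P\<in>preds L. rel M P \<subseteq> {xs. set xs \<subseteq> verts M \<and> length xs = arity L P}) \<and>
     (\<forall>P. P \<notin> preds L \<longrightarrow> rel M P = {})"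

primrec eval :: "'p rel_struct \<Rightarrow> (nat \<Rightarrow> nat) \<Rightarrow> 'p qf \<Rightarrow> bool" where
  "eval M s Falsum \<longleftrightarrow> False"
| "eval M s (Equal i j) \<longleftrightarrow> s i = s j"
| "eval M s (Atom P xs) \<longleftrightarrow> map s xs \<in> rel M P"
| "eval M s (Neg F) \<longleftrightarrow> \<not> eval M s F"
| "eval M s (And F G) \<longleftrightarrow> eval M s F \<and> eval M s G"
| "eval M s (Or F G) \<longleftrightarrow> eval M s F \<or> eval M s G"

definition satisfies :: "'p rel_struct \<Rightarrow> 'p qf \<Rightarrow> bool" where
  "satisfies M F \<longleftrightarrow> (\<forall>s. s ` qf_vars F \<subseteq> verts M \<longrightarrow> eval M s F)"

definition model :: "'p univ_theory \<Rightarrow> 'p rel_struct \<Rightarrow> bool" where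
  "model T M \<longleftrightarrow> struct_over T M \<and> (\<forall>F\<in>axioms T. satisfies M F)"

definition finite_models :: "'p univ_theory \<Rightarrow> 'p rel_struct set" where
  "finite_models T = {M. model T M \<and> finite (verts M)}"

text \<open>
  Theories are considered up to their consequences: the diagonal axioms have to be entailed,
  not to be listed in a particular syntactic form.  Since the sentences involved are universal,
  testing entailment on models with vertices in \<open>nat\<close> is no restriction.
\<close>

definition diag_axiom :: "('p, 'a) language_scheme \<Rightarrow> 'p \<Rightarrow> nat \<Rightarrow> nat \<Rightarrow> 'p qf" where
  "diag_axiom L P i j = Neg (And (Equal i j) (Atom P [0..<arity L P]))"

definition canonical :: "'p univ_theory \<Rightarrow> bool" where
  "canonical T \<longleftrightarrow> wf_theory T \<and>
     (\<forall>P\<in>preds T. \<forall>i j. i < j \<and> j < arity T P \<longrightarrow>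
        (\<forall>M. model T M \<longrightarrow> satisfies M (diag_axiom T P i j)))"

definition union_theory ::
    "'p univ_theory \<Rightarrow> 'q univ_theory \<Rightarrow> ('p + 'q) univ_theory" (infixl "\<oplus>\<^sub>T" 65) where
  "T1 \<oplus>\<^sub>T T2 =
     \<lparr> preds = preds T1 <+> preds T2,
       arity = case_sum (arity T1) (arity T2),
       axioms = map_qf Inl ` axioms T1 \<union> map_qf Inr ` axioms T2 \<rparr>"

definition hypergraph_theory :: "nat \<Rightarrow> unit univ_theory" where
  "hypergraph_theory l =
     (let L = \<lparr> preds = {()}, arity = (\<lambda>_. l) \<rparr> in
      \<lparr> preds = preds L, arity = arity L,
        axioms = {diag_axiom L () i j | i j. i < j \<and> j < l} \<union>
          {Or (Neg (Atom () [0..<l])) (Atom () ys) | ys. distinct ys \<and> set ys = {..<l}} \<rparr>)"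


section \<open>Isomorphism classes and densities\<close>

definition is_iso :: "(nat \<Rightarrow> nat) \<Rightarrow> 'p rel_struct \<Rightarrow> 'p rel_struct \<Rightarrow> bool" where
  "is_iso f M N \<longleftrightarrow> bij_betw f (verts M) (verts N) \<and>
     (\<forall>P xs. set xs \<subseteq> verts M \<longrightarrow> (xs \<in> rel M P \<longleftrightarrow> map f xs \<in> rel N P))"

definition isomorphic :: "'p rel_struct \<Rightarrow> 'p rel_struct \<Rightarrow> bool" (infix "\<cong>\<^sub>S" 50) where
  "M \<cong>\<^sub>S N \<longleftrightarrow> (\<exists>f. is_iso f M N)"

definition aut :: "'p rel_struct \<Rightarrow> (nat \<Rightarrow> nat) set" where
  "aut M = {f. f permutes verts M \<and> is_iso f M M}"

definition induced :: "'p rel_struct \<Rightarrow> nat set \<Rightarrow> 'p rel_struct" where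
  "induced M W = \<lparr> verts = W, rel = (\<lambda>P. {xs \<in> rel M P. set xs \<subseteq> W}) \<rparr>"

definition iso_rel :: "'p univ_theory \<Rightarrow> ('p rel_struct \<times> 'p rel_struct) set" where
  "iso_rel T = {(M, N). M \<in> finite_models T \<and> N \<in> finite_models T \<and> M \<cong>\<^sub>S N}"

definition iso_classes :: "'p univ_theory \<Rightarrow> 'p rel_struct set set" where
  "iso_classes T = finite_models T // iso_rel T"

definition iso_class :: "'p univ_theory \<Rightarrow> 'p rel_struct \<Rightarrow> 'p rel_struct set" where
  "iso_class T M = iso_rel T `` {M}"

text \<open>A representative of an isomorphism class.\<close>

definition rep :: "'p rel_struct set \<Rightarrow> 'p rel_struct" where
  "rep C = (SOME M. M \<in> C)"

definition density :: "'p rel_struct \<Rightarrow> 'p rel_struct \<Rightarrow> real" where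
  "density M N =
     real (card {W. W \<subseteq> verts N \<and> card W = card (verts M) \<and> induced N W \<cong>\<^sub>S M}) /
     real (card (verts N) choose card (verts M))"

text \<open>
  Limit objects are functions on the isomorphism classes of finite models, extended by
  \<open>undefined\<close>, so that equality of limit objects is equality of functions.
\<close>

type_synonym 'p limit_obj = "'p rel_struct set \<Rightarrow> real"

definition Hom_pos :: "'p univ_theory \<Rightarrow> 'p limit_obj set" where
  "Hom_pos T = {\<phi> \<in> iso_classes T \<rightarrow>\<^sub>E {0..1}.
     \<exists>N :: nat \<Rightarrow> 'p rel_struct. (\<forall>n. N n \<in> finite_models T) \<and>
       strict_mono (\<lambda>n. card (verts (N n))) \<and>
       (\<forall>M\<in>finite_models T. (\<lambda>n. density M (N n)) \<longlonglongrightarrow> \<phi> (iso_class T M))}"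

text \<open>The value \<open>\<phi>(\<langle>K\<rangle>)\<close> for a labelled model \<open>K\<close>.\<close>

definition labelled :: "'p univ_theory \<Rightarrow> 'p limit_obj \<Rightarrow> 'p rel_struct \<Rightarrow> real" where
  "labelled T \<phi> K = real (card (aut K)) / fact (card (verts K)) * \<phi> (iso_class T K)"


section \<open>Open interpretations\<close>

definition interp_struct ::
    "'p univ_theory \<Rightarrow> ('p \<Rightarrow> 'q qf) \<Rightarrow> 'q rel_struct \<Rightarrow> 'p rel_struct" where
  "interp_struct T1 I K =
     \<lparr> verts = verts K,
       rel = (\<lambda>P. if P \<in> preds T1
                  then {xs. length xs = arity T1 P \<and> set xs \<subseteq> verts K \<and> eval K (\<lambda>i. xs ! i) (I P)}
                  else {}) \<rparr>"

definition open_interpretation ::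
    "'p univ_theory \<Rightarrow> 'q univ_theory \<Rightarrow> ('p \<Rightarrow> 'q qf) \<Rightarrow> bool" where
  "open_interpretation T1 T2 I \<longleftrightarrow>
     (\<forall>P\<in>preds T1. qf_over T2 (I P) \<and> qf_vars (I P) \<subseteq> {..<arity T1 P}) \<and>
     (\<forall>K. model T2 K \<longrightarrow> model T1 (interp_struct T1 I K))"

text \<open>The limit object \<open>\<phi>\<^sup>I\<close>.\<close>

definition interp_limit ::
    "'p univ_theory \<Rightarrow> 'q univ_theory \<Rightarrow> ('p \<Rightarrow> 'q qf) \<Rightarrow> 'q limit_obj \<Rightarrow> 'p limit_obj" where
  "interp_limit T1 T2 I \<phi> = (\<lambda>C\<in>iso_classes T1.
     \<Sum>D | D \<in> iso_classes T2 \<and> card (verts (rep D)) = card (verts (rep C)) \<and>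
           interp_struct T1 I (rep D) \<cong>\<^sub>S rep C. \<phi> D)"

definition erase_left :: "'p univ_theory \<Rightarrow> 'p \<Rightarrow> ('p + 'q) qf" where
  "erase_left T1 P = Atom (Inl P) [0..<arity T1 P]"

definition erase_right :: "'q univ_theory \<Rightarrow> 'q \<Rightarrow> ('p + 'q) qf" where
  "erase_right T2 P = Atom (Inr P) [0..<arity T2 P]"


section \<open>Couplings\<close>

definition couplings ::
    "'p univ_theory \<Rightarrow> 'q univ_theory \<Rightarrow> 'p limit_obj \<Rightarrow> 'q limit_obj \<Rightarrow> ('p + 'q) limit_obj set" where
  "couplings T1 T2 \<phi>1 \<phi>2 = {\<xi> \<in> Hom_pos (T1 \<oplus>\<^sub>T T2).
     interp_limit T1 (T1 \<oplus>\<^sub>T T2) (erase_left T1) \<xi> = \<phi>1 \<and>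
     interp_limit T2 (T1 \<oplus>\<^sub>T T2) (erase_right T2) \<xi> = \<phi>2}"

text \<open>
  The factor \<open>|M|! / |Aut(M)|\<close> solves the defining equation
  \<open>(\<phi>\<^sub>1 \<otimes> \<phi>\<^sub>2)(\<langle>M\<rangle>) = \<phi>\<^sub>1(\<langle>I\<^sub>1(M)\<rangle>) \<phi>\<^sub>2(\<langle>I\<^sub>2(M)\<rangle>)\<close> for the value at the isomorphism class of \<open>M\<close>.
\<close>

definition indep_coupling ::
    "'p univ_theory \<Rightarrow> 'q univ_theory \<Rightarrow> 'p limit_obj \<Rightarrow> 'q limit_obj \<Rightarrow> ('p + 'q) limit_obj" where
  "indep_coupling T1 T2 \<phi>1 \<phi>2 = (\<lambda>C\<in>iso_classes (T1 \<oplus>\<^sub>T T2).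
     let M = rep C in
       fact (card (verts M)) / real (card (aut M)) *
       (labelled T1 \<phi>1 (interp_struct T1 (erase_left T1) M) *
        labelled T2 \<phi>2 (interp_struct T2 (erase_right T2) M)))"

definition uniquely_coupleable ::
    "'p univ_theory \<Rightarrow> 'q univ_theory \<Rightarrow> 'p limit_obj \<Rightarrow> 'q limit_obj \<Rightarrow> bool" where
  "uniquely_coupleable T1 T2 \<phi>1 \<phi>2 \<longleftrightarrow>
     couplings T1 T2 \<phi>1 \<phi>2 = {indep_coupling T1 T2 \<phi>1 \<phi>2}"


section \<open>Theons\<close>

definition atomless :: "'x measure \<Rightarrow> bool" where
  "atomless \<Omega> \<longleftrightarrow> (\<forall>A\<in>sets \<Omega>. measure \<Omega> A > 0 \<longrightarrow>
     (\<exists>B\<in>sets \<Omega>. B \<subseteq> A \<and> 0 < measure \<Omega> B \<and> measure \<Omega> B < measure \<Omega> A))"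

definition theon_space :: "'x measure \<Rightarrow> bool" where
  "theon_space \<Omega> \<longleftrightarrow> prob_space \<Omega> \<and> complete_measure \<Omega> \<and> atomless \<Omega>"

definition fin_subsets :: "nat set \<Rightarrow> nat set set" where
  "fin_subsets V = {A. finite A \<and> A \<noteq> {} \<and> A \<subseteq> V}"

text \<open>
  \<open>\<E>\<^sub>V(\<Omega>)\<close>, with the completion of the product measure.
\<close>

definition theon_cube :: "nat set \<Rightarrow> 'x measure \<Rightarrow> (nat set \<Rightarrow> 'x) measure" where
  "theon_cube V \<Omega> = completion (PiM (fin_subsets V) (\<lambda>_. \<Omega>))"

text \<open>The map \<open>\<alpha>\<^sup>*\<close>, for \<open>\<alpha>\<close> given as the list of its values.\<close>

definition pullback :: "nat list \<Rightarrow> (nat set \<Rightarrow> 'x) \<Rightarrow> (nat set \<Rightarrow> 'x)" where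
  "pullback xs \<theta> = (\<lambda>A\<in>fin_subsets {..<length xs}. \<theta> ((\<lambda>i. xs ! i) ` A))"

type_synonym ('p, 'x) peons = "'p \<Rightarrow> (nat set \<Rightarrow> 'x) set"

definition sampled_struct ::
    "'p univ_theory \<Rightarrow> ('p, 'x) peons \<Rightarrow> (nat set \<Rightarrow> 'x) \<Rightarrow> 'p rel_struct" where
  "sampled_struct T \<N> \<theta> =
     \<lparr> verts = UNIV,
       rel = (\<lambda>P. if P \<in> preds T
                  then {xs. length xs = arity T P \<and> distinct xs \<and> pullback xs \<theta> \<in> \<N> P}
                  else {}) \<rparr>"

definition theon :: "'p univ_theory \<Rightarrow> 'x measure \<Rightarrow> ('p, 'x) peons \<Rightarrow> bool" where
  "theon T \<Omega> \<N> \<longleftrightarrow> theon_space \<Omega> \<and>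
     (\<forall>P\<in>preds T. \<N> P \<in> sets (theon_cube {..<arity T P} \<Omega>)) \<and>
     (AE \<theta> in theon_cube UNIV \<Omega>. model T (sampled_struct T \<N> \<theta>))"

definition theon_limit ::
    "'p univ_theory \<Rightarrow> 'x measure \<Rightarrow> ('p, 'x) peons \<Rightarrow> 'p limit_obj" where
  "theon_limit T \<Omega> \<N> = (\<lambda>C\<in>iso_classes T.
     measure (theon_cube UNIV \<Omega>)
       {\<theta> \<in> space (theon_cube UNIV \<Omega>).
          induced (sampled_struct T \<N> \<theta>) {..<card (verts (rep C))} \<cong>\<^sub>S rep C})"

text \<open>
  In the next two definitions the product of a set \<open>H\<close> with a full power of \<open>X\<close> is written as
  the preimage of \<open>H\<close> under the restriction of coordinates.
\<close>

definition peon_rank_le :: "'x measure \<Rightarrow> nat \<Rightarrow> (nat set \<Rightarrow> 'x) set \<Rightarrow> nat \<Rightarrow> bool" where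
  "peon_rank_le \<Omega> k N r \<longleftrightarrow>
     (\<exists>H \<subseteq> {A \<in> fin_subsets {..<k}. card A \<le> r} \<rightarrow>\<^sub>E space \<Omega>.
        N = {x \<in> space (theon_cube {..<k} \<Omega>). restrict x {A \<in> fin_subsets {..<k}. card A \<le> r} \<in> H})"

definition peon_independent :: "'x measure \<Rightarrow> nat \<Rightarrow> (nat set \<Rightarrow> 'x) set \<Rightarrow> nat \<Rightarrow> bool" where
  "peon_independent \<Omega> k N l \<longleftrightarrow>
     (\<exists>H \<subseteq> {A \<in> fin_subsets {..<k}. card A > l} \<rightarrow>\<^sub>E space \<Omega>.
        N = {x \<in> space (theon_cube {..<k} \<Omega>). restrict x {A \<in> fin_subsets {..<k}. card A > l} \<in> H})"

definition peon_rank :: "'x measure \<Rightarrow> nat \<Rightarrow> (nat set \<Rightarrow> 'x) set \<Rightarrow> nat" where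
  "peon_rank \<Omega> k N = (LEAST r. peon_rank_le \<Omega> k N r)"

definition theon_rank :: "'p univ_theory \<Rightarrow> 'x measure \<Rightarrow> ('p, 'x) peons \<Rightarrow> nat" where
  "theon_rank T \<Omega> \<N> = Max (insert 0 ((\<lambda>P. peon_rank \<Omega> (arity T P) (\<N> P)) ` preds T))"

text \<open>
  One cannot quantify over types inside a definition, so the points of the spaces \<open>\<Omega>\<close> over which
  limit objects are represented are taken from a type \<open>'x\<close>, which is a parameter.  For \<open>'x = real\<close>
  this is no restriction: finitely many peons over an arbitrary \<open>\<Omega>\<close> depend, up to null
  sets, on a countably generated sub-\<open>\<sigma>\<close>-algebra only and can be transferred to the unit interval.
\<close>

definition limit_rank :: "'x itself \<Rightarrow> 'p univ_theory \<Rightarrow> 'p limit_obj \<Rightarrow> nat" where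
  "limit_rank _ T \<phi> =
     (LEAST r. \<exists>(\<Omega> :: 'x measure) \<N>. theon T \<Omega> \<N> \<and> theon_limit T \<Omega> \<N> = \<phi> \<and> theon_rank T \<Omega> \<N> = r)"

definition Independence :: "'x itself \<Rightarrow> nat \<Rightarrow> 'p univ_theory \<Rightarrow> 'p limit_obj \<Rightarrow> bool" where
  "Independence _ l T \<phi> \<longleftrightarrow>
     (\<exists>(\<Omega> :: 'x measure) \<N>. theon T \<Omega> \<N> \<and> theon_limit T \<Omega> \<N> = \<phi> \<and>
        (\<forall>P\<in>preds T. peon_independent \<Omega> (arity T P) (\<N> P) l))"


section \<open>Unique coupleability and unique inducibility\<close>

text \<open>
  Every finite language is a renaming of one with predicate symbols in \<open>nat\<close>, hence it is enough
  to let the theory \<open>T'\<close> range over theories with such symbols.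
\<close>

definition UCouple :: "'x itself \<Rightarrow> nat \<Rightarrow> 'p univ_theory \<Rightarrow> 'p limit_obj \<Rightarrow> bool" where
  "UCouple X l T \<phi> \<longleftrightarrow>
     (\<forall>(T' :: nat univ_theory). canonical T' \<longrightarrow>
        (\<forall>\<psi>\<in>Hom_pos T'. limit_rank X T' \<psi> \<le> l \<longrightarrow> uniquely_coupleable T T' \<phi> \<psi>))"

definition complete_hypergraph :: "nat \<Rightarrow> unit rel_struct \<Rightarrow> bool" where
  "complete_hypergraph l G \<longleftrightarrow>
     rel G () = {xs. length xs = l \<and> distinct xs \<and> set xs \<subseteq> verts G}"

definition UInduce :: "nat \<Rightarrow> 'p univ_theory \<Rightarrow> 'p limit_obj \<Rightarrow> bool" where
  "UInduce l T \<phi> \<longleftrightarrow> l = 0 \<or>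
     (let H = hypergraph_theory l in
      \<forall>\<psi>\<in>Hom_pos H. \<forall>\<xi>\<in>couplings T H \<phi> \<psi>. \<forall>M\<in>finite_models (T \<oplus>\<^sub>T H).
        complete_hypergraph l (interp_struct H (erase_right H) M) \<longrightarrow>
        \<xi> (iso_class (T \<oplus>\<^sub>T H) M) = indep_coupling T H \<phi> \<psi> (iso_class (T \<oplus>\<^sub>T H) M))"

end

theory Submission
  imports Defs "HOL-Library.Diagonal_Subsequence" "HOL-Real_Asymp.Real_Asymp"
begin

text \<open>
  The key point is that a coupling \<open>\<xi>\<close> of \<open>\<phi>\<^sup>I\<close> and \<open>\<psi>\<close> lifts to a coupling of \<open>\<phi>\<close> and \<open>\<psi>\<close>.
  A limit object induces for every \<open>n\<close> a probability distribution on the models with vertex set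
  \<open>{..<n}\<close>.  The distributions of \<open>\<phi>\<close> and \<open>\<xi>\<close> have the same image on the models of \<open>T1\<close>, so they
  can be joined to a distribution on models of \<open>T2 \<oplus>\<^sub>T T'\<close>.  By a variance bound, densities in a random model
  concentrate, so some model in the support of the joining approximates both \<open>\<phi>\<close> and \<open>\<xi>\<close>; a
  subsequential limit of these models, as \<open>n\<close> grows, is the required lift.  No ergodic decomposition of the joint
  distribution is needed.

  For theons, \<open>I(P)\<close> is evaluated at the structure that the coordinates determine on the vertices of a tuple.
\<close>

section \<open>Structures and isomorphisms\<close>

text \<open>The obstacle is that the joinings built for different \<open>n\<close> need not be
  compatible with one another, and that a compatible family would only give an exchangeable law,
  possibly a mixture of limit objects, whereas a coupling has to be a single limit object. Hence one
  model is selected for each \<open>n\<close>, and only its two images are controlled: each has to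
  be close to its own limit object, which the variance bound makes likely under any joining of the
  two laws. The lift has the same \<open>T'\<close> part as the given coupling, so it couples \<phi>
  with \<psi> and the hypothesis on \<phi> applies to it. Pushing the independent coupling forward
  along \<open>I\<close>, extended by the identity on \<open>T'\<close>, gives an independent
  coupling again, because the \<open>T'\<close> factor is constant on fibres. For inducibility the
  hypergraph is constant on fibres too, so completeness is passed on. Canonicity of
  \<open>T1\<close> matters for theons: sampled relations contain only injective tuples, and
  interpreted relations must not contain others.\<close>

lemma eval_cong:
  assumes "\<And>i. i \<in> qf_vars F \<Longrightarrow> s i = s' i"
  shows "eval M s F \<longleftrightarrow> eval M s' F"
  using assms
proof (induction F)
  case (Atom P xs)
  then have "map s xs = map s' xs" by simp
  then show ?case by (simp only: eval.simps)
qed auto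

lemma is_isoD:
  assumes "is_iso f M N"
  shows "bij_betw f (verts M) (verts N)"
    and "set xs \<subseteq> verts M \<Longrightarrow> xs \<in> rel M P \<longleftrightarrow> map f xs \<in> rel N P"
  using assms by (auto simp: is_iso_def)

lemma eval_iso:
  assumes "is_iso f M N" "s ` qf_vars F \<subseteq> verts M"
  shows "eval M s F \<longleftrightarrow> eval N (f \<circ> s) F"
  using assms(2)
proof (induction F)
  case (Equal i j)
  then show ?case
    using is_isoD(1)[OF assms(1)] by (auto simp: bij_betw_def inj_on_eq_iff)
next
  case (Atom P xs)
  then have "set (map s xs) \<subseteq> verts M" by auto
  from is_isoD(2)[OF assms(1) this] show ?case by (simp add: comp_def)
qed auto

lemma is_iso_refl: "is_iso id M M"
  by (auto simp: is_iso_def)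

lemma is_iso_cong:
  assumes "\<And>x. x \<in> verts M \<Longrightarrow> f x = g x" "is_iso f M N"
  shows "is_iso g M N"
  unfolding is_iso_def
proof (intro conjI allI impI)
  show "bij_betw g (verts M) (verts N)"
    using is_isoD(1)[OF assms(2)] assms(1) bij_betw_cong by metis
  fix P xs assume xs: "set xs \<subseteq> verts M"
  then have eq: "map g xs = map f xs" using assms(1) by auto
  show "xs \<in> rel M P \<longleftrightarrow> map g xs \<in> rel N P"
    unfolding eq by (rule is_isoD(2)[OF assms(2) xs])
qed

lemma is_iso_sym:
  assumes "is_iso f M N"
  shows "is_iso (inv_into (verts M) f) N M"
  unfolding is_iso_def
proof safe
  let ?g = "inv_into (verts M) f"
  note bij = is_isoD(1)[OF assms]
  show g: "bij_betw ?g (verts N) (verts M)" by (rule bij_betw_inv_into[OF bij])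
  fix P xs assume xs: "set xs \<subseteq> verts N"
  have "map f (map ?g xs) = xs"
    using xs bij by (simp add: bij_betw_inv_into_right map_idI subset_iff)
  moreover have "set (map ?g xs) \<subseteq> verts M"
    using g xs by (auto simp: bij_betw_def)
  ultimately show "xs \<in> rel N P \<Longrightarrow> map ?g xs \<in> rel M P" "map ?g xs \<in> rel M P \<Longrightarrow> xs \<in> rel N P"
    using is_isoD(2)[OF assms] by metis+
qed

lemma is_iso_trans:
  assumes "is_iso f M N" "is_iso g N K"
  shows "is_iso (g \<circ> f) M K"
  unfolding is_iso_def
proof (intro conjI allI impI)
  show "bij_betw (g \<circ> f) (verts M) (verts K)"
    using assms is_isoD(1) bij_betw_trans by blast
  fix P xs assume xs: "set xs \<subseteq> verts M"
  then have "set (map f xs) \<subseteq> verts N"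
    using is_isoD(1)[OF assms(1)] by (auto simp: bij_betw_def)
  then show "xs \<in> rel M P \<longleftrightarrow> map (g \<circ> f) xs \<in> rel K P"
    using is_isoD(2)[OF assms(1) xs] is_isoD(2)[OF assms(2)] by (metis map_map)
qed

lemma isomorphic_refl: "M \<cong>\<^sub>S M"
  using is_iso_refl unfolding isomorphic_def by blast

lemma isomorphic_sym: "M \<cong>\<^sub>S N \<Longrightarrow> N \<cong>\<^sub>S M"
  using is_iso_sym unfolding isomorphic_def by blast

lemma isomorphic_trans: "M \<cong>\<^sub>S N \<Longrightarrow> N \<cong>\<^sub>S K \<Longrightarrow> M \<cong>\<^sub>S K"
  using is_iso_trans unfolding isomorphic_def by blast

lemma isomorphic_cong_right: "M \<cong>\<^sub>S N \<Longrightarrow> K \<cong>\<^sub>S M \<longleftrightarrow> K \<cong>\<^sub>S N"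
  using isomorphic_sym isomorphic_trans by blast

lemma isomorphic_cong_left: "M \<cong>\<^sub>S N \<Longrightarrow> M \<cong>\<^sub>S K \<longleftrightarrow> N \<cong>\<^sub>S K"
  using isomorphic_sym isomorphic_trans by blast

lemma isomorphic_card: "M \<cong>\<^sub>S N \<Longrightarrow> card (verts M) = card (verts N)"
  using is_isoD(1) bij_betw_same_card unfolding isomorphic_def by blast

lemma struct_eqI:
  fixes M N :: "'p rel_struct"
  shows "verts M = verts N \<Longrightarrow> (\<And>P. rel M P = rel N P) \<Longrightarrow> M = N"
  by (cases M; cases N) auto

lemma struct_overD:
  assumes "struct_over L M" "xs \<in> rel M P"
  shows "P \<in> preds L" "set xs \<subseteq> verts M" "length xs = arity L P"
proof -
  show P: "P \<in> preds L" using assms by (auto simp: struct_over_def)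
  have "rel M P \<subseteq> {xs. set xs \<subseteq> verts M \<and> length xs = arity L P}"
    using assms(1) P unfolding struct_over_def by blast
  then show "set xs \<subseteq> verts M" "length xs = arity L P" using assms(2) by auto
qed

lemma struct_overI:
  assumes "\<And>P xs. xs \<in> rel M P \<Longrightarrow> P \<in> preds L \<and> set xs \<subseteq> verts M \<and> length xs = arity L P"
  shows "struct_over L M"
  using assms unfolding struct_over_def by blast

lemma eval_induced:
  assumes "s ` qf_vars F \<subseteq> W"
  shows "eval (induced N W) s F \<longleftrightarrow> eval N s F"
  using assms by (induction F) (auto simp: induced_def)

lemma verts_induced [simp]: "verts (induced N W) = W"
  by (simp add: induced_def)

lemma model_struct_over: "model T M \<Longrightarrow> struct_over T M"
  by (simp add: model_def)

text \<open>Axioms are universal: an assignment into \<open>W\<close> is also one into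
  \<open>N\<close>, and quantifier-free truth sees only the values of the assignment.\<close>

lemma model_induced:
  assumes "model T N" "W \<subseteq> verts N"
  shows "model T (induced N W)"
  unfolding model_def
proof (intro conjI ballI)
  show "struct_over T (induced N W)"
    using struct_overD[OF model_struct_over[OF assms(1)]]
    by (intro struct_overI) (auto simp: induced_def)
  fix F assume "F \<in> axioms T"
  then have "satisfies N F" using assms by (simp add: model_def)
  then show "satisfies (induced N W) F"
    using assms(2) eval_induced[of _ F W N] unfolding satisfies_def
    by (metis verts_induced order_trans)
qed

text \<open>\<open>is_iso\<close> does not restrict tuples of \<open>N\<close> that leave its vertex
  set, so \<open>struct_over T N\<close> has to be assumed.\<close>

lemma model_iso:
  assumes "model T M" "is_iso f M N" "struct_over T N"
  shows "model T N"
  unfolding model_def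
proof (intro conjI ballI)
  fix F assume "F \<in> axioms T"
  then have sat: "satisfies M F" using assms by (simp add: model_def)
  let ?g = "inv_into (verts M) f"
  have iso: "is_iso ?g N M" by (rule is_iso_sym[OF assms(2)])
  show "satisfies N F" unfolding satisfies_def
  proof (intro allI impI)
    fix s assume s: "s ` qf_vars F \<subseteq> verts N"
    have "(?g \<circ> s) ` qf_vars F \<subseteq> verts M"
      using s is_isoD(1)[OF iso] by (auto simp: bij_betw_def)
    then show "eval N s F"
      using eval_iso[OF iso s] sat by (simp add: satisfies_def)
  qed
qed (fact assms)

text \<open>The substructure that \<open>N\<close> induces on the entries of \<open>xs\<close>,
  relabelled by positions. In this labelled form isomorphism of samples becomes equality, so that
  laws of random samples are measures on a finite set.\<close>

definition pull :: "nat list \<Rightarrow> 'p rel_struct \<Rightarrow> 'p rel_struct" where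
  "pull xs N = \<lparr> verts = {..<length xs},
     rel = (\<lambda>P. {ys. set ys \<subseteq> {..<length xs} \<and> map ((!) xs) ys \<in> rel N P}) \<rparr>"

lemma verts_pull [simp]: "verts (pull xs N) = {..<length xs}"
  by (simp add: pull_def)

lemma rel_pull: "ys \<in> rel (pull xs N) P \<longleftrightarrow> set ys \<subseteq> {..<length xs} \<and> map ((!) xs) ys \<in> rel N P"
  by (simp add: pull_def)

lemma rel_induced: "xs \<in> rel (induced N W) P \<longleftrightarrow> xs \<in> rel N P \<and> set xs \<subseteq> W"
  by (simp add: induced_def)

lemma nth_image_eq: "(!) xs ` {..<length xs} = set xs"
  by (metis atLeast_upt image_set map_nth set_upt)

lemma pull_iso:
  assumes "distinct xs"
  shows "is_iso ((!) xs) (pull xs N) (induced N (set xs))"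
  unfolding is_iso_def
proof (intro conjI allI impI)
  show "bij_betw ((!) xs) (verts (pull xs N)) (verts (induced N (set xs)))"
    using assms by (simp add: bij_betw_def inj_on_nth nth_image_eq)
qed (auto simp: rel_pull rel_induced)

lemma struct_over_pull: "struct_over L N \<Longrightarrow> struct_over L (pull xs N)"
  by (rule struct_overI) (auto simp: rel_pull dest: struct_overD)

lemma model_pull:
  assumes "model T N" "distinct xs" "set xs \<subseteq> verts N"
  shows "model T (pull xs N)"
proof -
  have "model T (induced N (set xs))" using assms by (simp add: model_induced)
  then show ?thesis
    using is_iso_sym[OF pull_iso[OF assms(2)]] model_iso struct_over_pull model_struct_over assms(1)
    by blast
qed

text \<open>A sample of a sample is a sample; this lets densities of a random sample be computed in
  the host structure.\<close>

lemma pull_pull: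
  assumes "set ys \<subseteq> {..<length xs}"
  shows "pull ys (pull xs N) = pull (map ((!) xs) ys) N"
proof (rule struct_eqI)
  fix P
  have "map ((!) xs) (map ((!) ys) zs) = map ((!) (map ((!) xs) ys)) zs \<and> set (map ((!) ys) zs) \<subseteq> {..<length xs}"
    if "set zs \<subseteq> {..<length ys}" for zs
    using that assms nth_mem by (fastforce simp: subset_iff)
  then show "rel (pull ys (pull xs N)) P = rel (pull (map ((!) xs) ys) N) P"
    by (auto simp: rel_pull simp del: map_map)
qed simp

text \<open>An embedding of \<open>K\<close>, listed by its values, is a tuple that pulls
  \<open>N\<close> back to \<open>K\<close> itself. The hypothesis \<open>struct_over\<close>
  excludes tuples of \<open>K\<close> outside \<open>{..<m}\<close>, which \<open>is_iso\<close>
  does not see.\<close>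

lemma pull_eq_of_iso:
  assumes "is_iso f K (induced N W)" "verts K = {..<m}" "struct_over L K"
  shows "pull (map f [0..<m]) N = K"
proof (rule struct_eqI)
  fix P
  have im: "f ` {..<m} = W" using is_isoD(1)[OF assms(1)] assms(2) by (auto simp: bij_betw_def)
  have "ys \<in> rel (pull (map f [0..<m]) N) P \<longleftrightarrow> ys \<in> rel K P" for ys
  proof (cases "set ys \<subseteq> {..<m}")
    case True
    then have eq: "map ((!) (map f [0..<m])) ys = map f ys" by (auto simp: subset_iff)
    moreover have "set (map f ys) \<subseteq> W" using True im by auto
    ultimately show ?thesis
      using is_isoD(2)[OF assms(1), of ys P] True assms(2) unfolding rel_pull eq rel_induced by simp
  next
    case False
    then show ?thesis
      using struct_overD(2)[OF assms(3)] assms(2) by (auto simp: rel_pull)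
  qed
  then show "rel (pull (map f [0..<m]) N) P = rel K P" by auto
qed (simp add: assms)

lemma isomorphic_induced_pull: "distinct xs \<Longrightarrow> induced N (set xs) \<cong>\<^sub>S pull xs N"
  using pull_iso isomorphic_sym unfolding isomorphic_def by blast

text \<open>Labelled models of size \<open>m\<close>: a finite sample space (for finite languages)
  that meets every isomorphism class of size \<open>m\<close>.\<close>

definition mods :: "'p univ_theory \<Rightarrow> nat \<Rightarrow> 'p rel_struct set" where
  "mods T m = {K. model T K \<and> verts K = {..<m}}"

lemma modsD:
  assumes "K \<in> mods T m"
  shows "model T K" "verts K = {..<m}" "struct_over T K" "K \<in> finite_models T"
  using assms by (auto simp: mods_def model_def finite_models_def)

lemma finite_mods:
  assumes "wf_language T"
  shows "finite (mods T m)"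
proof -
  let ?B = "PiE (preds T) (\<lambda>P. Pow {xs. set xs \<subseteq> {..<m} \<and> length xs = arity T P})"
  have fin: "finite ?B"
    using assms by (intro finite_PiE) (auto simp: wf_language_def finite_lists_length_eq)
  have im: "(\<lambda>K. restrict (rel K) (preds T)) ` mods T m \<subseteq> ?B"
    using struct_overD[OF modsD(3)] modsD(2) by fastforce
  \<comment> \<open>Relations are empty outside the language, so restricting them to
    \<open>preds T\<close> loses nothing.\<close>
  have inj: "inj_on (\<lambda>K. restrict (rel K) (preds T)) (mods T m)"
  proof (rule inj_onI, rule struct_eqI)
    fix K K' P assume *: "K \<in> mods T m" "K' \<in> mods T m"
      "restrict (rel K) (preds T) = restrict (rel K') (preds T)"
    show "verts K = verts K'" using * by (simp add: modsD(2))
    show "rel K P = rel K' P"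
    proof (cases "P \<in> preds T")
      case True
      then show ?thesis using *(3) by (metis restrict_apply')
    next
      case False
      then show ?thesis using *(1,2) modsD(3) unfolding struct_over_def by metis
    qed
  qed
  show ?thesis by (rule inj_on_finite[OF inj im fin])
qed

lemma pull_in_mods:
  "model T N \<Longrightarrow> distinct xs \<Longrightarrow> set xs \<subseteq> verts N \<Longrightarrow> length xs = m \<Longrightarrow> pull xs N \<in> mods T m"
  by (simp add: mods_def model_pull)

lemma obtain_mods:
  assumes "M \<in> finite_models T"
  obtains K where "K \<in> mods T (card (verts M))" "M \<cong>\<^sub>S K"
proof -
  have fin: "finite (verts M)" and M: "model T M" using assms by (auto simp: finite_models_def)
  obtain xs where xs: "set xs = verts M" "distinct xs" using finite_distinct_list[OF fin] by blast
  have "induced M (verts M) = M"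
    using struct_overD[OF model_struct_over[OF M]] by (intro struct_eqI) (auto simp: rel_induced)
  then have "M \<cong>\<^sub>S pull xs M" using isomorphic_induced_pull[OF xs(2), of M] xs(1) by simp
  moreover have "pull xs M \<in> mods T (card (verts M))"
    using xs M by (intro pull_in_mods) (auto simp: distinct_card[symmetric])
  ultimately show ?thesis using that by blast
qed

section \<open>Isomorphism classes\<close>

lemma iso_rel_equiv: "equiv (finite_models T) (iso_rel T)"
  unfolding iso_rel_def
  by (intro equivI refl_onI symI transI) (auto intro: isomorphic_refl isomorphic_sym isomorphic_trans)

lemma iso_class_in: "M \<in> finite_models T \<Longrightarrow> iso_class T M \<in> iso_classes T"
  by (simp add: iso_class_def iso_classes_def quotientI)

lemma iso_class_eq_iff:
  assumes "M \<in> finite_models T" "N \<in> finite_models T"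
  shows "iso_class T M = iso_class T N \<longleftrightarrow> M \<cong>\<^sub>S N"
  using eq_equiv_class_iff[OF iso_rel_equiv assms] assms by (auto simp: iso_class_def iso_rel_def)

lemma rep_in:
  assumes "C \<in> iso_classes T"
  shows "rep C \<in> finite_models T" "iso_class T (rep C) = C"
proof -
  have "C \<noteq> {}" using assms in_quotient_imp_non_empty[OF iso_rel_equiv] by (auto simp: iso_classes_def)
  then have r: "rep C \<in> C" by (simp add: rep_def some_in_eq)
  then show f: "rep C \<in> finite_models T"
    using assms in_quotient_imp_subset[OF iso_rel_equiv] by (auto simp: iso_classes_def)
  obtain M where M: "M \<in> finite_models T" "C = iso_class T M"
    using assms by (auto simp: iso_classes_def iso_class_def quotient_def)
  then have "M \<cong>\<^sub>S rep C" using r by (auto simp: iso_class_def iso_rel_def)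
  then show "iso_class T (rep C) = C" using M f iso_class_eq_iff by blast
qed

lemma rep_iso_class:
  assumes "M \<in> finite_models T"
  shows "rep (iso_class T M) \<cong>\<^sub>S M"
  using rep_in[OF iso_class_in[OF assms]] iso_class_eq_iff[OF _ assms] by blast

lemma iso_classes_mods:
  assumes "C \<in> iso_classes T"
  obtains K where "K \<in> mods T (card (verts (rep C)))" "C = iso_class T K" "rep C \<cong>\<^sub>S K"
proof -
  obtain K where K: "K \<in> mods T (card (verts (rep C)))" "rep C \<cong>\<^sub>S K"
    using obtain_mods rep_in(1)[OF assms] by blast
  then have "C = iso_class T K"
    using iso_class_eq_iff rep_in[OF assms] modsD(4) by metis
  then show ?thesis using that K by blast
qed

lemma iso_classes_mods_image:
  "C \<in> iso_classes T \<Longrightarrow> C \<in> iso_class T ` mods T (card (verts (rep C)))"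
  by (erule iso_classes_mods) (rule image_eqI)

lemma countable_iso_classes:
  assumes "wf_language T"
  shows "countable (iso_classes T)"
proof (rule countable_subset)
  show "iso_classes T \<subseteq> (\<Union>m. iso_class T ` mods T m)"
    using iso_classes_mods_image by fast
  show "countable (\<Union>m. iso_class T ` mods T m)"
    by (rule countable_UN) (auto intro: countable_finite finite_imageI finite_mods[OF assms])
qed

lemma finite_iso_classes_card:
  assumes "wf_language T"
  shows "finite {C \<in> iso_classes T. card (verts (rep C)) = m}"
proof (rule finite_subset)
  show "{C \<in> iso_classes T. card (verts (rep C)) = m} \<subseteq> iso_class T ` mods T m"
    using iso_classes_mods_image by fast
qed (simp add: finite_mods[OF assms])

lemma aut_card_pos:
  assumes "finite (verts M)"
  shows "card (aut M) > 0"
proof -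
  have "finite (aut M)"
    by (rule finite_subset[OF _ finite_permutations[OF assms]]) (auto simp: aut_def)
  moreover have "id \<in> aut M" by (simp add: aut_def is_iso_refl permutes_id)
  ultimately show ?thesis by (auto simp: card_gt_0_iff)
qed

section \<open>Interpretations\<close>

lemma verts_interp [simp]: "verts (interp_struct T1 I K) = verts K"
  by (simp add: interp_struct_def)

lemma rel_interp:
  "xs \<in> rel (interp_struct T1 I K) P \<longleftrightarrow>
     P \<in> preds T1 \<and> length xs = arity T1 P \<and> set xs \<subseteq> verts K \<and> eval K (\<lambda>i. xs ! i) (I P)"
  by (simp add: interp_struct_def)

lemma struct_over_interp: "struct_over T1 (interp_struct T1 I K)"
  by (rule struct_overI) (auto simp: rel_interp)

lemma open_interpretationD:
  assumes "open_interpretation T1 T2 I"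
  shows "P \<in> preds T1 \<Longrightarrow> qf_vars (I P) \<subseteq> {..<arity T1 P}"
    and "model T2 K \<Longrightarrow> model T1 (interp_struct T1 I K)"
    and "K \<in> finite_models T2 \<Longrightarrow> interp_struct T1 I K \<in> finite_models T1"
    and "K \<in> mods T2 m \<Longrightarrow> interp_struct T1 I K \<in> mods T1 m"
  using assms by (auto simp: open_interpretation_def finite_models_def mods_def)

text \<open>Quantifier-free truth is preserved in both directions. The variables of
  \<open>I P\<close> lie below the arity, so \<open>(!) xs\<close> is only read inside the
  tuple.\<close>

lemma interp_iso:
  assumes "open_interpretation T1 T2 I" "is_iso f M N"
  shows "is_iso f (interp_struct T1 I M) (interp_struct T1 I N)"
  unfolding is_iso_def
proof (intro conjI allI impI)
  show "bij_betw f (verts (interp_struct T1 I M)) (verts (interp_struct T1 I N))"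
    using is_isoD(1)[OF assms(2)] by simp
  fix P xs assume "set xs \<subseteq> verts (interp_struct T1 I M)"
  then have xs: "set xs \<subseteq> verts M" by simp
  have set: "set (map f xs) \<subseteq> verts N" using xs is_isoD(1)[OF assms(2)] by (auto simp: bij_betw_def)
  have "eval M ((!) xs) (I P) = eval N ((!) (map f xs)) (I P)"
    if P: "P \<in> preds T1" "length xs = arity T1 P"
  proof -
    have vars: "qf_vars (I P) \<subseteq> {..<length xs}" using open_interpretationD(1)[OF assms(1)] P by simp
    then have "((!) xs) ` qf_vars (I P) \<subseteq> verts M" using xs nth_mem by fastforce
    then have "eval M ((!) xs) (I P) = eval N (f \<circ> (!) xs) (I P)" by (rule eval_iso[OF assms(2)])
    also have "\<dots> = eval N ((!) (map f xs)) (I P)" using vars by (intro eval_cong) auto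
    finally show ?thesis .
  qed
  then show "xs \<in> rel (interp_struct T1 I M) P \<longleftrightarrow> map f xs \<in> rel (interp_struct T1 I N) P"
    using set xs by (auto simp: rel_interp)
qed

lemma interp_isomorphic:
  "open_interpretation T1 T2 I \<Longrightarrow> M \<cong>\<^sub>S N \<Longrightarrow> interp_struct T1 I M \<cong>\<^sub>S interp_struct T1 I N"
  using interp_iso unfolding isomorphic_def by blast

text \<open>Truth of a quantifier-free formula depends only on the vertices named by the assignment,
  so interpreting commutes with passing to a subset; this allows densities to be pushed
  forward.\<close>

lemma interp_induced:
  assumes "open_interpretation T1 T2 I" "W \<subseteq> verts N"
  shows "induced (interp_struct T1 I N) W = interp_struct T1 I (induced N W)"
proof (rule struct_eqI)
  fix P
  have "eval (induced N W) ((!) xs) (I P) = eval N ((!) xs) (I P)"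
    if "P \<in> preds T1" "length xs = arity T1 P" "set xs \<subseteq> W" for xs
  proof (rule eval_induced)
    show "(!) xs ` qf_vars (I P) \<subseteq> W"
      using open_interpretationD(1)[OF assms(1) that(1)] that nth_mem by fastforce
  qed
  then show "rel (induced (interp_struct T1 I N) W) P = rel (interp_struct T1 I (induced N W)) P"
    using assms(2) by (auto simp: rel_interp rel_induced subset_iff)
qed simp

lemma interp_pull:
  assumes "open_interpretation T1 T2 I" "distinct xs" "set xs \<subseteq> verts N"
  shows "pull xs (interp_struct T1 I N) = interp_struct T1 I (pull xs N)"
proof -
  have "is_iso ((!) xs) (interp_struct T1 I (pull xs N)) (induced (interp_struct T1 I N) (set xs))"
    using interp_iso[OF assms(1) pull_iso[OF assms(2)]] interp_induced[OF assms(1,3)] by simp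
  then have "pull (map ((!) xs) [0..<length xs]) (interp_struct T1 I N) = interp_struct T1 I (pull xs N)"
    by (rule pull_eq_of_iso[OF _ _ struct_over_interp]) simp
  then show ?thesis by (simp add: map_nth)
qed

section \<open>Labelled densities and convergence\<close>

definition dlists :: "nat \<Rightarrow> 'a set \<Rightarrow> 'a list set" where
  "dlists m V = {xs. length xs = m \<and> distinct xs \<and> set xs \<subseteq> V}"

lemma dlistsD:
  assumes "xs \<in> dlists m V"
  shows "length xs = m" "distinct xs" "set xs \<subseteq> V"
  using assms by (auto simp: dlists_def)

lemma finite_dlists: "finite V \<Longrightarrow> finite (dlists m V)"
  by (rule finite_subset[OF _ finite_subset_distinct[of V]]) (auto simp: dlists_def)

lemma card_dlists:
  assumes "finite V"
  shows "card (dlists m V) = fact m * (card V choose m)"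
proof (cases "m \<le> card V")
  case True
  have "card (dlists m V) = fact (card V) div fact (card V - m)"
    unfolding dlists_def card_lists_distinct_length_eq[OF assms True]
    using fact_div_fact[of "card V - m" "card V"] by simp
  then have "card (dlists m V) * fact (card V - m) = fact (card V)"
    by (simp add: fact_dvd)
  also have "\<dots> = fact m * (card V choose m) * fact (card V - m)"
    using binomial_fact_lemma[OF True] by (simp add: mult.commute mult.left_commute)
  finally show ?thesis by simp
next
  case False
  have "length xs \<le> card V" if "xs \<in> dlists m V" for xs
    using card_mono[OF assms dlistsD(3)[OF that]] distinct_card[OF dlistsD(2)[OF that]] by simp
  then have "dlists m V = {}" using False dlistsD(1) by fastforce
  with False show ?thesis by (simp add: binomial_eq_0)
qed

section \<open>Automorphisms and labelled copies\<close>

lemma card_aut_le: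
  assumes "is_iso f M N" "finite (verts N)"
  shows "card (aut M) \<le> card (aut N)"
proof -
  let ?g = "inv_into (verts M) f"
  \<comment> \<open>Conjugation by \<open>f\<close> embeds the automorphisms of \<open>M\<close>
    into those of \<open>N\<close>. It is continued by the identity because elements of
    \<open>aut\<close> are permutations of all of \<open>nat\<close>.\<close>
  let ?c = "\<lambda>p x. if x \<in> verts N then f (p (?g x)) else x"
  note bij = is_isoD(1)[OF assms(1)]
  have iso_c: "is_iso (?c p) N N" if "is_iso p M M" for p
  proof -
    have *: "is_iso (f \<circ> (p \<circ> ?g)) N N"
      using is_iso_trans is_iso_sym that assms(1) by blast
    show ?thesis by (rule is_iso_cong[OF _ *]) simp
  qed
  have "?c ` aut M \<subseteq> aut N"
  proof safe
    fix p assume "p \<in> aut M"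
    then have "is_iso p M M" by (simp add: aut_def)
    from iso_c[OF this] show "?c p \<in> aut N"
      using is_isoD(1) bij_imp_permutes[of "?c p" "verts N"] by (auto simp: aut_def)
  qed
  moreover have "inj_on ?c (aut M)"
  proof (rule inj_onI)
    fix p q assume pq: "p \<in> aut M" "q \<in> aut M" "?c p = ?c q"
    show "p = q"
    proof
      fix x
      show "p x = q x"
      proof (cases "x \<in> verts M")
        case True
        then have fx: "f x \<in> verts N" and g: "?g (f x) = x"
          using bij by (auto simp: bij_betw_def)
        have "?c p (f x) = ?c q (f x)" using pq(3) by meson
        then have "f (p x) = f (q x)" using fx g by simp
        moreover have "p x \<in> verts M" "q x \<in> verts M"
          using True pq permutes_in_image by (fastforce simp: aut_def)+
        ultimately show ?thesis using bij by (auto simp: bij_betw_def inj_on_eq_iff)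
      next
        case False
        then show ?thesis using pq by (auto simp: aut_def permutes_def)
      qed
    qed
  qed
  moreover have "finite (aut N)"
    by (rule finite_subset[OF _ finite_permutations[OF assms(2)]]) (auto simp: aut_def)
  ultimately show ?thesis using card_inj_on_le by blast
qed

lemma card_aut_isomorphic:
  assumes "M \<cong>\<^sub>S N" "finite (verts M)" "finite (verts N)"
  shows "card (aut M) = card (aut N)"
  using assms card_aut_le isomorphic_sym unfolding isomorphic_def by (metis le_antisym)

text \<open>Once an isomorphism \<open>f\<close> from \<open>K\<close> onto the substructure on
  \<open>W\<close> is fixed, every listing of \<open>W\<close> that pulls back to \<open>K\<close>
  is \<open>f\<close> composed with exactly one automorphism of \<open>K\<close>.\<close>

lemma card_pull_eq_fixed_range:
  assumes K: "verts K = {..<m}" "struct_over L K" and W: "induced N W \<cong>\<^sub>S K"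
  shows "card {xs. distinct xs \<and> set xs = W \<and> pull xs N = K} = card (aut K)"
proof -
  obtain f where f: "is_iso f K (induced N W)"
    using isomorphic_sym[OF W] unfolding isomorphic_def by blast
  let ?g = "inv_into (verts K) f"
  have g: "is_iso ?g (induced N W) K" by (rule is_iso_sym[OF f])
  have fW: "inj_on f {..<m}" "f ` {..<m} = W"
    using is_isoD(1)[OF f] K by (auto simp: bij_betw_def)
  have "bij_betw (\<lambda>p. map (f \<circ> p) [0..<m]) (aut K) {xs. distinct xs \<and> set xs = W \<and> pull xs N = K}"
    unfolding bij_betw_def
  proof (intro conjI equalityI subsetI)
    show "inj_on (\<lambda>p. map (f \<circ> p) [0..<m]) (aut K)"
    proof (rule inj_onI)
      fix p q assume pq: "p \<in> aut K" "q \<in> aut K" "map (f \<circ> p) [0..<m] = map (f \<circ> q) [0..<m]"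
      show "p = q"
      proof
        fix x
        show "p x = q x"
        proof (cases "x < m")
          case True
          then have "f (p x) = f (q x)" using pq(3) by simp
          moreover have "p x \<in> {..<m}" "q x \<in> {..<m}"
            using True pq permutes_in_image K(1) by (fastforce simp: aut_def)+
          ultimately show ?thesis using fW(1) by (auto simp: inj_on_eq_iff)
        next
          case False
          then show ?thesis using pq K(1) by (auto simp: aut_def permutes_def)
        qed
      qed
    qed
  next
    fix xs assume "xs \<in> (\<lambda>p. map (f \<circ> p) [0..<m]) ` aut K"
    then obtain p where p: "p \<in> aut K" "xs = map (f \<circ> p) [0..<m]" by blast
    have iso: "is_iso (f \<circ> p) K (induced N W)"
      using p(1) f is_iso_trans by (auto simp: aut_def)
    have "bij_betw (f \<circ> p) {..<m} W" using is_isoD(1)[OF iso] K(1) by simp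
    then have "distinct xs" "set xs = W"
      unfolding p(2) by (auto simp: distinct_map bij_betw_def lessThan_atLeast0)
    moreover have "pull xs N = K" unfolding p(2) by (rule pull_eq_of_iso[OF iso K])
    ultimately show "xs \<in> {xs. distinct xs \<and> set xs = W \<and> pull xs N = K}" by simp
  next
    fix xs assume "xs \<in> {xs. distinct xs \<and> set xs = W \<and> pull xs N = K}"
    then have xs: "distinct xs" "set xs = W" "pull xs N = K" by auto
    then have len: "length xs = m" using K(1) verts_pull[of xs N] by simp
    define p where "p = (\<lambda>i. if i < m then ?g (xs ! i) else i)"
    have iso: "is_iso (?g \<circ> (!) xs) K K"
      using is_iso_trans[OF _ g] pull_iso[OF xs(1), of N] xs by simp
    have "is_iso p K K" by (rule is_iso_cong[OF _ iso]) (simp add: p_def K(1))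
    moreover from this have "p permutes verts K"
      by (rule bij_imp_permutes[OF is_isoD(1)]) (simp add: p_def K(1))
    ultimately have "p \<in> aut K" by (simp add: aut_def)
    moreover have "map (f \<circ> p) [0..<m] = xs"
    proof (rule nth_equalityI)
      fix i assume "i < length (map (f \<circ> p) [0..<m])"
      then have i: "i < m" by simp
      then have "xs ! i \<in> f ` {..<m}" using xs(2) len fW(2) nth_mem by metis
      then show "map (f \<circ> p) [0..<m] ! i = xs ! i"
        using i K(1) by (simp add: p_def f_inv_into_f)
    qed (simp add: len)
    ultimately show "xs \<in> (\<lambda>p. map (f \<circ> p) [0..<m]) ` aut K" by (metis image_eqI)
  qed
  then show ?thesis by (simp add: bij_betw_same_card)
qed

lemma card_pull_eq:
  assumes K: "verts K = {..<m}" "struct_over L K" and N: "finite (verts N)"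
  shows "card {xs \<in> dlists m (verts N). pull xs N = K} =
    card (aut K) * card {W. W \<subseteq> verts N \<and> card W = m \<and> induced N W \<cong>\<^sub>S K}"
proof -
  let ?S = "{xs \<in> dlists m (verts N). pull xs N = K}"
  let ?W = "{W. W \<subseteq> verts N \<and> card W = m \<and> induced N W \<cong>\<^sub>S K}"
  have fin: "finite ?S" "finite ?W" using N by (auto simp: finite_dlists)
  have im: "set ` ?S \<subseteq> ?W"
    using isomorphic_induced_pull by (fastforce simp: dlists_def distinct_card)
  have "card ?S = (\<Sum>W\<in>?W. card {xs \<in> ?S. set xs = W})"
    using sum.group[OF fin im, of "\<lambda>_. 1::nat"] by simp
  also have "\<dots> = (\<Sum>W\<in>?W. card (aut K))"
  proof (rule sum.cong)
    fix W assume W: "W \<in> ?W"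
    have "{xs \<in> ?S. set xs = W} = {xs. distinct xs \<and> set xs = W \<and> pull xs N = K}"
      using W by (auto simp: dlists_def distinct_card)
    then show "card {xs \<in> ?S. set xs = W} = card (aut K)"
      using card_pull_eq_fixed_range[OF K] W by simp
  qed simp
  finally show ?thesis by simp
qed

text \<open>The finite counterpart of \<open>labelled\<close>: the probability that a uniformly
  random injective tuple pulls \<open>N\<close> back to exactly \<open>K\<close>. It is 0 when
  \<open>N\<close> is finite and too small to contain such tuples.\<close>

definition tdens :: "'p rel_struct \<Rightarrow> 'p rel_struct \<Rightarrow> real" where
  "tdens K N = real (card {xs \<in> dlists (card (verts K)) (verts N). pull xs N = K}) /
     real (card (dlists (card (verts K)) (verts N)))"

lemma tdens_density:
  assumes "K \<in> mods T m" "finite (verts N)"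
  shows "tdens K N = real (card (aut K)) / fact m * density K N"
  using card_pull_eq[OF modsD(2,3)[OF assms(1)] assms(2)] modsD(2)[OF assms(1)]
  by (simp add: tdens_def density_def card_dlists[OF assms(2)])

lemma density_isomorphic: "M \<cong>\<^sub>S M' \<Longrightarrow> density M N = density M' N"
  unfolding density_def by (simp add: isomorphic_card isomorphic_cong_right)

lemma density_nonneg: "density M N \<ge> 0"
  by (simp add: density_def)

lemma density_le_1:
  assumes "finite (verts N)"
  shows "density M N \<le> 1"
proof -
  have "card {W. W \<subseteq> verts N \<and> card W = card (verts M) \<and> induced N W \<cong>\<^sub>S M} \<le>
      card {W. W \<subseteq> verts N \<and> card W = card (verts M)}"
    using assms by (intro card_mono) auto
  then show ?thesis by (auto simp: density_def n_subsets[OF assms] divide_le_eq_1 not_less)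
qed

lemma labelled_isomorphic:
  assumes "M \<in> finite_models T" "N \<in> finite_models T" "M \<cong>\<^sub>S N"
  shows "labelled T \<phi> M = labelled T \<phi> N"
  unfolding labelled_def using assms iso_class_eq_iff[OF assms(1,2)]
  by (simp add: isomorphic_card card_aut_isomorphic finite_models_def)

lemma iso_class_labelled:
  assumes "M \<in> finite_models T"
  shows "\<phi> (iso_class T M) = fact (card (verts M)) / real (card (aut M)) * labelled T \<phi> M"
  using aut_card_pos[of M] assms by (simp add: labelled_def finite_models_def)

text \<open>The value at a class is recovered from \<open>labelled\<close> by a factor that depends
  on the model only, and every class contains a model on some \<open>{..<m}\<close>. Identities of
  limit objects can thus be checked on labelled models.\<close>

lemma limit_obj_eqI:
  assumes "\<phi> \<in> extensional (iso_classes T)" "\<phi>' \<in> extensional (iso_classes T)"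
    and "\<And>m K. K \<in> mods T m \<Longrightarrow> labelled T \<phi> K = labelled T \<phi>' K"
  shows "\<phi> = \<phi>'"
proof (rule extensionalityI[OF assms(1,2)])
  fix C assume "C \<in> iso_classes T"
  then obtain K m where K: "K \<in> mods T m" "C = iso_class T K" using iso_classes_mods by blast
  then show "\<phi> C = \<phi>' C"
    using assms(3)[OF K(1)] iso_class_labelled[OF modsD(4)[OF K(1)]] by metis
qed

text \<open>The witnessing sequence in the definition of \<open>Hom_pos\<close>, kept explicit so
  that interpretations can transport it.\<close>

definition converges_to :: "'p univ_theory \<Rightarrow> (nat \<Rightarrow> 'p rel_struct) \<Rightarrow> 'p limit_obj \<Rightarrow> bool" where
  "converges_to T N \<phi> \<longleftrightarrow> (\<forall>n. N n \<in> finite_models T) \<and> strict_mono (\<lambda>n. card (verts (N n))) \<and>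
     (\<forall>M\<in>finite_models T. (\<lambda>n. density M (N n)) \<longlonglongrightarrow> \<phi> (iso_class T M))"

lemma Hom_posE:
  assumes "\<phi> \<in> Hom_pos T"
  obtains N where "converges_to T N \<phi>"
  using assms unfolding Hom_pos_def converges_to_def by blast

lemma Hom_pos_extensional: "\<phi> \<in> Hom_pos T \<Longrightarrow> \<phi> \<in> extensional (iso_classes T)"
  by (auto simp: Hom_pos_def PiE_def)

lemma Hom_posI:
  assumes "converges_to T N \<phi>" "\<phi> \<in> extensional (iso_classes T)"
  shows "\<phi> \<in> Hom_pos T"
proof -
  have "\<phi> C \<in> {0..1}" if "C \<in> iso_classes T" for C
  proof -
    have lim: "(\<lambda>n. density (rep C) (N n)) \<longlonglongrightarrow> \<phi> C"
      using assms(1) rep_in[OF that] unfolding converges_to_def by metis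
    have "finite (verts (N n))" for n using assms(1) by (simp add: converges_to_def finite_models_def)
    then show ?thesis
      using LIMSEQ_le_const[OF lim, of 0] LIMSEQ_le_const2[OF lim, of 1]
      by (simp add: density_nonneg density_le_1)
  qed
  then show ?thesis
    using assms unfolding Hom_pos_def converges_to_def by (auto simp: PiE_def)
qed

lemma conv_tdens:
  assumes "converges_to T N \<phi>" "K \<in> mods T m"
  shows "(\<lambda>n. tdens K (N n)) \<longlonglongrightarrow> labelled T \<phi> K"
proof -
  have "tdens K (N n) = real (card (aut K)) / fact m * density K (N n)" for n
    using assms(1) by (intro tdens_density[OF assms(2)]) (auto simp: converges_to_def finite_models_def)
  moreover have "(\<lambda>n. density K (N n)) \<longlonglongrightarrow> \<phi> (iso_class T K)"
    using assms(1) modsD(4)[OF assms(2)] by (auto simp: converges_to_def)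
  ultimately show ?thesis
    unfolding labelled_def modsD(2)[OF assms(2)] by (simp only: card_lessThan tendsto_mult_left)
qed

lemma conv_unique:
  assumes "converges_to T N \<phi>" "converges_to T N \<phi>'"
    "\<phi> \<in> extensional (iso_classes T)" "\<phi>' \<in> extensional (iso_classes T)"
  shows "\<phi> = \<phi>'"
  by (rule limit_obj_eqI[OF assms(3,4)])
    (rule LIMSEQ_unique[OF conv_tdens[OF assms(1)] conv_tdens[OF assms(2)]])

lemma interp_limit_extensional: "interp_limit T1 T2 I \<phi> \<in> extensional (iso_classes T1)"
  by (simp add: interp_limit_def)

text \<open>The subsets that count for \<open>M\<close> in the interpreted structure are sorted by
  the class they induce in \<open>N\<close>; these classes all belong to the index set of the
  sum.\<close>

lemma density_interp:
  assumes I: "open_interpretation T1 T2 I" and T2: "wf_language T2"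
    and M: "M \<in> finite_models T1" and N: "N \<in> finite_models T2"
  shows "density M (interp_struct T1 I N) =
    (\<Sum>D | D \<in> iso_classes T2 \<and> card (verts (rep D)) = card (verts M) \<and>
       interp_struct T1 I (rep D) \<cong>\<^sub>S M. density (rep D) N)"
proof -
  let ?m = "card (verts M)"
  let ?D = "{D. D \<in> iso_classes T2 \<and> card (verts (rep D)) = ?m \<and> interp_struct T1 I (rep D) \<cong>\<^sub>S M}"
  let ?W = "{W. W \<subseteq> verts N \<and> card W = ?m \<and> induced (interp_struct T1 I N) W \<cong>\<^sub>S M}"
  have finN: "finite (verts N)" and modN: "model T2 N" using N by (auto simp: finite_models_def)
  have ind: "induced N W \<in> finite_models T2" if "W \<subseteq> verts N" for W
    using that finN modN by (auto simp: finite_models_def model_induced finite_subset)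
  have finD: "finite ?D" by (rule finite_subset[OF _ finite_iso_classes_card[OF T2, of ?m]]) auto
  have finW: "finite ?W" using finN by simp
  have iso: "interp_struct T1 I (rep (iso_class T2 (induced N W))) \<cong>\<^sub>S induced (interp_struct T1 I N) W"
    if "W \<subseteq> verts N" for W
    using interp_isomorphic[OF I rep_iso_class[OF ind[OF that]]] interp_induced[OF I that] by simp
  have im: "(\<lambda>W. iso_class T2 (induced N W)) ` ?W \<subseteq> ?D"
  proof safe
    fix W assume W: "W \<subseteq> verts N" "card W = ?m" "induced (interp_struct T1 I N) W \<cong>\<^sub>S M"
    show "iso_class T2 (induced N W) \<in> iso_classes T2" by (rule iso_class_in[OF ind[OF W(1)]])
    show "card (verts (rep (iso_class T2 (induced N W)))) = ?m"
      using isomorphic_card[OF rep_iso_class[OF ind[OF W(1)]]] W(2) by simp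
    show "interp_struct T1 I (rep (iso_class T2 (induced N W))) \<cong>\<^sub>S M"
      using isomorphic_trans[OF iso[OF W(1)] W(3)] .
  qed
  have "card ?W = (\<Sum>D\<in>?D. card {W \<in> ?W. iso_class T2 (induced N W) = D})"
    using sum.group[OF finW finD im, of "\<lambda>_. 1::nat"] by simp
  also have "\<dots> = (\<Sum>D\<in>?D. card {W. W \<subseteq> verts N \<and> card W = card (verts (rep D)) \<and> induced N W \<cong>\<^sub>S rep D})"
  proof (rule sum.cong, simp)
    fix D assume D: "D \<in> ?D"
    have *: "iso_class T2 (induced N W) = D \<longleftrightarrow> induced N W \<cong>\<^sub>S rep D" if "W \<subseteq> verts N" for W
      using iso_class_eq_iff[OF ind[OF that]] rep_in D by (metis (no_types, lifting) mem_Collect_eq)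
    have **: "induced (interp_struct T1 I N) W \<cong>\<^sub>S M"
      if "W \<subseteq> verts N" "iso_class T2 (induced N W) = D" for W
      using iso[OF that(1)] that(2) D isomorphic_cong_left by blast
    have "{W \<in> ?W. iso_class T2 (induced N W) = D} =
        {W. W \<subseteq> verts N \<and> card W = card (verts (rep D)) \<and> induced N W \<cong>\<^sub>S rep D}"
      using D * ** by auto
    then show "card {W \<in> ?W. iso_class T2 (induced N W) = D} =
        card {W. W \<subseteq> verts N \<and> card W = card (verts (rep D)) \<and> induced N W \<cong>\<^sub>S rep D}" by simp
  qed
  finally have "density M (interp_struct T1 I N) = (\<Sum>D\<in>?D.
      real (card {W. W \<subseteq> verts N \<and> card W = card (verts (rep D)) \<and> induced N W \<cong>\<^sub>S rep D})
      / real (card (verts N) choose ?m))"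
    by (simp add: density_def sum_divide_distrib)
  also have "\<dots> = (\<Sum>D\<in>?D. density (rep D) N)"
    by (rule sum.cong) (auto simp: density_def)
  finally show ?thesis .
qed

text \<open>\<open>interp_limit\<close> is a finite sum of values of \<phi>, and the density in the
  interpreted model is the same sum of densities. Membership in \<open>Hom_pos\<close> and
  functoriality will both be read off from the interpreted sequence.\<close>

lemma conv_interp:
  assumes "open_interpretation T1 T2 I" "wf_language T2" "converges_to T2 N \<phi>"
  shows "converges_to T1 (\<lambda>n. interp_struct T1 I (N n)) (interp_limit T1 T2 I \<phi>)"
  unfolding converges_to_def
proof (intro conjI allI ballI)
  have N: "N n \<in> finite_models T2" for n using assms by (simp add: converges_to_def)
  then show "interp_struct T1 I (N n) \<in> finite_models T1" for n
    using open_interpretationD(3)[OF assms(1)] by blast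
  show "strict_mono (\<lambda>n. card (verts (interp_struct T1 I (N n))))"
    using assms(3) by (simp add: converges_to_def)
  fix M assume M: "M \<in> finite_models T1"
  let ?C = "iso_class T1 M"
  let ?D = "{D. D \<in> iso_classes T2 \<and> card (verts (rep D)) = card (verts (rep ?C)) \<and>
       interp_struct T1 I (rep D) \<cong>\<^sub>S rep ?C}"
  have C: "?C \<in> iso_classes T1" by (rule iso_class_in[OF M])
  have eq: "density M (interp_struct T1 I (N n)) = (\<Sum>D\<in>?D. density (rep D) (N n))" for n
    using density_isomorphic[OF rep_iso_class[OF M]]
      density_interp[OF assms(1,2) rep_in(1)[OF C] N] by metis
  have "(\<lambda>n. \<Sum>D\<in>?D. density (rep D) (N n)) \<longlonglongrightarrow> (\<Sum>D\<in>?D. \<phi> D)"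
  proof (rule tendsto_sum)
    fix D assume "D \<in> ?D"
    then have "rep D \<in> finite_models T2" "iso_class T2 (rep D) = D" using rep_in by blast+
    then show "(\<lambda>n. density (rep D) (N n)) \<longlonglongrightarrow> \<phi> D" using assms(3) by (metis converges_to_def)
  qed
  then show "(\<lambda>n. density M (interp_struct T1 I (N n))) \<longlonglongrightarrow> interp_limit T1 T2 I \<phi> ?C"
    using C by (simp add: eq interp_limit_def)
qed

lemma interp_limit_Hom_pos:
  "open_interpretation T1 T2 I \<Longrightarrow> wf_language T2 \<Longrightarrow> \<phi> \<in> Hom_pos T2 \<Longrightarrow>
   interp_limit T1 T2 I \<phi> \<in> Hom_pos T1"
  by (meson Hom_posE Hom_posI conv_interp interp_limit_extensional)

lemma tdens_interp:
  assumes I: "open_interpretation T1 T2 I" and T2: "wf_language T2"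
    and K: "K \<in> mods T1 m" and N: "N \<in> finite_models T2"
  shows "tdens K (interp_struct T1 I N) = (\<Sum>K' | K' \<in> mods T2 m \<and> interp_struct T1 I K' = K. tdens K' N)"
proof -
  let ?S = "{xs \<in> dlists m (verts N). pull xs (interp_struct T1 I N) = K}"
  let ?D = "{K'. K' \<in> mods T2 m \<and> interp_struct T1 I K' = K}"
  have finN: "finite (verts N)" and modN: "model T2 N" using N by (auto simp: finite_models_def)
  have fin: "finite ?S" "finite ?D" using finN by (auto simp: finite_dlists finite_mods[OF T2])
  have pull: "pull xs (interp_struct T1 I N) = interp_struct T1 I (pull xs N)" "pull xs N \<in> mods T2 m"
    if "xs \<in> dlists m (verts N)" for xs
    using dlistsD[OF that] interp_pull[OF I] pull_in_mods[OF modN] by auto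
  have im: "(\<lambda>xs. pull xs N) ` ?S \<subseteq> ?D" using pull by auto
  have "card ?S = (\<Sum>K'\<in>?D. card {xs \<in> ?S. pull xs N = K'})"
    using sum.group[OF fin im, of "\<lambda>_. 1::nat"] by simp
  also have "\<dots> = (\<Sum>K'\<in>?D. card {xs \<in> dlists m (verts N). pull xs N = K'})"
    using pull by (intro sum.cong arg_cong[where f=card]) auto
  finally have "tdens K (interp_struct T1 I N) = (\<Sum>K'\<in>?D.
     real (card {xs \<in> dlists m (verts N). pull xs N = K'}) / real (card (dlists m (verts N))))"
    using modsD(2)[OF K] by (simp add: tdens_def sum_divide_distrib)
  also have "\<dots> = (\<Sum>K'\<in>?D. tdens K' N)"
    by (rule sum.cong) (auto simp: tdens_def modsD(2))
  finally show ?thesis .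
qed

text \<open>In labelled form \<open>interp_limit\<close> is an image measure: the fibre consists of
  the models whose interpretation equals \<open>K\<close>, without isomorphisms or automorphism
  factors. Laws are compared and joined in this form.\<close>

lemma labelled_interp:
  assumes I: "open_interpretation T1 T2 I" and T2: "wf_language T2"
    and "\<phi> \<in> Hom_pos T2" and K: "K \<in> mods T1 m"
  shows "labelled T1 (interp_limit T1 T2 I \<phi>) K =
    (\<Sum>K' | K' \<in> mods T2 m \<and> interp_struct T1 I K' = K. labelled T2 \<phi> K')"
proof -
  obtain N where N: "converges_to T2 N \<phi>" using Hom_posE assms by blast
  have "(\<lambda>n. tdens K (interp_struct T1 I (N n))) \<longlonglongrightarrow> labelled T1 (interp_limit T1 T2 I \<phi>) K"
    by (rule conv_tdens[OF conv_interp[OF I T2 N] K])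
  moreover have "tdens K (interp_struct T1 I (N n)) =
      (\<Sum>K' | K' \<in> mods T2 m \<and> interp_struct T1 I K' = K. tdens K' (N n))" for n
    using N by (intro tdens_interp[OF I T2 K]) (simp add: converges_to_def)
  moreover have "(\<lambda>n. \<Sum>K' | K' \<in> mods T2 m \<and> interp_struct T1 I K' = K. tdens K' (N n)) \<longlonglongrightarrow>
      (\<Sum>K' | K' \<in> mods T2 m \<and> interp_struct T1 I K' = K. labelled T2 \<phi> K')"
    by (rule tendsto_sum) (auto intro: conv_tdens[OF N])
  ultimately show ?thesis using LIMSEQ_unique by auto
qed

section \<open>Unions of theories\<close>

abbreviation el :: "'p univ_theory \<Rightarrow> ('p + 'q) rel_struct \<Rightarrow> 'p rel_struct" where
  "el T1 \<equiv> interp_struct T1 (erase_left T1)"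

abbreviation er :: "'q univ_theory \<Rightarrow> ('p + 'q) rel_struct \<Rightarrow> 'q rel_struct" where
  "er T2 \<equiv> interp_struct T2 (erase_right T2)"

lemma union_theory_simps [simp]:
  "preds (T1 \<oplus>\<^sub>T T2) = preds T1 <+> preds T2"
  "arity (T1 \<oplus>\<^sub>T T2) = case_sum (arity T1) (arity T2)"
  "axioms (T1 \<oplus>\<^sub>T T2) = map_qf Inl ` axioms T1 \<union> map_qf Inr ` axioms T2"
  by (simp_all add: union_theory_def)

lemma wf_language_union: "wf_language T1 \<Longrightarrow> wf_language T2 \<Longrightarrow> wf_language (T1 \<oplus>\<^sub>T T2)"
  by (auto simp: wf_language_def)

lemma qf_vars_map [simp]: "qf_vars (map_qf f F) = qf_vars F"
  by (induction F) auto

lemma rel_el: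
  assumes "struct_over (T1 \<oplus>\<^sub>T T2) Z"
  shows "rel (el T1 Z) P = rel Z (Inl P)"
proof -
  have "xs \<in> rel (el T1 Z) P \<longleftrightarrow> xs \<in> rel Z (Inl P)" for xs
    using struct_overD[OF assms, of xs "Inl P"]
    by (auto simp: rel_interp erase_left_def) (metis map_nth)+
  then show ?thesis by blast
qed

lemma rel_er:
  assumes "struct_over (T1 \<oplus>\<^sub>T T2) Z"
  shows "rel (er T2 Z) P = rel Z (Inr P)"
proof -
  have "xs \<in> rel (er T2 Z) P \<longleftrightarrow> xs \<in> rel Z (Inr P)" for xs
    using struct_overD[OF assms, of xs "Inr P"]
    by (auto simp: rel_interp erase_right_def) (metis map_nth)+
  then show ?thesis by blast
qed

lemma eval_el:
  assumes "struct_over (T1 \<oplus>\<^sub>T T2) Z"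
  shows "eval Z s (map_qf Inl F) \<longleftrightarrow> eval (el T1 Z) s F"
  by (induction F) (simp_all add: rel_el[OF assms])

lemma eval_er:
  assumes "struct_over (T1 \<oplus>\<^sub>T T2) Z"
  shows "eval Z s (map_qf Inr F) \<longleftrightarrow> eval (er T2 Z) s F"
  by (induction F) (simp_all add: rel_er[OF assms])

text \<open>The axioms of the union are renamed copies, so each of them speaks about only one of the
  two reducts.\<close>

lemma model_union_iff:
  assumes "struct_over (T1 \<oplus>\<^sub>T T2) Z"
  shows "model (T1 \<oplus>\<^sub>T T2) Z \<longleftrightarrow> model T1 (el T1 Z) \<and> model T2 (er T2 Z)"
proof -
  have "(\<forall>F\<in>axioms (T1 \<oplus>\<^sub>T T2). satisfies Z F) \<longleftrightarrow>
      (\<forall>F\<in>axioms T1. satisfies (el T1 Z) F) \<and> (\<forall>F\<in>axioms T2. satisfies (er T2 Z) F)"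
    by (simp add: ball_Un satisfies_def eval_el[OF assms] eval_er[OF assms])
  then show ?thesis by (simp add: model_def assms struct_over_interp)
qed

lemma erase_left_interpretation: "open_interpretation T1 (T1 \<oplus>\<^sub>T T2) (erase_left T1)"
  using model_union_iff model_struct_over
  by (fastforce simp: open_interpretation_def erase_left_def)

lemma erase_right_interpretation: "open_interpretation T2 (T1 \<oplus>\<^sub>T T2) (erase_right T2)"
  using model_union_iff model_struct_over
  by (fastforce simp: open_interpretation_def erase_right_def)

text \<open>The inverse of taking both reducts, meant for structures on the same vertices; the
  vertex set is read from \<open>K\<close>.\<close>

definition join :: "'p rel_struct \<Rightarrow> 'q rel_struct \<Rightarrow> ('p + 'q) rel_struct" where
  "join K L = \<lparr> verts = verts K, rel = case_sum (rel K) (rel L) \<rparr>"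

lemma struct_over_join:
  assumes "struct_over T1 K" "struct_over T2 L" "verts K = verts L"
  shows "struct_over (T1 \<oplus>\<^sub>T T2) (join K L)"
proof (rule struct_overI)
  fix P xs assume "xs \<in> rel (join K L) P"
  then show "P \<in> preds (T1 \<oplus>\<^sub>T T2) \<and> set xs \<subseteq> verts (join K L) \<and> length xs = arity (T1 \<oplus>\<^sub>T T2) P"
    using struct_overD[OF assms(1)] struct_overD[OF assms(2)] assms(3)
    by (cases P) (auto simp: join_def)
qed

lemma el_join:
  fixes T1 :: "'p univ_theory" and T2 :: "'q univ_theory"
  assumes "struct_over T1 K" "struct_over T2 L" "verts K = verts L"
  shows "el T1 (join K L) = K"
  by (rule struct_eqI) (simp_all add: rel_el[OF struct_over_join[OF assms]], simp_all add: join_def)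

lemma er_join:
  fixes T1 :: "'p univ_theory" and T2 :: "'q univ_theory"
  assumes "struct_over T1 K" "struct_over T2 L" "verts K = verts L"
  shows "er T2 (join K L) = L"
  by (rule struct_eqI) (simp_all add: rel_er[OF struct_over_join[OF assms]], simp_all add: join_def assms)

lemma join_el_er:
  assumes "struct_over (T1 \<oplus>\<^sub>T T2) Z"
  shows "join (el T1 Z) (er T2 Z) = Z"
proof (rule struct_eqI)
  show "rel (join (el T1 Z) (er T2 Z)) P = rel Z P" for P
    using rel_el[OF assms] rel_er[OF assms] by (cases P) (auto simp: join_def)
qed (simp add: join_def)

lemma join_in_mods:
  assumes "K \<in> mods T1 m" "L \<in> mods T2 m"
  shows "join K L \<in> mods (T1 \<oplus>\<^sub>T T2) m"
proof -
  have *: "struct_over T1 K" "struct_over T2 L" "verts K = verts L"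
    using modsD[OF assms(1)] modsD[OF assms(2)] by auto
  show ?thesis
    using modsD[OF assms(1)] modsD[OF assms(2)] model_union_iff[OF struct_over_join[OF *]]
    by (simp add: mods_def el_join[OF *] er_join[OF *]) (simp add: join_def)
qed

text \<open>\<open>I\<close> on the first component and the identity on the second. It carries
  couplings over \<open>T2\<close> to couplings over \<open>T1\<close>.\<close>

definition extend_interp :: "'r univ_theory \<Rightarrow> ('p \<Rightarrow> 'q qf) \<Rightarrow> 'p + 'r \<Rightarrow> ('q + 'r) qf" where
  "extend_interp T' I = case_sum (\<lambda>P. map_qf Inl (I P)) (erase_right T')"

lemma interp_extend:
  assumes Z: "struct_over (T2 \<oplus>\<^sub>T T') Z"
  shows "interp_struct (T1 \<oplus>\<^sub>T T') (extend_interp T' I) Z = join (interp_struct T1 I (el T2 Z)) (er T' Z)"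
proof (rule struct_eqI)
  show "rel (interp_struct (T1 \<oplus>\<^sub>T T') (extend_interp T' I) Z) P =
      rel (join (interp_struct T1 I (el T2 Z)) (er T' Z)) P" for P
    by (cases P) (auto simp: rel_interp join_def extend_interp_def eval_el[OF Z])
qed (simp add: join_def)

lemma el_interp_extend:
  fixes T1 :: "'p univ_theory"
  assumes "struct_over (T2 \<oplus>\<^sub>T T') Z"
  shows "el T1 (interp_struct (T1 \<oplus>\<^sub>T T') (extend_interp T' I) Z) = interp_struct T1 I (el T2 Z)"
  unfolding interp_extend[OF assms]
  by (rule el_join[where ?T2.0 = T']) (simp_all add: struct_over_interp)

lemma er_interp_extend:
  fixes T1 :: "'p univ_theory"
  assumes "struct_over (T2 \<oplus>\<^sub>T T') Z"
  shows "er T' (interp_struct (T1 \<oplus>\<^sub>T T') (extend_interp T' I) Z) = er T' Z"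
  unfolding interp_extend[OF assms]
  by (rule er_join[where ?T1.0 = T1]) (simp_all add: struct_over_interp)

lemma qf_over_map_Inl: "qf_over T F \<Longrightarrow> qf_over (T \<oplus>\<^sub>T T') (map_qf Inl F)"
  by (induction F) auto

lemma extend_interpretation:
  assumes I: "open_interpretation T1 T2 I"
  shows "open_interpretation (T1 \<oplus>\<^sub>T T') (T2 \<oplus>\<^sub>T T') (extend_interp T' I)"
  unfolding open_interpretation_def
proof (intro conjI ballI allI impI)
  fix P assume "P \<in> preds (T1 \<oplus>\<^sub>T T')"
  then show "qf_over (T2 \<oplus>\<^sub>T T') (extend_interp T' I P)"
    "qf_vars (extend_interp T' I P) \<subseteq> {..<arity (T1 \<oplus>\<^sub>T T') P}"
    using I unfolding open_interpretation_def
    by (force simp: extend_interp_def erase_right_def intro!: qf_over_map_Inl)+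
next
  fix Z assume Z: "model (T2 \<oplus>\<^sub>T T') Z"
  note so = model_struct_over[OF Z]
  show "model (T1 \<oplus>\<^sub>T T') (interp_struct (T1 \<oplus>\<^sub>T T') (extend_interp T' I) Z)"
    using Z model_union_iff[OF so] open_interpretationD(2)[OF I]
    by (simp add: model_union_iff[OF struct_over_interp] el_interp_extend[OF so] er_interp_extend[OF so])
qed

text \<open>Both composites are limits along images of one sequence converging to \<zeta>. These
  images coincide and limits are unique, so nested sums over classes need not be rearranged.\<close>

lemma interp_limit_cong_comp:
  assumes "wf_language T2" "\<zeta> \<in> Hom_pos T2" "open_interpretation Ta T2 A" "open_interpretation Tb T2 B"
    and "wf_language Ta" "wf_language Tb"
    and "open_interpretation T1 Ta A'" "open_interpretation T1 Tb B'"
    and "\<And>Z. model T2 Z \<Longrightarrow>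
      interp_struct T1 A' (interp_struct Ta A Z) = interp_struct T1 B' (interp_struct Tb B Z)"
  shows "interp_limit T1 Ta A' (interp_limit Ta T2 A \<zeta>) = interp_limit T1 Tb B' (interp_limit Tb T2 B \<zeta>)"
proof -
  obtain Z where Z: "converges_to T2 Z \<zeta>" using assms Hom_posE by blast
  then have "model T2 (Z n)" for n by (simp add: converges_to_def finite_models_def)
  then have "converges_to T1 (\<lambda>n. interp_struct T1 A' (interp_struct Ta A (Z n)))
      (interp_limit T1 Tb B' (interp_limit Tb T2 B \<zeta>))"
    using conv_interp[OF assms(8,6) conv_interp[OF assms(4,1) Z]] assms(9) by simp
  then show ?thesis
    using conv_interp[OF assms(7,5) conv_interp[OF assms(3,1) Z]]
    by (intro conv_unique[OF _ _ interp_limit_extensional interp_limit_extensional])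
qed

lemma interp_limit_comp:
  assumes "wf_language T2" "\<zeta> \<in> Hom_pos T2" "open_interpretation Ta T2 A" "open_interpretation T1 T2 B"
    and "wf_language Ta" "open_interpretation T1 Ta A'"
    and "\<And>Z. model T2 Z \<Longrightarrow> interp_struct T1 A' (interp_struct Ta A Z) = interp_struct T1 B Z"
  shows "interp_limit T1 Ta A' (interp_limit Ta T2 A \<zeta>) = interp_limit T1 T2 B \<zeta>"
proof -
  obtain Z where Z: "converges_to T2 Z \<zeta>" using assms Hom_posE by blast
  then have "model T2 (Z n)" for n by (simp add: converges_to_def finite_models_def)
  then have "converges_to T1 (\<lambda>n. interp_struct T1 A' (interp_struct Ta A (Z n))) (interp_limit T1 T2 B \<zeta>)"
    using conv_interp[OF assms(4,1) Z] assms(7) by simp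
  then show ?thesis
    using conv_interp[OF assms(6,5) conv_interp[OF assms(3,1) Z]]
    by (intro conv_unique[OF _ _ interp_limit_extensional interp_limit_extensional])
qed

text \<open>\<open>indep_coupling\<close> is defined through a chosen representative of each class;
  isomorphism invariance of the three \<open>labelled\<close> values frees the product formula from
  that choice.\<close>

lemma labelled_indep_coupling:
  assumes K: "K \<in> finite_models (T1 \<oplus>\<^sub>T T2)"
  shows "labelled (T1 \<oplus>\<^sub>T T2) (indep_coupling T1 T2 \<phi>1 \<phi>2) K =
    labelled T1 \<phi>1 (el T1 K) * labelled T2 \<phi>2 (er T2 K)"
proof -
  let ?M = "rep (iso_class (T1 \<oplus>\<^sub>T T2) K)"
  have C: "iso_class (T1 \<oplus>\<^sub>T T2) K \<in> iso_classes (T1 \<oplus>\<^sub>T T2)" by (rule iso_class_in[OF K])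
  have M: "?M \<in> finite_models (T1 \<oplus>\<^sub>T T2)" by (rule rep_in(1)[OF C])
  have iso: "?M \<cong>\<^sub>S K" by (rule rep_iso_class[OF K])
  have eq: "labelled (T1 \<oplus>\<^sub>T T2) \<xi> K = labelled (T1 \<oplus>\<^sub>T T2) \<xi> ?M" for \<xi>
    using labelled_isomorphic[OF M K iso] by simp
  have el: "labelled T1 \<phi>1 (el T1 K) = labelled T1 \<phi>1 (el T1 ?M)"
    using labelled_isomorphic interp_isomorphic[OF erase_left_interpretation iso]
      open_interpretationD(3)[OF erase_left_interpretation] M K by metis
  have er: "labelled T2 \<phi>2 (er T2 K) = labelled T2 \<phi>2 (er T2 ?M)"
    using labelled_isomorphic interp_isomorphic[OF erase_right_interpretation iso]
      open_interpretationD(3)[OF erase_right_interpretation] M K by metis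
  have pos: "card (aut ?M) > 0" using aut_card_pos M by (auto simp: finite_models_def)
  have "labelled (T1 \<oplus>\<^sub>T T2) (indep_coupling T1 T2 \<phi>1 \<phi>2) ?M =
      labelled T1 \<phi>1 (el T1 ?M) * labelled T2 \<phi>2 (er T2 ?M)"
    unfolding labelled_def[of "T1 \<oplus>\<^sub>T T2"] rep_in(2)[OF C] indep_coupling_def
    using C pos by (simp add: Let_def)
  then show ?thesis by (simp only: eq el er)
qed

lemma indep_coupling_extensional: "indep_coupling T1 T2 \<phi>1 \<phi>2 \<in> extensional (iso_classes (T1 \<oplus>\<^sub>T T2))"
  by (simp add: indep_coupling_def)

section \<open>Sampling\<close>

definition avg :: "'a set \<Rightarrow> ('a \<Rightarrow> real) \<Rightarrow> real" where
  "avg S f = (\<Sum>x\<in>S. f x) / real (card S)"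

lemma avg_cong: "(\<And>x. x \<in> S \<Longrightarrow> f x = g x) \<Longrightarrow> avg S f = avg S g"
  by (simp add: avg_def)

lemma avg_mono: "(\<And>x. x \<in> S \<Longrightarrow> f x \<le> g x) \<Longrightarrow> avg S f \<le> avg S g"
  by (simp add: avg_def divide_right_mono sum_mono)

lemma avg_swap: "avg S (\<lambda>x. avg R (f x)) = avg R (\<lambda>y. avg S (\<lambda>x. f x y))"
proof -
  have "(\<Sum>x\<in>S. \<Sum>y\<in>R. f x y) = (\<Sum>y\<in>R. \<Sum>x\<in>S. f x y)" by (rule sum.swap)
  then show ?thesis by (simp add: avg_def sum_divide_distrib[symmetric] mult.commute)
qed

lemma avg_const: "finite S \<Longrightarrow> S \<noteq> {} \<Longrightarrow> avg S (\<lambda>_. c) = c"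
  by (simp add: avg_def)

lemma avg_add: "avg S (\<lambda>x. f x + g x) = avg S f + avg S g"
  by (simp add: avg_def sum.distrib add_divide_distrib)

lemma avg_mult: "avg S (\<lambda>x. c * f x) = c * avg S f"
  by (simp add: avg_def sum_distrib_left)

lemma tdens_avg:
  assumes "verts K = {..<m}" "finite (verts N)"
  shows "tdens K N = avg (dlists m (verts N)) (\<lambda>xs. of_bool (pull xs N = K))"
proof -
  have "real (card {xs \<in> dlists m (verts N). pull xs N = K}) =
      (\<Sum>xs\<in>dlists m (verts N). of_bool (pull xs N = K))"
    using finite_dlists[OF assms(2)] by (subst sum_of_bool_eq) (auto simp: Int_def)
  then show ?thesis using assms(1) by (simp add: tdens_def avg_def)
qed

lemma dlists_nonempty: "finite V \<Longrightarrow> m \<le> card V \<Longrightarrow> dlists m V \<noteq> {}"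
  using card_dlists[of V m] by (metis card.empty fact_nonzero mult_is_0 zero_less_binomial_iff less_irrefl)

text \<open>The numbers \<open>tdens K N\<close> are the law of \<open>pull xs N\<close> for a
  uniform injective tuple; this change of variables turns sums over models into averages over
  tuples.\<close>

lemma sum_tdens_avg:
  assumes "wf_language T" "N \<in> finite_models T"
  shows "(\<Sum>K\<in>mods T m. tdens K N * g K) = avg (dlists m (verts N)) (\<lambda>xs. g (pull xs N))"
proof -
  have fin: "finite (verts N)" and N: "model T N" using assms by (auto simp: finite_models_def)
  have im: "(\<lambda>xs. pull xs N) ` dlists m (verts N) \<subseteq> mods T m"
    using pull_in_mods[OF N] by (auto simp: dlists_def)
  have "(\<Sum>xs\<in>dlists m (verts N). g (pull xs N)) =
      (\<Sum>K\<in>mods T m. \<Sum>xs | xs \<in> dlists m (verts N) \<and> pull xs N = K. g (pull xs N))"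
    by (rule sum.group[OF finite_dlists[OF fin] finite_mods[OF assms(1)] im, symmetric])
  also have "\<dots> = (\<Sum>K\<in>mods T m. real (card {xs \<in> dlists m (verts N). pull xs N = K}) * g K)"
    by (intro sum.cong) auto
  finally show ?thesis
    by (simp add: avg_def tdens_def sum_divide_distrib modsD(2))
qed

lemma sum_tdens:
  assumes "wf_language T" "N \<in> finite_models T" "m \<le> card (verts N)"
  shows "(\<Sum>K\<in>mods T m. tdens K N) = 1"
proof -
  have fin: "finite (verts N)" using assms by (auto simp: finite_models_def)
  show ?thesis
    using sum_tdens_avg[OF assms(1,2), where m = m and g = "\<lambda>_. 1"]
      avg_const[OF finite_dlists[OF fin] dlists_nonempty[OF fin assms(3)]] by simp
qed

text \<open>Both tuples are completed to listings of all of \<open>V\<close>, and equal positions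
  are matched.\<close>

lemma obtain_permutation:
  assumes "finite V" "zs \<in> dlists m V" "zs' \<in> dlists m V"
  obtains \<sigma> where "bij_betw \<sigma> V V" "map \<sigma> zs = zs'"
proof -
  obtain us where us: "set us = V - set zs" "distinct us"
    using finite_distinct_list[of "V - set zs"] assms(1) by auto
  obtain us' where us': "set us' = V - set zs'" "distinct us'"
    using finite_distinct_list[of "V - set zs'"] assms(1) by auto
  let ?l = "zs @ us" and ?l' = "zs' @ us'"
  have l: "distinct ?l" "set ?l = V" "distinct ?l'" "set ?l' = V"
    using us us' assms(2,3) by (auto simp: dlists_def)
  then have len: "length ?l' = length ?l" using distinct_card by metis
  have b: "bij_betw ((!) ?l) {..<length ?l} V" "bij_betw ((!) ?l') {..<length ?l} V"
    using bij_betw_nth[OF l(1) _ l(2)[symmetric]] bij_betw_nth[OF l(3) _ l(4)[symmetric]] len by auto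
  let ?\<sigma> = "(!) ?l' \<circ> inv_into {..<length ?l} ((!) ?l)"
  have "bij_betw ?\<sigma> V V" by (rule bij_betw_trans[OF bij_betw_inv_into[OF b(1)] b(2)])
  moreover have "map ?\<sigma> zs = zs'"
  proof (rule nth_equalityI)
    show "length (map ?\<sigma> zs) = length zs'" using assms by (simp add: dlists_def)
    fix i assume "i < length (map ?\<sigma> zs)"
    then have i: "i < m" using assms(2) by (simp add: dlists_def)
    then have "inv_into {..<length ?l} ((!) ?l) (?l ! i) = i"
      using assms(2) bij_betw_inv_into_left[OF b(1), of i] by (simp add: dlists_def)
    then show "map ?\<sigma> zs ! i = zs' ! i"
      using i assms(2,3) by (simp add: dlists_def nth_append)
  qed
  ultimately show ?thesis using that by blast
qed

lemma map_in_dlists: "bij_betw \<sigma> V V \<Longrightarrow> xs \<in> dlists n V \<Longrightarrow> map \<sigma> xs \<in> dlists n V"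
  by (auto simp: dlists_def distinct_map bij_betw_def inj_on_def subset_iff)

lemma nth_map_in_dlists:
  assumes "xs \<in> dlists n V" "ys \<in> dlists m {..<n}"
  shows "map ((!) xs) ys \<in> dlists m V"
  using assms nth_mem by (fastforce simp: dlists_def distinct_map inj_on_def nth_eq_iff_index_eq subset_iff)

text \<open>The entries of a uniform injective tuple at fixed distinct positions form a uniform
  injective tuple: permutations of \<open>V\<close> act transitively on injective
  \<open>m\<close>-tuples and carry fibres into fibres, so all fibres have the same size.\<close>

lemma avg_sub:
  assumes "finite V" "n \<le> card V" "ys \<in> dlists m {..<n}"
  shows "avg (dlists n V) (\<lambda>xs. F (map ((!) xs) ys)) = avg (dlists m V) F"
proof -
  let ?fib = "\<lambda>zs. {xs \<in> dlists n V. map ((!) xs) ys = zs}"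
  have le: "card (?fib zs) \<le> card (?fib zs')" if zs: "zs \<in> dlists m V" "zs' \<in> dlists m V" for zs zs'
  proof -
    obtain \<sigma> where \<sigma>: "bij_betw \<sigma> V V" "map \<sigma> zs = zs'"
      using obtain_permutation[OF assms(1) zs] by blast
    have "map \<sigma> ` ?fib zs \<subseteq> ?fib zs'"
    proof safe
      fix xs assume xs: "xs \<in> dlists n V" "zs = map ((!) xs) ys"
      show "map \<sigma> xs \<in> dlists n V" by (rule map_in_dlists[OF \<sigma>(1) xs(1)])
      have eq: "map ((!) (map \<sigma> xs)) ys = map \<sigma> (map ((!) xs) ys)"
        using xs(1) assms(3) by (auto simp: dlists_def subset_iff)
      show "map ((!) (map \<sigma> xs)) ys = zs'" unfolding eq xs(2)[symmetric] by (rule \<sigma>(2))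
    qed
    moreover have "inj_on (map \<sigma>) (?fib zs)"
    proof (rule inj_onI, erule map_inj_on)
      fix xs xs' assume "xs \<in> ?fib zs" "xs' \<in> ?fib zs"
      then have "set xs \<union> set xs' \<subseteq> V" by (simp add: dlists_def)
      then show "inj_on \<sigma> (set xs \<union> set xs')"
        using inj_on_subset[OF bij_betw_imp_inj_on[OF \<sigma>(1)]] by blast
    qed
    moreover have "finite (?fib zs')" using assms(1) by (simp add: finite_dlists)
    ultimately show ?thesis using card_inj_on_le by blast
  qed
  obtain zs0 where zs0: "zs0 \<in> dlists m V"
    using dlists_nonempty[OF assms(1,2)] nth_map_in_dlists[OF _ assms(3)] by blast
  define c where "c = card (?fib zs0)"
  have c: "card (?fib zs) = c" if "zs \<in> dlists m V" for zs
    using le[OF that zs0] le[OF zs0 that] by (simp add: c_def)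
  have im: "(\<lambda>xs. map ((!) xs) ys) ` dlists n V \<subseteq> dlists m V"
    using nth_map_in_dlists[OF _ assms(3)] by blast
  have sum: "(\<Sum>xs\<in>dlists n V. G (map ((!) xs) ys)) = real c * (\<Sum>zs\<in>dlists m V. G zs)" for G
  proof -
    have "(\<Sum>xs\<in>dlists n V. G (map ((!) xs) ys)) = (\<Sum>zs\<in>dlists m V. \<Sum>xs\<in>?fib zs. G (map ((!) xs) ys))"
      by (rule sum.group[OF finite_dlists[OF assms(1)] finite_dlists[OF assms(1)] im, symmetric])
    also have "\<dots> = (\<Sum>zs\<in>dlists m V. real c * G zs)"
      using c by (intro sum.cong) auto
    finally show ?thesis by (simp add: sum_distrib_left)
  qed
  have "real (card (dlists n V)) = real c * real (card (dlists m V))"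
    using sum[of "\<lambda>_. 1"] by simp
  moreover have "card (dlists n V) \<noteq> 0"
    using dlists_nonempty[OF assms(1,2)] finite_dlists[OF assms(1)] by simp
  ultimately show ?thesis unfolding avg_def sum by auto
qed

text \<open>Unbiasedness of sampling: after the averages are exchanged, the inner one belongs to a
  fixed pattern of positions and does not depend on the pattern.\<close>

lemma avg_tdens_pull:
  assumes "finite (verts N)" "n \<le> card (verts N)" "verts K = {..<m}" "m \<le> n"
  shows "avg (dlists n (verts N)) (\<lambda>xs. tdens K (pull xs N)) = tdens K N"
proof -
  have "avg (dlists n (verts N)) (\<lambda>xs. tdens K (pull xs N)) =
      avg (dlists n (verts N)) (\<lambda>xs. avg (dlists m {..<n}) (\<lambda>ys. of_bool (pull (map ((!) xs) ys) N = K)))"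
  proof (rule avg_cong)
    fix xs assume xs: "xs \<in> dlists n (verts N)"
    then have "length xs = n" by (simp add: dlists_def)
    then show "tdens K (pull xs N) = avg (dlists m {..<n}) (\<lambda>ys. of_bool (pull (map ((!) xs) ys) N = K))"
      using pull_pull[of _ xs N] by (subst tdens_avg[OF assms(3)]) (auto simp: dlists_def intro: avg_cong)
  qed
  also have "\<dots> = avg (dlists m {..<n}) (\<lambda>ys. tdens K N)"
    unfolding avg_swap[of "dlists n (verts N)"]
    unfolding tdens_avg[OF assms(3,1)] by (intro avg_cong avg_sub[OF assms(1,2)])
  also have "\<dots> = tdens K N"
    using assms(4) by (intro avg_const finite_dlists dlists_nonempty) auto
  finally show ?thesis .
qed

text \<open>The probability that two independent random injections of \<open>{..<m}\<close> into \<open>{..<n}\<close> have disjoint ranges.\<close>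

definition disj_ratio :: "nat \<Rightarrow> nat \<Rightarrow> real" where
  "disj_ratio m n = (fact (2 * m) * real (n choose (2 * m))) / (fact m * real (n choose m))\<^sup>2"

section \<open>Asymptotics of the disjointness probability and the second moment of sampled
  densities\<close>

lemma falling_factorial_asymp: "(\<lambda>n. fact k * real (n choose k) / real n ^ k) \<longlonglongrightarrow> 1"
proof (induction k)
  case (Suc k)
  have eq: "fact (Suc k) * real (n choose Suc k) / real n ^ Suc k =
      fact k * real (n choose k) / real n ^ k * ((real n - real k) / real n)" if "n > k" for n
  proof -
    have "Suc k * (n choose Suc k) = (n - k) * (n choose k)"
      by (metis binomial_absorb_comp binomial_absorption mult.commute)
    then have "real (Suc k) * real (n choose Suc k) = (real n - real k) * real (n choose k)"
      using that by (metis of_nat_diff of_nat_mult less_imp_le)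
    then show ?thesis by (simp add: ac_simps del: binomial_Suc_Suc)
  qed
  have "(\<lambda>n. (real n - real k) / real n) \<longlonglongrightarrow> 1" by real_asymp
  from tendsto_mult[OF Suc this]
  have "(\<lambda>n. fact k * real (n choose k) / real n ^ k * ((real n - real k) / real n)) \<longlonglongrightarrow> 1" by simp
  then show ?case
    by (rule Lim_transform_eventually) (use eq in \<open>auto intro!: eventually_sequentiallyI[of "Suc k"]\<close>)
qed simp

lemma disj_ratio_tendsto: "(\<lambda>n. disj_ratio m n) \<longlonglongrightarrow> 1"
proof -
  have "(\<lambda>n. (fact (2 * m) * real (n choose (2 * m)) / real n ^ (2 * m)) /
      (fact m * real (n choose m) / real n ^ m)\<^sup>2) \<longlonglongrightarrow> 1 / 1\<^sup>2"
    by (intro tendsto_divide tendsto_power falling_factorial_asymp) simp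
  then have "(\<lambda>n. (fact (2 * m) * real (n choose (2 * m)) / real n ^ (2 * m)) /
      (fact m * real (n choose m) / real n ^ m)\<^sup>2) \<longlonglongrightarrow> 1" by simp
  then show ?thesis
    by (rule Lim_transform_eventually)
      (auto intro!: eventually_sequentiallyI[of 1]
        simp: disj_ratio_def power_divide power_mult[symmetric] mult.commute)
qed

text \<open>Cutting an injective \<open>2 * m\<close>-tuple in the middle identifies it with a pair
  of injective \<open>m\<close>-tuples with disjoint ranges. The pairs left out contribute between 0
  and 1 each, which gives the two bounds.\<close>

lemma sum_disjoint_pairs:
  fixes f :: "'a list \<Rightarrow> real"
  assumes V: "finite V" and f: "\<And>ys. 0 \<le> f ys" "\<And>ys. f ys \<le> 1"
  shows "(\<Sum>ws\<in>dlists (2 * m) V. f (take m ws) * f (drop m ws)) \<le> (\<Sum>ys\<in>dlists m V. f ys)\<^sup>2"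
    and "(\<Sum>ys\<in>dlists m V. f ys)\<^sup>2 \<le> (\<Sum>ws\<in>dlists (2 * m) V. f (take m ws) * f (drop m ws)) +
      ((real (card (dlists m V)))\<^sup>2 - real (card (dlists (2 * m) V)))"
proof -
  let ?D = "dlists m V" and ?E = "dlists (2 * m) V"
  let ?s = "\<lambda>ws :: 'a list. (take m ws, drop m ws)"
  have fin: "finite ?D" using V by (rule finite_dlists)
  have inj: "inj_on ?s ?E" by (rule inj_onI) (metis append_take_drop_id prod.inject)
  have sub: "?s ` ?E \<subseteq> ?D \<times> ?D"
    by (auto simp: dlists_def dest: in_set_takeD in_set_dropD)
  have sq: "(\<Sum>ys\<in>?D. f ys)\<^sup>2 = (\<Sum>(a, b)\<in>?D \<times> ?D. f a * f b)"
    by (simp add: power2_eq_square sum_product sum.cartesian_product)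
  have im: "(\<Sum>(a, b)\<in>?s ` ?E. f a * f b) = (\<Sum>ws\<in>?E. f (take m ws) * f (drop m ws))"
    by (simp add: sum.reindex[OF inj])
  show "(\<Sum>ws\<in>?E. f (take m ws) * f (drop m ws)) \<le> (\<Sum>ys\<in>?D. f ys)\<^sup>2"
    unfolding sq im[symmetric] using fin sub f by (intro sum_mono2) auto
  have "(\<Sum>(a, b)\<in>?D \<times> ?D. f a * f b) =
      (\<Sum>(a, b)\<in>?D \<times> ?D - ?s ` ?E. f a * f b) + (\<Sum>(a, b)\<in>?s ` ?E. f a * f b)"
    using fin sub by (intro sum.subset_diff) auto
  also have "(\<Sum>(a, b)\<in>?D \<times> ?D - ?s ` ?E. f a * f b) \<le> (\<Sum>p\<in>?D \<times> ?D - ?s ` ?E. 1)"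
    using f by (intro sum_mono) (auto intro: mult_le_one)
  also have "\<dots> = real (card (?D \<times> ?D)) - real (card (?s ` ?E))"
  proof -
    have f2: "finite (?D \<times> ?D)" using fin by simp
    have "card (?D \<times> ?D - ?s ` ?E) = card (?D \<times> ?D) - card (?s ` ?E)"
      by (rule card_Diff_subset[OF finite_subset[OF sub f2] sub])
    then show ?thesis using card_mono[OF f2 sub] by (simp only: sum_constant of_nat_diff mult_1_right)
  qed
  finally show "(\<Sum>ys\<in>?D. f ys)\<^sup>2 \<le> (\<Sum>ws\<in>?E. f (take m ws) * f (drop m ws)) +
      ((real (card ?D))\<^sup>2 - real (card ?E))"
    unfolding sq im card_image[OF inj] by (simp add: card_cartesian_product power2_eq_square)
qed

lemma disj_ratio_card:
  "disj_ratio m (card V) = real (card (dlists (2 * m) V)) / (real (card (dlists m V)))\<^sup>2" if "finite V"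
  by (simp add: disj_ratio_def card_dlists[OF that])

text \<open>Squaring produces pairs of \<open>m\<close>-tuples. Disjoint pairs form a uniform
  \<open>2 * m\<close>-tuple, whose average in \<open>N\<close> is at most
  \<open>(tdens K N)\<^sup>2\<close> divided by the proportion of disjoint pairs in
  \<open>N\<close>. Overlapping pairs inside the sample have proportion
  \<open>1 - disj_ratio m n\<close> and contribute at most that.\<close>

lemma second_moment:
  assumes N: "finite (verts N)" "n \<le> card (verts N)" and K: "verts K = {..<m}" and mn: "2 * m \<le> n"
  shows "avg (dlists n (verts N)) (\<lambda>xs. (tdens K (pull xs N))\<^sup>2) \<le>
    disj_ratio m n * ((tdens K N)\<^sup>2 / disj_ratio m (card (verts N))) + (1 - disj_ratio m n)"
proof -
  let ?D = "\<lambda>k. dlists k {..<n}" and ?V = "verts N"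
  define B :: "nat list \<Rightarrow> real" where "B = (\<lambda>zs. of_bool (pull zs N = K))"
  have fD: "finite (?D k)" for k by (simp add: finite_dlists)
  have Dm: "card (?D m) \<noteq> 0" using mn fD dlists_nonempty[of "{..<n}" m] by simp
  have ratio: "disj_ratio m n = real (card (?D (2 * m))) / (real (card (?D m)))\<^sup>2"
    using disj_ratio_card[of "{..<n}" m] by simp
  have step: "(tdens K (pull xs N))\<^sup>2 \<le> disj_ratio m n *
      avg (?D (2 * m)) (\<lambda>ws. B (take m (map ((!) xs) ws)) * B (drop m (map ((!) xs) ws))) + (1 - disj_ratio m n)"
    if xs: "xs \<in> dlists n ?V" for xs
  proof -
    let ?f = "\<lambda>ys. B (map ((!) xs) ys)"
    have "length xs = n" using xs by (simp add: dlists_def)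
    then have t: "tdens K (pull xs N) = avg (?D m) ?f"
      using pull_pull[of _ xs N]
      by (subst tdens_avg[OF K]) (auto simp: dlists_def B_def intro: avg_cong)
    have "(tdens K (pull xs N))\<^sup>2 = (\<Sum>ys\<in>?D m. ?f ys)\<^sup>2 / (real (card (?D m)))\<^sup>2"
      by (simp add: t avg_def power_divide)
    also have "\<dots> \<le> ((\<Sum>ws\<in>?D (2 * m). ?f (take m ws) * ?f (drop m ws)) +
      ((real (card (?D m)))\<^sup>2 - real (card (?D (2 * m))))) / (real (card (?D m)))\<^sup>2"
      by (intro divide_right_mono sum_disjoint_pairs(2)) (auto simp: B_def)
    also have "\<dots> = disj_ratio m n * avg (?D (2 * m)) (\<lambda>ws. ?f (take m ws) * ?f (drop m ws)) + (1 - disj_ratio m n)"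
      using Dm mn fD dlists_nonempty[of "{..<n}" "2 * m"]
      by (simp add: ratio avg_def add_divide_distrib diff_divide_distrib)
    finally show ?thesis by (simp add: take_map drop_map)
  qed
  have "avg (dlists n ?V) (\<lambda>xs. (tdens K (pull xs N))\<^sup>2) \<le> avg (dlists n ?V) (\<lambda>xs. disj_ratio m n *
      avg (?D (2 * m)) (\<lambda>ws. B (take m (map ((!) xs) ws)) * B (drop m (map ((!) xs) ws))) + (1 - disj_ratio m n))"
    by (rule avg_mono[OF step])
  also have "\<dots> = disj_ratio m n * avg (dlists n ?V) (\<lambda>xs.
      avg (?D (2 * m)) (\<lambda>ws. B (take m (map ((!) xs) ws)) * B (drop m (map ((!) xs) ws)))) + (1 - disj_ratio m n)"
    by (simp add: avg_add avg_mult avg_const finite_dlists dlists_nonempty N)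
  finally have le: "avg (dlists n ?V) (\<lambda>xs. (tdens K (pull xs N))\<^sup>2) \<le> disj_ratio m n * avg (dlists n ?V) (\<lambda>xs.
      avg (?D (2 * m)) (\<lambda>ws. B (take m (map ((!) xs) ws)) * B (drop m (map ((!) xs) ws)))) + (1 - disj_ratio m n)" .
  have "avg (dlists n ?V) (\<lambda>xs.
      avg (?D (2 * m)) (\<lambda>ws. B (take m (map ((!) xs) ws)) * B (drop m (map ((!) xs) ws)))) =
      avg (?D (2 * m)) (\<lambda>ws. avg (dlists (2 * m) ?V) (\<lambda>zs. B (take m zs) * B (drop m zs)))"
    unfolding avg_swap[of "dlists n (verts N)"]
    by (intro avg_cong avg_sub[OF N, where F = "\<lambda>zs. B (take m zs) * B (drop m zs)"])
  also have "\<dots> = avg (dlists (2 * m) ?V) (\<lambda>zs. B (take m zs) * B (drop m zs))"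
    using mn by (intro avg_const fD dlists_nonempty) auto
  also have "\<dots> \<le> (\<Sum>ys\<in>dlists m ?V. B ys)\<^sup>2 / real (card (dlists (2 * m) ?V))"
    unfolding avg_def by (intro divide_right_mono sum_disjoint_pairs(1) N) (auto simp: B_def)
  also have "\<dots> = (tdens K N)\<^sup>2 / disj_ratio m (card ?V)"
  proof -
    have "card (dlists m ?V) \<noteq> 0"
      using N mn dlists_nonempty[of ?V m] finite_dlists[of ?V m] by simp
    then show ?thesis
      unfolding tdens_avg[OF K N(1)] disj_ratio_card[OF N(1)] avg_def B_def
      by (simp add: power_divide)
  qed
  finally have "disj_ratio m n * avg (dlists n ?V) (\<lambda>xs.
      avg (?D (2 * m)) (\<lambda>ws. B (take m (map ((!) xs) ws)) * B (drop m (map ((!) xs) ws)))) \<le>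
      disj_ratio m n * ((tdens K N)\<^sup>2 / disj_ratio m (card ?V))"
    by (rule mult_left_mono) (simp add: disj_ratio_def)
  with le show ?thesis by linarith
qed

section \<open>Mean and variance of densities under the law of a limit object\<close>

lemma labelled_nonneg:
  assumes "\<phi> \<in> Hom_pos T" "K \<in> mods T m"
  shows "labelled T \<phi> K \<ge> 0"
proof -
  have "\<phi> (iso_class T K) \<in> {0..1}"
    using assms(1) iso_class_in[OF modsD(4)[OF assms(2)]] by (auto simp: Hom_pos_def)
  then show ?thesis by (simp add: labelled_def)
qed

lemma conv_card_ge:
  assumes "converges_to T N \<phi>"
  shows "\<forall>\<^sub>F k in sequentially. m \<le> card (verts (N k))"
proof (rule eventually_sequentiallyI)
  fix k assume "m \<le> k"
  also have "k \<le> card (verts (N k))"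
    using assms strict_mono_imp_increasing[of "\<lambda>n. card (verts (N n))"] by (simp add: converges_to_def)
  finally show "m \<le> card (verts (N k))" .
qed

lemma conv_sum_labelled:
  assumes "converges_to T N \<phi>"
  shows "(\<lambda>k. \<Sum>L\<in>mods T n. tdens L (N k) * g L) \<longlonglongrightarrow> (\<Sum>L\<in>mods T n. labelled T \<phi> L * g L)"
  by (intro tendsto_sum tendsto_mult_right conv_tdens[OF assms])

lemma sum_labelled:
  assumes "wf_language T" "\<phi> \<in> Hom_pos T"
  shows "(\<Sum>K\<in>mods T m. labelled T \<phi> K) = 1"
proof -
  obtain N where N: "converges_to T N \<phi>" using Hom_posE assms by blast
  have "\<forall>\<^sub>F k in sequentially. (\<Sum>L\<in>mods T m. tdens L (N k) * 1) = 1"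
    using conv_card_ge[OF N, of m]
  proof eventually_elim
    case (elim k)
    then show ?case using N sum_tdens[OF assms(1) _ elim] by (simp add: converges_to_def)
  qed
  then have "(\<lambda>k. \<Sum>L\<in>mods T m. tdens L (N k) * 1) \<longlonglongrightarrow> 1"
    by (rule tendsto_eventually)
  from LIMSEQ_unique[OF conv_sum_labelled[OF N] this] show ?thesis by simp
qed

lemma labelled_mean:
  assumes T: "wf_language T" "\<phi> \<in> Hom_pos T" and K: "K \<in> mods T m" and "m \<le> n"
  shows "(\<Sum>L\<in>mods T n. labelled T \<phi> L * tdens K L) = labelled T \<phi> K"
proof -
  obtain N where N: "converges_to T N \<phi>" using Hom_posE assms by blast
  then have Nk: "N k \<in> finite_models T" "finite (verts (N k))" for k
    by (auto simp: converges_to_def finite_models_def)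
  have "\<forall>\<^sub>F k in sequentially. tdens K (N k) = (\<Sum>L\<in>mods T n. tdens L (N k) * tdens K L)"
    using conv_card_ge[OF N, of n]
    by eventually_elim
      (simp add: sum_tdens_avg[OF T(1) Nk(1)] avg_tdens_pull[OF Nk(2) _ modsD(2)[OF K] assms(4)])
  with conv_tdens[OF N K] have "(\<lambda>k. \<Sum>L\<in>mods T n. tdens L (N k) * tdens K L) \<longlonglongrightarrow> labelled T \<phi> K"
    by (rule Lim_transform_eventually)
  then show ?thesis by (rule LIMSEQ_unique[OF conv_sum_labelled[OF N]])
qed

text \<open>The bound for finite hosts is passed to the limit with \<open>n\<close> fixed; the host
  sizes tend to infinity, so the ratio in the denominator becomes 1.\<close>

lemma labelled_second_moment:
  assumes T: "wf_language T" "\<phi> \<in> Hom_pos T" and K: "K \<in> mods T m" and "2 * m \<le> n"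
  shows "(\<Sum>L\<in>mods T n. labelled T \<phi> L * (tdens K L)\<^sup>2) \<le>
    disj_ratio m n * (labelled T \<phi> K)\<^sup>2 + (1 - disj_ratio m n)"
proof -
  obtain N where N: "converges_to T N \<phi>" using Hom_posE assms by blast
  then have Nk: "N k \<in> finite_models T" "finite (verts (N k))" for k
    by (auto simp: converges_to_def finite_models_def)
  let ?b = "\<lambda>k. disj_ratio m n * ((tdens K (N k))\<^sup>2 / disj_ratio m (card (verts (N k)))) + (1 - disj_ratio m n)"
  have ev: "\<forall>\<^sub>F k in sequentially. (\<Sum>L\<in>mods T n. tdens L (N k) * (tdens K L)\<^sup>2) \<le> ?b k"
    using conv_card_ge[OF N, of n]
    by eventually_elim
      (simp only: sum_tdens_avg[OF T(1) Nk(1)], rule second_moment[OF Nk(2) _ modsD(2)[OF K] assms(4)])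
  have "filterlim (\<lambda>k. card (verts (N k))) sequentially sequentially"
    using N by (intro filterlim_subseq) (simp add: converges_to_def)
  then have "(\<lambda>k. disj_ratio m (card (verts (N k)))) \<longlonglongrightarrow> 1"
    by (rule filterlim_compose[OF disj_ratio_tendsto])
  then have "?b \<longlonglongrightarrow> disj_ratio m n * ((labelled T \<phi> K)\<^sup>2 / 1) + (1 - disj_ratio m n)"
    by (intro tendsto_intros conv_tdens[OF N K]) auto
  from tendsto_le[OF sequentially_bot this conv_sum_labelled[OF N] ev] show ?thesis by simp
qed

text \<open>The mean is exact, so only the second moment produces an error. The absolute value and
  the factor with \<open>1 +\<close> make the bound independent of the signs of
  \<open>1 - disj_ratio m n\<close> and \<open>1 - ?x\<^sup>2\<close>.\<close>

lemma labelled_variance: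
  assumes T: "wf_language T" "\<phi> \<in> Hom_pos T" and K: "K \<in> mods T m" and "2 * m \<le> n"
  shows "(\<Sum>L\<in>mods T n. labelled T \<phi> L * (tdens K L - labelled T \<phi> K)\<^sup>2) \<le>
    \<bar>1 - disj_ratio m n\<bar> * (1 + (labelled T \<phi> K)\<^sup>2)"
proof -
  let ?x = "labelled T \<phi> K"
  have "(\<Sum>L\<in>mods T n. labelled T \<phi> L * (tdens K L - ?x)\<^sup>2) =
      (\<Sum>L\<in>mods T n. labelled T \<phi> L * (tdens K L)\<^sup>2) - 2 * ?x * (\<Sum>L\<in>mods T n. labelled T \<phi> L * tdens K L)
      + ?x\<^sup>2 * (\<Sum>L\<in>mods T n. labelled T \<phi> L)"
  proof -
    have "labelled T \<phi> L * (tdens K L - ?x)\<^sup>2 = labelled T \<phi> L * (tdens K L)\<^sup>2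
        - 2 * ?x * (labelled T \<phi> L * tdens K L) + ?x\<^sup>2 * labelled T \<phi> L" for L
      by (simp add: power2_diff algebra_simps)
    then show ?thesis by (simp only: sum.distrib sum_subtractf sum_distrib_left)
  qed
  also have "\<dots> = (\<Sum>L\<in>mods T n. labelled T \<phi> L * (tdens K L)\<^sup>2) - ?x\<^sup>2"
    using assms labelled_mean[OF T K] sum_labelled[OF T] by (simp add: power2_eq_square)
  also have "\<dots> \<le> (1 - disj_ratio m n) * (1 - ?x\<^sup>2)"
    using labelled_second_moment[OF assms] by (simp add: algebra_simps)
  also have "\<dots> \<le> \<bar>1 - disj_ratio m n\<bar> * \<bar>1 - ?x\<^sup>2\<bar>"
    by (metis abs_ge_self abs_mult)
  also have "\<dots> \<le> \<bar>1 - disj_ratio m n\<bar> * (1 + ?x\<^sup>2)"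
    by (intro mult_left_mono) (auto simp: abs_le_iff)
  finally show ?thesis .
qed

text \<open>One nonnegative number that controls the densities of all models with at most
  \<open>k\<close> vertices. Squares make its expectation a finite sum of variances.\<close>

definition sample_err :: "'p univ_theory \<Rightarrow> 'p limit_obj \<Rightarrow> nat \<Rightarrow> 'p rel_struct \<Rightarrow> real" where
  "sample_err T \<phi> k L = (\<Sum>j\<le>k. \<Sum>K\<in>mods T j. (tdens K L - labelled T \<phi> K)\<^sup>2)"

lemma sample_err_nonneg: "sample_err T \<phi> k L \<ge> 0"
  by (auto simp: sample_err_def intro!: sum_nonneg)

lemma sample_err_ge:
  assumes "wf_language T" "K \<in> mods T j" "j \<le> k"
  shows "(tdens K L - labelled T \<phi> K)\<^sup>2 \<le> sample_err T \<phi> k L"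
proof -
  have "(tdens K L - labelled T \<phi> K)\<^sup>2 \<le> (\<Sum>K\<in>mods T j. (tdens K L - labelled T \<phi> K)\<^sup>2)"
    using assms finite_mods by (intro member_le_sum) auto
  also have "\<dots> \<le> sample_err T \<phi> k L"
    unfolding sample_err_def using assms(3)
    by (intro member_le_sum[where f = "\<lambda>j. \<Sum>K\<in>mods T j. (tdens K L - labelled T \<phi> K)\<^sup>2"] sum_nonneg) auto
  finally show ?thesis .
qed

lemma expected_sample_err:
  assumes T: "wf_language T" "\<phi> \<in> Hom_pos T"
  shows "(\<lambda>n. \<Sum>L\<in>mods T n. labelled T \<phi> L * sample_err T \<phi> k L) \<longlonglongrightarrow> 0"
proof (rule tendsto_sandwich)
  let ?b = "\<lambda>n. \<Sum>j\<le>k. \<Sum>K\<in>mods T j. \<bar>1 - disj_ratio j n\<bar> * (1 + (labelled T \<phi> K)\<^sup>2)"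
  show "\<forall>\<^sub>F n in sequentially. 0 \<le> (\<Sum>L\<in>mods T n. labelled T \<phi> L * sample_err T \<phi> k L)"
    by (intro always_eventually allI sum_nonneg mult_nonneg_nonneg labelled_nonneg[OF T(2)] sample_err_nonneg)
  show "\<forall>\<^sub>F n in sequentially. (\<Sum>L\<in>mods T n. labelled T \<phi> L * sample_err T \<phi> k L) \<le> ?b n"
  proof (rule eventually_sequentiallyI)
    fix n assume n: "2 * k \<le> n"
    have "(\<Sum>L\<in>mods T n. labelled T \<phi> L * sample_err T \<phi> k L) =
        (\<Sum>j\<le>k. \<Sum>K\<in>mods T j. \<Sum>L\<in>mods T n. labelled T \<phi> L * (tdens K L - labelled T \<phi> K)\<^sup>2)"
      unfolding sample_err_def sum_distrib_left
      by (subst sum.swap) (intro sum.cong refl sum.swap)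
    also have "\<dots> \<le> ?b n"
      using n by (intro sum_mono labelled_variance[OF T]) auto
    finally show "(\<Sum>L\<in>mods T n. labelled T \<phi> L * sample_err T \<phi> k L) \<le> ?b n" .
  qed
  have "?b \<longlonglongrightarrow> (\<Sum>j\<le>k. \<Sum>K\<in>mods T j. \<bar>1 - 1\<bar> * (1 + (labelled T \<phi> K)\<^sup>2))"
    by (intro tendsto_intros disj_ratio_tendsto)
  then show "?b \<longlonglongrightarrow> 0" by simp
qed simp

section \<open>Lifting of couplings\<close>

text \<open>
  In each fibre \<open>a x = z = b y\<close>, averaging \<open>g x + h y\<close> with weights proportional to \<open>p x * q y\<close> amounts
  to using the relatively independent joining of \<open>p\<close> and \<open>q\<close>.
\<close>

lemma matching_pair:
  fixes p g :: "'a \<Rightarrow> real" and q h :: "'b \<Rightarrow> real"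
  assumes fin: "finite S" "finite R" and nn: "\<And>x. x \<in> S \<Longrightarrow> p x \<ge> 0" "\<And>y. y \<in> R \<Longrightarrow> q y \<ge> 0"
    "\<And>x. g x \<ge> 0" "\<And>y. h y \<ge> 0"
    and eq: "\<And>z. (\<Sum>x | x \<in> S \<and> a x = z. p x) = (\<Sum>y | y \<in> R \<and> b y = z. q y)"
    and one: "(\<Sum>x\<in>S. p x) = 1"
    and lt: "(\<Sum>x\<in>S. p x * g x) + (\<Sum>y\<in>R. q y * h y) < e"
  shows "\<exists>x\<in>S. \<exists>y\<in>R. a x = b y \<and> g x + h y < e"
proof (rule ccontr)
  assume "\<not> ?thesis"
  then have ge: "g x + h y \<ge> e" if "x \<in> S" "y \<in> R" "a x = b y" for x y using that by force
  define Z where "Z = a ` S \<union> b ` R"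
  have fZ: "finite Z" using fin by (simp add: Z_def)
  have grp: "(\<Sum>z\<in>Z. \<Sum>x | x \<in> S \<and> a x = z. u x) = (\<Sum>x\<in>S. u x)"
    "(\<Sum>z\<in>Z. \<Sum>y | y \<in> R \<and> b y = z. v y) = (\<Sum>y\<in>R. v y)" for u :: "'a \<Rightarrow> real" and v :: "'b \<Rightarrow> real"
    using sum.group[OF fin(1) fZ] sum.group[OF fin(2) fZ] by (auto simp: Z_def)
  have fibre: "e * (\<Sum>x | x \<in> S \<and> a x = z. p x) \<le>
      (\<Sum>x | x \<in> S \<and> a x = z. p x * g x) + (\<Sum>y | y \<in> R \<and> b y = z. q y * h y)" for z
  proof -
    let ?S = "{x. x \<in> S \<and> a x = z}" and ?R = "{y. y \<in> R \<and> b y = z}"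
    let ?w = "\<Sum>x\<in>?S. p x" and ?G = "\<Sum>x\<in>?S. p x * g x" and ?H = "\<Sum>y\<in>?R. q y * h y"
    \<comment> \<open>The fibre inequality is proved after multiplication by the mass
      \<open>?w\<close> of the fibre, which is the same for \<open>p\<close> and for
      \<open>q\<close>; there it becomes a comparison of double sums over matched pairs.\<close>
    have "?w * ?w = ?w * (\<Sum>y\<in>?R. q y)" by (simp only: eq[of z])
    also have "\<dots> = (\<Sum>x\<in>?S. \<Sum>y\<in>?R. p x * q y)" by (rule sum_product)
    finally have ww: "?w * ?w = (\<Sum>x\<in>?S. \<Sum>y\<in>?R. p x * q y)" .
    have "e * ?w * ?w = e * (\<Sum>x\<in>?S. \<Sum>y\<in>?R. p x * q y)" by (simp only: mult.assoc ww)
    also have "\<dots> = (\<Sum>x\<in>?S. \<Sum>y\<in>?R. e * (p x * q y))" by (simp only: sum_distrib_left)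
    also have "\<dots> \<le> (\<Sum>x\<in>?S. \<Sum>y\<in>?R. (g x + h y) * (p x * q y))"
      using ge nn by (intro sum_mono mult_right_mono) auto
    also have "\<dots> = (\<Sum>x\<in>?S. \<Sum>y\<in>?R. (p x * g x) * q y) + (\<Sum>x\<in>?S. \<Sum>y\<in>?R. p x * (q y * h y))"
      by (simp add: sum.distrib[symmetric] algebra_simps)
    also have "\<dots> = ?G * ?w + ?w * ?H"
      unfolding sum_product[symmetric] eq[of z] ..
    finally have le: "e * ?w * ?w \<le> (?G + ?H) * ?w" by (simp add: algebra_simps)
    have w0: "?w \<ge> 0" and GH: "?G + ?H \<ge> 0" using nn by (auto intro!: add_nonneg_nonneg sum_nonneg)
    show ?thesis
    proof (cases "?w = 0")
      \<comment> \<open>A fibre of mass 0 cannot be divided out; its left side is 0 and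
        nonnegativity of the right side suffices.\<close>
      case True
      then show ?thesis using GH by simp
    next
      case False
      then have "?w > 0" using w0 by linarith
      then show ?thesis using le mult_right_le_imp_le by blast
    qed
  qed
  have "e = (\<Sum>z\<in>Z. e * (\<Sum>x | x \<in> S \<and> a x = z. p x))"
    by (simp add: sum_distrib_left[symmetric] grp one)
  also have "\<dots> \<le> (\<Sum>z\<in>Z. (\<Sum>x | x \<in> S \<and> a x = z. p x * g x) + (\<Sum>y | y \<in> R \<and> b y = z. q y * h y))"
    by (intro sum_mono fibre)
  also have "\<dots> = (\<Sum>x\<in>S. p x * g x) + (\<Sum>y\<in>R. q y * h y)"
    by (simp add: sum.distrib grp)
  finally show False using lt by simp
qed

text \<open>Compactness: densities lie in \<open>{0..1}\<close> and there are countably many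
  classes, so all of them converge along a diagonal subsequence.\<close>

lemma conv_subseq_ex:
  fixes N :: "nat \<Rightarrow> 'p rel_struct"
  assumes T: "wf_language T" and N: "\<And>n. N n \<in> finite_models T" "strict_mono (\<lambda>n. card (verts (N n)))"
  obtains r \<phi> where "strict_mono r" "converges_to T (\<lambda>n. N (r n)) \<phi>" "\<phi> \<in> extensional (iso_classes T)"
proof -
  let ?c = "from_nat_into (iso_classes T)"
  let ?d = "\<lambda>C n. density (rep C) (N n)"
  define P where "P = (\<lambda>i (s :: nat \<Rightarrow> nat). convergent (\<lambda>n. ?d (?c i) (s n)))"
  have P_iff: "P i s \<longleftrightarrow> convergent (\<lambda>n. ?d (?c i) (s n))" for i s by (simp add: P_def)
  interpret subseqs P
  proof
    fix i and s :: "nat \<Rightarrow> nat" assume "strict_mono s"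
    have "?d (?c i) (s n) \<in> {0..1}" for n
      using N(1) by (auto simp: finite_models_def density_nonneg intro: density_le_1)
    then obtain l r where "strict_mono r" "((\<lambda>n. ?d (?c i) (s n)) \<circ> r) \<longlonglongrightarrow> l"
      using seq_compactE[OF compact_imp_seq_compact[OF compact_Icc]] by metis
    then show "\<exists>r'. strict_mono r' \<and> P i (s \<circ> r')"
      unfolding P_iff convergent_def comp_def by blast
  qed
  have "P i (diagseq \<circ> ((+) (Suc i)))" for i
    by (rule diagseq_holds) (use convergent_subseq_convergent in \<open>fastforce simp: P_iff comp_def\<close>)
  \<comment> \<open>Convergence is known only for the diagonal sequence from index
    \<open>Suc i\<close> on, and an initial segment does not affect it.\<close>
  from iffD1[OF P_iff this] have "convergent (\<lambda>n. ?d (?c i) (diagseq (n + Suc i)))" for i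
    by (simp only: comp_def add.commute)
  then have "convergent (\<lambda>n. ?d (?c i) (diagseq n))" for i
    using convergent_ignore_initial_segment[of "\<lambda>n. ?d (?c i) (diagseq n)" "Suc i"] by blast
  then have lim: "(\<lambda>n. ?d C (diagseq n)) \<longlonglongrightarrow> lim (\<lambda>n. ?d C (diagseq n))" if "C \<in> iso_classes T" for C
    using from_nat_into_surj[OF countable_iso_classes[OF T] that] convergent_LIMSEQ_iff by metis
  define \<phi> where "\<phi> = (\<lambda>C\<in>iso_classes T. lim (\<lambda>n. ?d C (diagseq n)))"
  have "converges_to T (\<lambda>n. N (diagseq n)) \<phi>"
    unfolding converges_to_def
  proof (intro conjI allI ballI)
    show "N (diagseq n) \<in> finite_models T" for n by (rule N)
    show "strict_mono (\<lambda>n. card (verts (N (diagseq n))))"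
      using strict_mono_o[OF N(2) subseq_diagseq] by (simp add: comp_def)
    fix M assume M: "M \<in> finite_models T"
    then show "(\<lambda>n. density M (N (diagseq n))) \<longlonglongrightarrow> \<phi> (iso_class T M)"
      using lim[OF iso_class_in[OF M]] iso_class_in[OF M] density_isomorphic[OF rep_iso_class[OF M]]
      by (simp add: \<phi>_def)
  qed
  moreover have "\<phi> \<in> extensional (iso_classes T)" by (simp add: \<phi>_def)
  ultimately show ?thesis using that subseq_diagseq by blast
qed

text \<open>A fixed \<open>K\<close> on \<open>m\<close> vertices is measured by
  \<open>sample_err T \<phi> k\<close> as soon as \<open>k\<close> is at least \<open>m\<close>, so
  its squared deviation is eventually below \<open>inverse (real (Suc k))\<close>. The resulting
  convergence survives passing to the subsequence \<open>r\<close>.\<close>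

lemma limit_eq_of_sample_err:
  assumes T: "wf_language T" and converges_to: "converges_to T (\<lambda>k. N (r k)) \<zeta>" and r: "strict_mono r"
    and ext: "\<zeta> \<in> extensional (iso_classes T)" "\<phi> \<in> extensional (iso_classes T)"
    and err: "\<And>k. sample_err T \<phi> k (N k) < inverse (real (Suc k))"
  shows "\<zeta> = \<phi>"
proof (rule limit_obj_eqI[OF ext])
  fix m K assume K: "K \<in> mods T m"
  have "\<forall>\<^sub>F k in sequentially. norm ((tdens K (N k) - labelled T \<phi> K)\<^sup>2) \<le> inverse (real (Suc k))"
    using eventually_ge_at_top[of m]
  proof eventually_elim
    case (elim k)
    have "(tdens K (N k) - labelled T \<phi> K)\<^sup>2 \<le> sample_err T \<phi> k (N k)"
      by (rule sample_err_ge[OF T K elim])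
    then show ?case using err[of k] by simp
  qed
  then have "(\<lambda>k. (tdens K (N k) - labelled T \<phi> K)\<^sup>2) \<longlonglongrightarrow> 0"
    by (rule Lim_null_comparison[OF _ LIMSEQ_inverse_real_of_nat])
  then have "(\<lambda>k. tdens K (N k) - labelled T \<phi> K) \<longlonglongrightarrow> 0"
    by (rule power_tendsto_0_iff[THEN iffD1, rotated]) simp
  then have "(\<lambda>k. tdens K (N k)) \<longlonglongrightarrow> labelled T \<phi> K"
    by (simp add: LIM_zero_iff)
  from LIMSEQ_subseq_LIMSEQ[OF this r] have "(\<lambda>k. tdens K (N (r k))) \<longlonglongrightarrow> labelled T \<phi> K"
    by (simp add: comp_def)
  then show "labelled T \<zeta> K = labelled T \<phi> K"
    by (rule LIMSEQ_unique[OF conv_tdens[OF converges_to K]])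
qed

text \<open>By \<open>marg\<close> the laws of \<phi> and \<xi> on labelled models have the same
  image over \<open>T1\<close>. Two models matched over \<open>T1\<close> are glued: the first
  supplies the \<open>T2\<close> relations, the second the \<open>T'\<close> relations.\<close>

lemma lift_coupling:
  fixes T1 :: "'p univ_theory" and T2 :: "'q univ_theory" and T' :: "'r univ_theory"
  assumes I: "open_interpretation T1 T2 I"
    and wf: "wf_language T1" "wf_language T2" "wf_language T'"
    and \<phi>: "\<phi> \<in> Hom_pos T2" and \<xi>: "\<xi> \<in> Hom_pos (T1 \<oplus>\<^sub>T T')"
    and marg: "interp_limit T1 (T1 \<oplus>\<^sub>T T') (erase_left T1) \<xi> = interp_limit T1 T2 I \<phi>"
  obtains \<zeta> where "\<zeta> \<in> Hom_pos (T2 \<oplus>\<^sub>T T')"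
    "interp_limit T2 (T2 \<oplus>\<^sub>T T') (erase_left T2) \<zeta> = \<phi>"
    "interp_limit (T1 \<oplus>\<^sub>T T') (T2 \<oplus>\<^sub>T T') (extend_interp T' I) \<zeta> = \<xi>"
proof -
  let ?A = "T1 \<oplus>\<^sub>T T'" and ?B = "T2 \<oplus>\<^sub>T T'"
  let ?J = "interp_struct ?A (extend_interp T' I) :: ('q + 'r) rel_struct \<Rightarrow> _"
  have wfA: "wf_language ?A" and wfB: "wf_language ?B" using wf wf_language_union by blast+
  have ex: "\<forall>\<^sub>F n in sequentially. \<exists>Z\<in>mods ?B n.
      sample_err T2 \<phi> k (el T2 Z) + sample_err ?A \<xi> k (?J Z) < inverse (real (Suc k))" for k
  proof -
    have "(\<lambda>n. (\<Sum>L\<in>mods T2 n. labelled T2 \<phi> L * sample_err T2 \<phi> k L) +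
        (\<Sum>L\<in>mods ?A n. labelled ?A \<xi> L * sample_err ?A \<xi> k L)) \<longlonglongrightarrow> 0 + 0"
      by (intro tendsto_add expected_sample_err wf wfA \<phi> \<xi>)
    then have "\<forall>\<^sub>F n in sequentially. (\<Sum>L\<in>mods T2 n. labelled T2 \<phi> L * sample_err T2 \<phi> k L) +
        (\<Sum>L\<in>mods ?A n. labelled ?A \<xi> L * sample_err ?A \<xi> k L) < inverse (real (Suc k))"
      by (rule order_tendstoD) simp
    then show ?thesis
    proof eventually_elim
      case (elim n)
      \<comment> \<open>Over a labelled model of \<open>T1\<close> both sums compute the common
        marginal; for any other \<open>z\<close> both fibres are empty.\<close>
      have fibres: "(\<Sum>x | x \<in> mods T2 n \<and> interp_struct T1 I x = z. labelled T2 \<phi> x) =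
          (\<Sum>y | y \<in> mods ?A n \<and> el T1 y = z. labelled ?A \<xi> y)" for z
      proof (cases "z \<in> mods T1 n")
        case True
        then show ?thesis
          using labelled_interp[OF I wf(2) \<phi> True]
            labelled_interp[OF erase_left_interpretation wfA \<xi> True] marg by simp
      next
        case False
        then have "{x. x \<in> mods T2 n \<and> interp_struct T1 I x = z} = {}"
          "{y. y \<in> mods ?A n \<and> el T1 y = z} = {}"
          by (auto dest: open_interpretationD(4)[OF I] open_interpretationD(4)[OF erase_left_interpretation])
        then show ?thesis by (simp only: sum.empty)
      qed
      have "\<exists>x\<in>mods T2 n. \<exists>y\<in>mods ?A n. interp_struct T1 I x = el T1 y \<and>
          sample_err T2 \<phi> k x + sample_err ?A \<xi> k y < inverse (real (Suc k))"
        by (rule matching_pair[OF finite_mods[OF wf(2)] finite_mods[OF wfA] labelled_nonneg[OF \<phi>]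
          labelled_nonneg[OF \<xi>] sample_err_nonneg sample_err_nonneg fibres sum_labelled[OF wf(2) \<phi>] elim])
      then obtain x y where xy: "x \<in> mods T2 n" "y \<in> mods ?A n" "interp_struct T1 I x = el T1 y"
        "sample_err T2 \<phi> k x + sample_err ?A \<xi> k y < inverse (real (Suc k))" by blast
      \<comment> \<open>The \<open>T1\<close> part of \<open>y\<close> is already determined by
        \<open>x\<close>, so only the \<open>T'\<close> part of \<open>y\<close> has to be adjoined.
        The result maps exactly onto \<open>x\<close> and onto \<open>y\<close>, hence no new error
        arises.\<close>
      let ?Z = "join x (er T' y)"
      have er: "er T' y \<in> mods T' n" using open_interpretationD(4)[OF erase_right_interpretation xy(2)] .
      have Z: "?Z \<in> mods ?B n" by (rule join_in_mods[OF xy(1) er])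
      have so: "struct_over T2 x" "struct_over T' (er T' y)" "verts x = verts (er T' y)"
        using modsD[OF xy(1)] modsD[OF er] by auto
      have "?J ?Z = join (el T1 y) (er T' y)"
        using interp_extend[OF modsD(3)[OF Z], of T1 I] el_join[OF so] er_join[OF so] xy(3) by simp
      then have "?J ?Z = y" using join_el_er[OF modsD(3)[OF xy(2)]] by simp
      then show ?case using Z xy(4) el_join[OF so] by (intro bexI[of _ ?Z]) simp_all
    qed
  qed
  then obtain n0 where n0: "\<And>k n. n \<ge> n0 k \<Longrightarrow> \<exists>Z\<in>mods ?B n.
      sample_err T2 \<phi> k (el T2 Z) + sample_err ?A \<xi> k (?J Z) < inverse (real (Suc k))"
    unfolding eventually_sequentially by metis
  \<comment> \<open>These partial sums dominate \<open>n0\<close> and increase strictly, as the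
    sizes in a convergent sequence must.\<close>
  define s where "s = (\<lambda>k. \<Sum>i\<le>k. Suc (n0 i))"
  have s: "strict_mono s" by (simp add: s_def strict_mono_Suc_iff)
  have "n0 k \<le> s k" for k
    using member_le_sum[of k "{..k}" "\<lambda>i. Suc (n0 i)"] by (simp add: s_def)
  then have "\<forall>k. \<exists>z. z \<in> mods ?B (s k) \<and>
      sample_err T2 \<phi> k (el T2 z) + sample_err ?A \<xi> k (?J z) < inverse (real (Suc k))"
    using n0 by (meson bexE)
  from choice[OF this] obtain Z where Z: "\<And>k. Z k \<in> mods ?B (s k)"
    "\<And>k. sample_err T2 \<phi> k (el T2 (Z k)) + sample_err ?A \<xi> k (?J (Z k)) < inverse (real (Suc k))"
    by blast
  have err: "sample_err T2 \<phi> k (el T2 (Z k)) < inverse (real (Suc k))"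
    "sample_err ?A \<xi> k (?J (Z k)) < inverse (real (Suc k))" for k
    using Z(2)[of k] sample_err_nonneg[of T2 \<phi> k "el T2 (Z k)"] sample_err_nonneg[of ?A \<xi> k "?J (Z k)"]
    by linarith+
  have "strict_mono (\<lambda>k. card (verts (Z k)))" using s modsD(2)[OF Z(1)] by simp
  then obtain r \<zeta> where r: "strict_mono r" and \<zeta>: "converges_to ?B (\<lambda>k. Z (r k)) \<zeta>"
    "\<zeta> \<in> extensional (iso_classes ?B)"
    using conv_subseq_ex[of ?B Z] wfB modsD(4)[OF Z(1)] by blast
  show ?thesis
  proof
    show "\<zeta> \<in> Hom_pos ?B" by (rule Hom_posI[OF \<zeta>])
    show "interp_limit T2 ?B (erase_left T2) \<zeta> = \<phi>"
      by (rule limit_eq_of_sample_err[OF wf(2) conv_interp[OF erase_left_interpretation wfB \<zeta>(1)] r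
        interp_limit_extensional Hom_pos_extensional[OF \<phi>] err(1)])
    show "interp_limit ?A ?B (extend_interp T' I) \<zeta> = \<xi>"
      by (rule limit_eq_of_sample_err[OF wfA conv_interp[OF extend_interpretation[OF I] wfB \<zeta>(1)] r
        interp_limit_extensional Hom_pos_extensional[OF \<xi>] err(2)])
  qed
qed

section \<open>Unique coupleability and unique inducibility\<close>

text \<open>The square formed by \<open>I\<close>, its extension and the two left erasures commutes
  on structures, hence on limit objects.\<close>

lemma interp_limit_el_extend:
  assumes I: "open_interpretation T1 T2 I"
    and wf: "wf_language T1" "wf_language T2" "wf_language T'" and \<zeta>: "\<zeta> \<in> Hom_pos (T2 \<oplus>\<^sub>T T')"
  shows "interp_limit T1 (T1 \<oplus>\<^sub>T T') (erase_left T1)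
      (interp_limit (T1 \<oplus>\<^sub>T T') (T2 \<oplus>\<^sub>T T') (extend_interp T' I) \<zeta>) =
    interp_limit T1 T2 I (interp_limit T2 (T2 \<oplus>\<^sub>T T') (erase_left T2) \<zeta>)"
  by (rule interp_limit_cong_comp[OF wf_language_union[OF wf(2,3)] \<zeta> extend_interpretation[OF I]
    erase_left_interpretation wf_language_union[OF wf(1,3)] wf(2) erase_left_interpretation I])
    (rule el_interp_extend[OF model_struct_over])

lemma interp_limit_er_extend:
  assumes I: "open_interpretation T1 T2 I"
    and wf: "wf_language T1" "wf_language T2" "wf_language T'" and \<zeta>: "\<zeta> \<in> Hom_pos (T2 \<oplus>\<^sub>T T')"
  shows "interp_limit T' (T1 \<oplus>\<^sub>T T') (erase_right T')
      (interp_limit (T1 \<oplus>\<^sub>T T') (T2 \<oplus>\<^sub>T T') (extend_interp T' I) \<zeta>) =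
    interp_limit T' (T2 \<oplus>\<^sub>T T') (erase_right T') \<zeta>"
  by (rule interp_limit_comp[OF wf_language_union[OF wf(2,3)] \<zeta> extend_interpretation[OF I]
    erase_right_interpretation wf_language_union[OF wf(1,3)] erase_right_interpretation])
    (rule er_interp_extend[OF model_struct_over])

lemma interp_extend_eq_iff:
  assumes "K \<in> mods (T1 \<oplus>\<^sub>T T') m" "Z \<in> mods (T2 \<oplus>\<^sub>T T') m"
  shows "interp_struct (T1 \<oplus>\<^sub>T T') (extend_interp T' I) Z = K \<longleftrightarrow>
    interp_struct T1 I (el T2 Z) = el T1 K \<and> er T' Z = er T' K"
  using interp_extend[OF modsD(3)[OF assms(2)], of T1 I] join_el_er[OF modsD(3)[OF assms(1)]]
    el_interp_extend[OF modsD(3)[OF assms(2)], of T1 I] er_interp_extend[OF modsD(3)[OF assms(2)], of T1 I]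
  by metis

text \<open>The models over \<open>K\<close> are the joins of some \<open>x\<close> over the
  \<open>T1\<close> part of \<open>K\<close> with the fixed \<open>T'\<close> part of
  \<open>K\<close>, so the second factor is constant on the fibre. The products are left bare so
  that the identity also applies where \<open>indep_coupling\<close> over \<open>T2\<close> is not
  known to lie in \<open>Hom_pos\<close>.\<close>

lemma sum_labelled_extend:
  assumes I: "open_interpretation T1 T2 I" and wf: "wf_language T2"
    and \<phi>: "\<phi> \<in> Hom_pos T2" and K: "K \<in> mods (T1 \<oplus>\<^sub>T T') m"
  shows "(\<Sum>Z | Z \<in> mods (T2 \<oplus>\<^sub>T T') m \<and> interp_struct (T1 \<oplus>\<^sub>T T') (extend_interp T' I) Z = K.
      labelled T2 \<phi> (el T2 Z) * labelled T' \<psi> (er T' Z)) =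
    labelled T1 (interp_limit T1 T2 I \<phi>) (el T1 K) * labelled T' \<psi> (er T' K)"
proof -
  have elK: "el T1 K \<in> mods T1 m" and erK: "er T' K \<in> mods T' m"
    using open_interpretationD(4) erase_left_interpretation erase_right_interpretation K by blast+
  have Z: "join x (er T' K) \<in> mods (T2 \<oplus>\<^sub>T T') m" "el T2 (join x (er T' K)) = x"
    "er T' (join x (er T' K)) = er T' K" if "x \<in> mods T2 m" for x
    using join_in_mods[OF that erK] modsD[OF that] modsD[OF erK]
    by (simp_all add: el_join[where ?T2.0 = T'] er_join[where ?T1.0 = T2])
  have "(\<Sum>Z | Z \<in> mods (T2 \<oplus>\<^sub>T T') m \<and> interp_struct (T1 \<oplus>\<^sub>T T') (extend_interp T' I) Z = K.
      labelled T2 \<phi> (el T2 Z) * labelled T' \<psi> (er T' Z)) =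
    (\<Sum>x | x \<in> mods T2 m \<and> interp_struct T1 I x = el T1 K. labelled T2 \<phi> x * labelled T' \<psi> (er T' K))"
  proof (rule sum.reindex_bij_witness[where i = "\<lambda>x. join x (er T' K)" and j = "el T2"], goal_cases)
    case (1 Y)
    then have Y: "Y \<in> mods (T2 \<oplus>\<^sub>T T') m" and "er T' Y = er T' K"
      using interp_extend_eq_iff[OF K] by blast+
    then show ?case using join_el_er[OF modsD(3)[OF Y]] by simp
  next
    case (2 Y)
    then show ?case
      using interp_extend_eq_iff[OF K] open_interpretationD(4)[OF erase_left_interpretation] by blast
  next
    case (3 x)
    then show ?case using Z by blast
  next
    case (4 x)
    then show ?case using Z[of x] interp_extend_eq_iff[OF K Z(1)] by simp
  next
    case (5 Y)
    then show ?case using interp_extend_eq_iff[OF K] by fastforce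
  qed
  then show ?thesis
    using labelled_interp[OF I wf \<phi> elK] by (simp add: sum_distrib_right)
qed

text \<open>Membership in \<open>Hom_pos\<close> is assumed because the fibre formula
  \<open>labelled_interp\<close> is about limit objects; unique coupleability will provide
  it.\<close>

lemma interp_limit_indep_coupling:
  assumes I: "open_interpretation T1 T2 I"
    and wf: "wf_language T1" "wf_language T2" "wf_language T'" and \<phi>: "\<phi> \<in> Hom_pos T2"
    and indep: "indep_coupling T2 T' \<phi> \<psi> \<in> Hom_pos (T2 \<oplus>\<^sub>T T')"
  shows "interp_limit (T1 \<oplus>\<^sub>T T') (T2 \<oplus>\<^sub>T T') (extend_interp T' I) (indep_coupling T2 T' \<phi> \<psi>) =
    indep_coupling T1 T' (interp_limit T1 T2 I \<phi>) \<psi>"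
proof (rule limit_obj_eqI[OF interp_limit_extensional indep_coupling_extensional])
  fix m K assume K: "K \<in> mods (T1 \<oplus>\<^sub>T T') m"
  let ?J = "interp_struct (T1 \<oplus>\<^sub>T T') (extend_interp T' I)"
  have "labelled (T1 \<oplus>\<^sub>T T') (interp_limit (T1 \<oplus>\<^sub>T T') (T2 \<oplus>\<^sub>T T') (extend_interp T' I)
      (indep_coupling T2 T' \<phi> \<psi>)) K =
    (\<Sum>Z | Z \<in> mods (T2 \<oplus>\<^sub>T T') m \<and> ?J Z = K. labelled (T2 \<oplus>\<^sub>T T') (indep_coupling T2 T' \<phi> \<psi>) Z)"
    by (rule labelled_interp[OF extend_interpretation[OF I] wf_language_union[OF wf(2,3)] indep K])
  also have "\<dots> = (\<Sum>Z | Z \<in> mods (T2 \<oplus>\<^sub>T T') m \<and> ?J Z = K.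
      labelled T2 \<phi> (el T2 Z) * labelled T' \<psi> (er T' Z))"
    by (intro sum.cong refl labelled_indep_coupling) (auto dest: modsD(4))
  also have "\<dots> = labelled (T1 \<oplus>\<^sub>T T') (indep_coupling T1 T' (interp_limit T1 T2 I \<phi>) \<psi>) K"
    by (simp add: sum_labelled_extend[OF I wf(2) \<phi> K] labelled_indep_coupling[OF modsD(4)[OF K]])
  finally show "labelled (T1 \<oplus>\<^sub>T T') (interp_limit (T1 \<oplus>\<^sub>T T') (T2 \<oplus>\<^sub>T T') (extend_interp T' I)
      (indep_coupling T2 T' \<phi> \<psi>)) K =
    labelled (T1 \<oplus>\<^sub>T T') (indep_coupling T1 T' (interp_limit T1 T2 I \<phi>) \<psi>) K" .
qed

text \<open>A coupling over \<open>T1\<close> lifts to one over \<open>T2\<close>, which has to be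
  the independent one, and its push-forward is independent again. The same push-forward shows that
  the independent coupling over \<open>T1\<close> is indeed a coupling.\<close>

theorem uniquely_coupleable_interp:
  assumes I: "open_interpretation T1 T2 I"
    and wf: "wf_language T1" "wf_language T2" "wf_language T'" and \<phi>: "\<phi> \<in> Hom_pos T2"
    and uc: "uniquely_coupleable T2 T' \<phi> \<psi>"
  shows "uniquely_coupleable T1 T' (interp_limit T1 T2 I \<phi>) \<psi>"
  unfolding uniquely_coupleable_def
proof (intro equalityI subsetI)
  let ?lim = "interp_limit (T1 \<oplus>\<^sub>T T') (T2 \<oplus>\<^sub>T T') (extend_interp T' I)"
  let ?i = "indep_coupling T2 T' \<phi> \<psi>"
  \<comment> \<open>Unique coupleability is an equality of sets, so it includes that the independent
    coupling is a limit object with the right marginals.\<close>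
  have i: "?i \<in> Hom_pos (T2 \<oplus>\<^sub>T T')"
    "interp_limit T2 (T2 \<oplus>\<^sub>T T') (erase_left T2) ?i = \<phi>"
    "interp_limit T' (T2 \<oplus>\<^sub>T T') (erase_right T') ?i = \<psi>"
    using uc by (auto simp: uniquely_coupleable_def couplings_def)
  have eq: "?lim ?i = indep_coupling T1 T' (interp_limit T1 T2 I \<phi>) \<psi>"
    by (rule interp_limit_indep_coupling[OF I wf \<phi> i(1)])
  {
    fix \<xi> assume "\<xi> \<in> {indep_coupling T1 T' (interp_limit T1 T2 I \<phi>) \<psi>}"
    then have \<xi>: "\<xi> = ?lim ?i" using eq by simp
    have "?lim ?i \<in> Hom_pos (T1 \<oplus>\<^sub>T T')"
      by (rule interp_limit_Hom_pos[OF extend_interpretation[OF I] wf_language_union[OF wf(2,3)] i(1)])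
    then show "\<xi> \<in> couplings T1 T' (interp_limit T1 T2 I \<phi>) \<psi>"
      unfolding \<xi> couplings_def
      by (simp add: interp_limit_el_extend[OF I wf i(1)] interp_limit_er_extend[OF I wf i(1)] i)
  }
  fix \<xi> assume "\<xi> \<in> couplings T1 T' (interp_limit T1 T2 I \<phi>) \<psi>"
  then have \<xi>: "\<xi> \<in> Hom_pos (T1 \<oplus>\<^sub>T T')"
    "interp_limit T1 (T1 \<oplus>\<^sub>T T') (erase_left T1) \<xi> = interp_limit T1 T2 I \<phi>"
    "interp_limit T' (T1 \<oplus>\<^sub>T T') (erase_right T') \<xi> = \<psi>"
    by (auto simp: couplings_def)
  obtain \<zeta> where \<zeta>: "\<zeta> \<in> Hom_pos (T2 \<oplus>\<^sub>T T')"
    "interp_limit T2 (T2 \<oplus>\<^sub>T T') (erase_left T2) \<zeta> = \<phi>" "?lim \<zeta> = \<xi>"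
    by (rule lift_coupling[OF I wf \<phi> \<xi>(1,2)])
  have "interp_limit T' (T2 \<oplus>\<^sub>T T') (erase_right T') \<zeta> = \<psi>"
    using interp_limit_er_extend[OF I wf \<zeta>(1)] \<zeta>(3) \<xi>(3) by simp
  with \<zeta> have "\<zeta> \<in> couplings T2 T' \<phi> \<psi>" by (simp add: couplings_def)
  then have "\<zeta> = ?i" using uc by (simp add: uniquely_coupleable_def)
  then show "\<xi> \<in> {indep_coupling T1 T' (interp_limit T1 T2 I \<phi>) \<psi>}" using \<zeta>(3) eq by simp
qed

lemma complete_hypergraph_isomorphic:
  assumes "G \<cong>\<^sub>S G'" "struct_over L G'" "complete_hypergraph l G"
  shows "complete_hypergraph l G'"
proof -
  obtain f where f: "is_iso f G' G" using isomorphic_sym[OF assms(1)] unfolding isomorphic_def by blast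
  have inj: "inj_on f (verts G')" and im: "f ` verts G' = verts G"
    using is_isoD(1)[OF f] by (auto simp: bij_betw_def)
  have "xs \<in> rel G' () \<longleftrightarrow> length xs = l \<and> distinct xs \<and> set xs \<subseteq> verts G'" for xs
  proof (cases "set xs \<subseteq> verts G'")
    case True
    then have "distinct (map f xs) \<longleftrightarrow> distinct xs" "set (map f xs) \<subseteq> verts G"
      using im by (auto simp: distinct_map intro: inj_on_subset[OF inj])
    then show ?thesis
      using is_isoD(2)[OF f True, of "()"] assms(3) True by (simp add: complete_hypergraph_def)
  next
    case False
    then show ?thesis using struct_overD(2)[OF assms(2)] by blast
  qed
  then show ?thesis by (auto simp: complete_hypergraph_def)
qed

lemma wf_language_hypergraph: "l \<ge> 1 \<Longrightarrow> wf_language (hypergraph_theory l)"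
  by (simp add: wf_language_def hypergraph_theory_def Let_def)

lemma iso_class_eq_labelledI:
  assumes "M \<in> finite_models T" "labelled T \<xi> M = labelled T \<xi>' M"
  shows "\<xi> (iso_class T M) = \<xi>' (iso_class T M)"
  using iso_class_labelled[OF assms(1)] assms(2) by metis

text \<open>All models over \<open>K\<close> share the hypergraph of \<open>K\<close>. Completeness
  thus holds on the whole fibre, and the hypothesis determines the lifted coupling at each of its
  points, whatever that coupling does elsewhere.\<close>

theorem UInduce_interp:
  fixes T1 :: "'p univ_theory" and T2 :: "'q univ_theory"
  assumes I: "open_interpretation T1 T2 I"
    and wf: "wf_language T1" "wf_language T2" and \<phi>: "\<phi> \<in> Hom_pos T2"
    and ui: "UInduce l T2 \<phi>"
  shows "UInduce l T1 (interp_limit T1 T2 I \<phi>)"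
proof (cases "l = 0")
  case False
  define H where "H = hypergraph_theory l"
  \<comment> \<open>Here \<open>l\<close> is positive, as arities have to be.\<close>
  have wfH: "wf_language H" using False by (simp add: H_def wf_language_hypergraph)
  let ?A = "T1 \<oplus>\<^sub>T H" and ?B = "T2 \<oplus>\<^sub>T H"
  let ?lim = "interp_limit ?A ?B (extend_interp H I)"
  have wfB: "wf_language ?B" by (rule wf_language_union[OF wf(2) wfH])
  have "\<xi> (iso_class ?A M) = indep_coupling T1 H (interp_limit T1 T2 I \<phi>) \<psi> (iso_class ?A M)"
    if \<psi>: "\<psi> \<in> Hom_pos H" and \<xi>': "\<xi> \<in> couplings T1 H (interp_limit T1 T2 I \<phi>) \<psi>"
      and M: "M \<in> finite_models ?A" and compl: "complete_hypergraph l (er H M)" for \<psi> \<xi> M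
  proof -
    have \<xi>: "\<xi> \<in> Hom_pos ?A"
      "interp_limit T1 ?A (erase_left T1) \<xi> = interp_limit T1 T2 I \<phi>"
      "interp_limit H ?A (erase_right H) \<xi> = \<psi>"
      using \<xi>' by (auto simp: couplings_def)
    obtain \<zeta> where \<zeta>: "\<zeta> \<in> Hom_pos ?B"
      "interp_limit T2 ?B (erase_left T2) \<zeta> = \<phi>" "?lim \<zeta> = \<xi>"
      by (rule lift_coupling[OF I wf wfH \<phi> \<xi>(1,2)])
    have "interp_limit H ?B (erase_right H) \<zeta> = \<psi>"
      using interp_limit_er_extend[OF I wf wfH \<zeta>(1)] \<zeta>(3) \<xi>(3) by simp
    with \<zeta> have \<zeta>c: "\<zeta> \<in> couplings T2 H \<phi> \<psi>" by (simp add: couplings_def)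
    \<comment> \<open>Passing to a labelled copy makes the fibre formula available; completeness of
      the hypergraph is invariant under isomorphism.\<close>
    obtain m K where K: "K \<in> mods ?A m" "M \<cong>\<^sub>S K" using obtain_mods[OF M] by blast
    have "er H M \<cong>\<^sub>S er H K" by (rule interp_isomorphic[OF erase_right_interpretation K(2)])
    then have complK: "complete_hypergraph l (er H K)"
      by (rule complete_hypergraph_isomorphic[OF _ struct_over_interp compl])
    let ?Z = "{Z. Z \<in> mods ?B m \<and> interp_struct ?A (extend_interp H I) Z = K}"
    have "labelled ?A \<xi> K = (\<Sum>Z\<in>?Z. labelled ?B \<zeta> Z)"
      using labelled_interp[OF extend_interpretation[OF I] wfB \<zeta>(1) K(1)] \<zeta>(3) by simp
    also have "\<dots> = (\<Sum>Z\<in>?Z. labelled T2 \<phi> (el T2 Z) * labelled H \<psi> (er H Z))"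
    proof (rule sum.cong)
      fix Z assume "Z \<in> ?Z"
      then have Z: "Z \<in> mods ?B m" and "er H Z = er H K" using interp_extend_eq_iff[OF K(1)] by blast+
      then have "complete_hypergraph l (er H Z)" using complK by simp
      then have "\<zeta> (iso_class ?B Z) = indep_coupling T2 H \<phi> \<psi> (iso_class ?B Z)"
        using ui False \<psi> \<zeta>c modsD(4)[OF Z] unfolding UInduce_def Let_def H_def by blast
      then have "labelled ?B \<zeta> Z = labelled ?B (indep_coupling T2 H \<phi> \<psi>) Z"
        by (simp add: labelled_def)
      then show "labelled ?B \<zeta> Z = labelled T2 \<phi> (el T2 Z) * labelled H \<psi> (er H Z)"
        using labelled_indep_coupling[OF modsD(4)[OF Z]] by simp
    qed simp
    also have "\<dots> = labelled ?A (indep_coupling T1 H (interp_limit T1 T2 I \<phi>) \<psi>) K"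
      by (simp add: sum_labelled_extend[OF I wf(2) \<phi> K(1)] labelled_indep_coupling[OF modsD(4)[OF K(1)]])
    finally have "\<xi> (iso_class ?A K) = indep_coupling T1 H (interp_limit T1 T2 I \<phi>) \<psi> (iso_class ?A K)"
      by (rule iso_class_eq_labelledI[OF modsD(4)[OF K(1)]])
    then show ?thesis using iso_class_eq_iff[OF M modsD(4)[OF K(1)]] K(2) by simp
  qed
  then show ?thesis unfolding UInduce_def Let_def H_def by blast
qed (simp add: UInduce_def)

section \<open>Interpretations of theons\<close>

lemma space_theon_cube: "space (theon_cube V \<Omega>) = fin_subsets V \<rightarrow>\<^sub>E space \<Omega>"
  by (simp add: theon_cube_def space_PiM)

lemma prob_space_theon_cube: "prob_space \<Omega> \<Longrightarrow> prob_space (theon_cube V \<Omega>)"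
  unfolding theon_cube_def by (intro prob_space.prob_space_completion prob_space_PiM)

lemma image_nth_fin_subsets:
  "set xs \<subseteq> V \<Longrightarrow> A \<in> fin_subsets {..<length xs} \<Longrightarrow> (!) xs ` A \<in> fin_subsets V"
  by (auto simp: fin_subsets_def subset_iff)

text \<open>The cubes carry completed \<sigma>-algebras, so measurability of the coordinates is not
  enough: preimages of null sets have to be null. As \<open>xs\<close> is injective, distinct index
  sets read distinct coordinates, hence the map preserves the product measure.\<close>

lemma pullback_measurable:
  assumes "prob_space \<Omega>" "distinct xs" "set xs \<subseteq> V"
  shows "pullback xs \<in> theon_cube V \<Omega> \<rightarrow>\<^sub>M theon_cube {..<length xs} \<Omega>"
proof -
  let ?I = "fin_subsets {..<length xs}" and ?K = "fin_subsets V"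
  let ?MI = "PiM ?I (\<lambda>_. \<Omega>)" and ?MK = "PiM ?K (\<lambda>_. \<Omega>)"
  have inj: "inj_on ((`) ((!) xs)) ?I"
    using inj_on_nth[OF assms(2), of "{..<length xs}"]
    by (intro inj_onI) (auto simp: fin_subsets_def inj_on_image_eq_iff)
  have maps: "(`) ((!) xs) \<in> ?I \<rightarrow> ?K"
    using image_nth_fin_subsets[OF assms(3)] by blast
  have m: "pullback xs \<in> ?MK \<rightarrow>\<^sub>M ?MI"
    unfolding pullback_def using maps by (intro measurable_restrict measurable_component_singleton) auto
  have "distr ?MK ?MI (pullback xs) = ?MI"
    using distr_PiM_reindex[where M = "\<lambda>_. \<Omega>", OF assms(1) inj maps]
    by (simp add: pullback_def[abs_def])
  then have "distr (completion ?MK) ?MI (pullback xs) = ?MI"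
    by (simp add: distr_completion[OF m])
  then show ?thesis
    unfolding theon_cube_def
    by (intro completion.measurable_completion2 measurable_completion m) simp
qed

lemma pullback_space:
  assumes "set xs \<subseteq> V" "\<theta> \<in> space (theon_cube V \<Omega>)"
  shows "pullback xs \<theta> \<in> space (theon_cube {..<length xs} \<Omega>)"
  using assms image_nth_fin_subsets[OF assms(1)] unfolding space_theon_cube pullback_def
  by (auto intro!: PiE_mem[OF assms(2)[unfolded space_theon_cube]])

lemma pullback_pullback:
  assumes "set ys \<subseteq> {..<length xs}"
  shows "pullback ys (pullback xs \<theta>) = pullback (map ((!) xs) ys) \<theta>"
proof
  fix A
  show "pullback ys (pullback xs \<theta>) A = pullback (map ((!) xs) ys) \<theta> A"
  proof (cases "A \<in> fin_subsets {..<length ys}")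
    case True
    have "(!) xs ` (!) ys ` A = (!) (map ((!) xs) ys) ` A"
      using True by (force simp: fin_subsets_def image_image)
    then show ?thesis
      using True image_nth_fin_subsets[OF assms True] by (simp add: pullback_def)
  qed (simp add: pullback_def)
qed

section \<open>Structures sampled from coordinates, and measurability of the events they
  define\<close>

lemma rel_sampled:
  "xs \<in> rel (sampled_struct T \<N> \<theta>) P \<longleftrightarrow>
     P \<in> preds T \<and> length xs = arity T P \<and> distinct xs \<and> pullback xs \<theta> \<in> \<N> P"
  by (simp add: sampled_struct_def)

lemma verts_sampled [simp]: "verts (sampled_struct T \<N> \<theta>) = UNIV"
  by (simp add: sampled_struct_def)

text \<open>Equivariance of sampling. Only positions below \<open>length xs\<close> are compared,
  since the pulled back coordinates carry no information about other vertices.\<close>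

lemma pull_sampled:
  assumes "distinct xs"
  shows "pull xs (sampled_struct T \<N> \<theta>) = induced (sampled_struct T \<N> (pullback xs \<theta>)) {..<length xs}"
proof (rule struct_eqI)
  fix P
  have "distinct (map ((!) xs) ys) \<longleftrightarrow> distinct ys" if "set ys \<subseteq> {..<length xs}" for ys
    using that assms by (auto simp: distinct_map inj_on_def nth_eq_iff_index_eq subset_iff)
  then show "rel (pull xs (sampled_struct T \<N> \<theta>)) P =
      rel (induced (sampled_struct T \<N> (pullback xs \<theta>)) {..<length xs}) P"
    by (auto simp: rel_pull rel_induced rel_sampled pullback_pullback)
qed simp

lemma eval_sampled_pullback:
  assumes "distinct xs" "s ` qf_vars F \<subseteq> {..<length xs}"
  shows "eval (sampled_struct T \<N> (pullback xs \<theta>)) s F \<longleftrightarrow> eval (sampled_struct T \<N> \<theta>) ((!) xs \<circ> s) F"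
proof -
  have im: "((!) xs \<circ> s) ` qf_vars F \<subseteq> set xs" using assms(2) nth_mem by fastforce
  have "eval (sampled_struct T \<N> (pullback xs \<theta>)) s F \<longleftrightarrow> eval (pull xs (sampled_struct T \<N> \<theta>)) s F"
    unfolding pull_sampled[OF assms(1)] by (rule eval_induced[OF assms(2), symmetric])
  also have "\<dots> \<longleftrightarrow> eval (induced (sampled_struct T \<N> \<theta>) (set xs)) ((!) xs \<circ> s) F"
    using assms(2) by (intro eval_iso[OF pull_iso[OF assms(1)]]) simp
  also have "\<dots> \<longleftrightarrow> eval (sampled_struct T \<N> \<theta>) ((!) xs \<circ> s) F"
    by (rule eval_induced[OF im])
  finally show ?thesis .
qed

text \<open>The set \<open>V\<close> is a parameter because the finite cube that contains a peon and
  the infinite cube that is sampled are both needed.\<close>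

lemma sets_rel_sampled:
  assumes "prob_space \<Omega>" "\<And>P. P \<in> preds T \<Longrightarrow> \<N> P \<in> sets (theon_cube {..<arity T P} \<Omega>)" "set xs \<subseteq> V"
  shows "{\<theta> \<in> space (theon_cube V \<Omega>). xs \<in> rel (sampled_struct T \<N> \<theta>) P} \<in> sets (theon_cube V \<Omega>)"
proof (cases "P \<in> preds T \<and> length xs = arity T P \<and> distinct xs")
  case True
  then have "pullback xs -` \<N> P \<inter> space (theon_cube V \<Omega>) \<in> sets (theon_cube V \<Omega>)"
    using measurable_sets[OF pullback_measurable[OF assms(1) _ assms(3)]] assms(2)[of P] by simp
  moreover have "pullback xs -` \<N> P \<inter> space (theon_cube V \<Omega>) =
      {\<theta> \<in> space (theon_cube V \<Omega>). xs \<in> rel (sampled_struct T \<N> \<theta>) P}"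
    using True by (auto simp: rel_sampled)
  ultimately show ?thesis by simp
next
  case False
  then have "{\<theta> \<in> space (theon_cube V \<Omega>). xs \<in> rel (sampled_struct T \<N> \<theta>) P} = {}"
    by (auto simp: rel_sampled)
  then show ?thesis by (simp only: sets.empty_sets)
qed

lemma sets_eval_sampled:
  assumes "prob_space \<Omega>" "\<And>P. P \<in> preds T \<Longrightarrow> \<N> P \<in> sets (theon_cube {..<arity T P} \<Omega>)"
    and "s ` qf_vars F \<subseteq> V"
  shows "{\<theta> \<in> space (theon_cube V \<Omega>). eval (sampled_struct T \<N> \<theta>) s F} \<in> sets (theon_cube V \<Omega>)"
  using assms(3)
proof (induction F)
  case (Atom P xs)
  then have "set (map s xs) \<subseteq> V" by auto
  from sets_rel_sampled[where T = T and P = P, OF assms(1,2) this] show ?case by simp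
qed (simp_all add: image_Un sets.sets_Collect)

lemma sets_induced_sampled:
  assumes wf: "wf_language T" and "prob_space \<Omega>"
    and "\<And>P. P \<in> preds T \<Longrightarrow> \<N> P \<in> sets (theon_cube {..<arity T P} \<Omega>)"
  shows "{\<theta> \<in> space (theon_cube UNIV \<Omega>). induced (sampled_struct T \<N> \<theta>) {..<m} \<cong>\<^sub>S M}
    \<in> sets (theon_cube UNIV \<Omega>)"
proof -
  let ?S = "theon_cube UNIV \<Omega>"
  \<comment> \<open>A sampled structure is a model only almost everywhere, so the possible
    substructures are enumerated without the axioms; there are still finitely many.\<close>
  define T0 where "T0 = T\<lparr>axioms := {}\<rparr>"
  have T0: "wf_language T0" "preds T0 = preds T" "arity T0 = arity T" "axioms T0 = {}"
    using wf by (simp_all add: T0_def wf_language_def)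
  have fin: "finite (preds T)" using wf by (simp add: wf_language_def)
  have ind: "induced (sampled_struct T \<N> \<theta>) {..<m} \<in> mods T0 m" for \<theta>
    using T0 by (auto simp: mods_def model_def rel_induced rel_sampled intro!: struct_overI)
  have eq: "induced (sampled_struct T \<N> \<theta>) {..<m} = K \<longleftrightarrow>
      (\<forall>P\<in>preds T. \<forall>xs\<in>{xs. set xs \<subseteq> {..<m} \<and> length xs = arity T P}.
         xs \<in> rel (sampled_struct T \<N> \<theta>) P \<longleftrightarrow> xs \<in> rel K P)" if K: "K \<in> mods T0 m" for \<theta> K
  proof
    assume R: "\<forall>P\<in>preds T. \<forall>xs\<in>{xs. set xs \<subseteq> {..<m} \<and> length xs = arity T P}.
         xs \<in> rel (sampled_struct T \<N> \<theta>) P \<longleftrightarrow> xs \<in> rel K P"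
    show "induced (sampled_struct T \<N> \<theta>) {..<m} = K"
    proof (rule struct_eqI)
      fix P
      have "xs \<in> rel (induced (sampled_struct T \<N> \<theta>) {..<m}) P \<longleftrightarrow> xs \<in> rel K P" for xs
        using R struct_overD[OF modsD(3)[OF K], of xs P] T0 modsD(2)[OF K]
        by (auto simp: rel_induced rel_sampled)
      then show "rel (induced (sampled_struct T \<N> \<theta>) {..<m}) P = rel K P" by blast
    qed (simp add: modsD(2)[OF K])
  qed (auto simp: rel_induced)
  have K: "{\<theta> \<in> space ?S. induced (sampled_struct T \<N> \<theta>) {..<m} = K} \<in> sets ?S" if "K \<in> mods T0 m" for K
    unfolding eq[OF that]
  proof (intro sets.sets_Collect_finite_All fin)
    fix P assume "P \<in> preds T"
    show "finite {xs. set xs \<subseteq> {..<m} \<and> length xs = arity T P}" by (simp add: finite_lists_length_eq)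
    fix xs :: "nat list"
    have "{\<theta> \<in> space ?S. xs \<in> rel (sampled_struct T \<N> \<theta>) P} \<in> sets ?S"
      by (rule sets_rel_sampled[OF assms(2,3)]) auto
    then show "{\<theta> \<in> space ?S. (xs \<in> rel (sampled_struct T \<N> \<theta>) P) = (xs \<in> rel K P)} \<in> sets ?S"
      by (cases "xs \<in> rel K P") (simp_all add: sets.sets_Collect_neg)
  qed
  have "{\<theta> \<in> space ?S. induced (sampled_struct T \<N> \<theta>) {..<m} \<cong>\<^sub>S M} =
      (\<Union>K\<in>{K \<in> mods T0 m. K \<cong>\<^sub>S M}. {\<theta> \<in> space ?S. induced (sampled_struct T \<N> \<theta>) {..<m} = K})"
    using ind by auto
  also have "\<dots> \<in> sets ?S"
    using finite_mods[OF T0(1)] K by (intro sets.finite_UN) auto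
  finally show ?thesis .
qed

lemma canonical_wf_language: "canonical T \<Longrightarrow> wf_language T"
  by (simp add: canonical_def wf_theory_def)

lemma canonical_distinct:
  assumes "canonical T" "model T M" "xs \<in> rel M P"
  shows "distinct xs"
proof (rule ccontr)
  assume "\<not> distinct xs"
  then obtain i j where ij: "i < j" "j < length xs" "xs ! i = xs ! j"
    by (metis distinct_conv_nth linorder_neqE_nat)
  note xs = struct_overD[OF model_struct_over[OF assms(2)] assms(3)]
  have "satisfies M (diag_axiom T P i j)"
    using assms(1,2) xs ij unfolding canonical_def by metis
  moreover have "(!) xs ` qf_vars (diag_axiom T P i j) \<subseteq> verts M"
    using ij xs nth_mem by (fastforce simp: diag_axiom_def)
  ultimately have "\<not> (xs ! i = xs ! j \<and> map ((!) xs) [0..<arity T P] \<in> rel M P)"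
    unfolding satisfies_def by (auto simp: diag_axiom_def)
  then show False using ij assms(3) xs(3) map_nth[of xs] by simp
qed

text \<open>\<open>I P\<close> is evaluated at the tuple \<open>0, 1, ...\<close> of the structure
  determined by \<open>x\<close> itself. The point \<open>x\<close> has coordinates only for subsets
  of \<open>{..<arity T1 P}\<close>, which suffices because an open interpretation uses only
  variables below the arity.\<close>

definition interp_peons ::
    "'p univ_theory \<Rightarrow> 'q univ_theory \<Rightarrow> ('p \<Rightarrow> 'q qf) \<Rightarrow> 'x measure \<Rightarrow> ('q, 'x) peons \<Rightarrow> ('p, 'x) peons" where
  "interp_peons T1 T2 I \<Omega> \<N> = (\<lambda>P. {x \<in> space (theon_cube {..<arity T1 P} \<Omega>).
     eval (sampled_struct T2 \<N> x) (\<lambda>i. i) (I P)})"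

text \<open>On injective tuples both sides evaluate \<open>I P\<close> at the entries. Sampled
  relations contain no other tuples by construction, and the interpreted structure has none because
  it is a model of the canonical theory \<open>T1\<close>; for this the sampled structure has to be
  a model of \<open>T2\<close>.\<close>

lemma sampled_interp_peons:
  assumes "canonical T1" and I: "open_interpretation T1 T2 I"
    and \<theta>: "\<theta> \<in> space (theon_cube UNIV \<Omega>)" and mod: "model T2 (sampled_struct T2 \<N> \<theta>)"
  shows "sampled_struct T1 (interp_peons T1 T2 I \<Omega> \<N>) \<theta> = interp_struct T1 I (sampled_struct T2 \<N> \<theta>)"
proof (rule struct_eqI)
  fix P
  have "xs \<in> rel (sampled_struct T1 (interp_peons T1 T2 I \<Omega> \<N>) \<theta>) P \<longleftrightarrow>
      xs \<in> rel (interp_struct T1 I (sampled_struct T2 \<N> \<theta>)) P" for xs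
  proof (cases "P \<in> preds T1 \<and> length xs = arity T1 P \<and> distinct xs")
    case True
    then have "qf_vars (I P) \<subseteq> {..<length xs}" using open_interpretationD(1)[OF I] by simp
    then have "eval (sampled_struct T2 \<N> (pullback xs \<theta>)) (\<lambda>i. i) (I P) \<longleftrightarrow>
        eval (sampled_struct T2 \<N> \<theta>) ((!) xs) (I P)"
      using True eval_sampled_pullback[of xs "\<lambda>i. i" "I P"] by (simp add: comp_def)
    moreover have "pullback xs \<theta> \<in> space (theon_cube {..<length xs} \<Omega>)"
      using \<theta> by (intro pullback_space) auto
    ultimately show ?thesis
      using True by (simp add: rel_sampled rel_interp interp_peons_def)
  next
    case False
    then have "xs \<notin> rel (sampled_struct T1 (interp_peons T1 T2 I \<Omega> \<N>) \<theta>) P"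
      by (auto simp: rel_sampled)
    moreover have "xs \<notin> rel (interp_struct T1 I (sampled_struct T2 \<N> \<theta>)) P"
      using False canonical_distinct[OF assms(1) open_interpretationD(2)[OF I mod]]
      by (auto simp: rel_interp)
    ultimately show ?thesis by simp
  qed
  then show "rel (sampled_struct T1 (interp_peons T1 T2 I \<Omega> \<N>) \<theta>) P =
      rel (interp_struct T1 I (sampled_struct T2 \<N> \<theta>)) P" by blast
qed simp

lemma theonD:
  assumes "theon T \<Omega> \<N>"
  shows "prob_space \<Omega>" "P \<in> preds T \<Longrightarrow> \<N> P \<in> sets (theon_cube {..<arity T P} \<Omega>)"
    "AE \<theta> in theon_cube UNIV \<Omega>. model T (sampled_struct T \<N> \<theta>)" "theon_space \<Omega>"
  using assms by (auto simp: theon_def theon_space_def)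

lemma AE_sampled_interp_peons:
  assumes "canonical T1" "open_interpretation T1 T2 I" "theon T2 \<Omega> \<N>"
  shows "AE \<theta> in theon_cube UNIV \<Omega>. model T2 (sampled_struct T2 \<N> \<theta>) \<and>
    sampled_struct T1 (interp_peons T1 T2 I \<Omega> \<N>) \<theta> = interp_struct T1 I (sampled_struct T2 \<N> \<theta>)"
  using theonD(3)[OF assms(3)] AE_space
  by eventually_elim (simp add: sampled_interp_peons[OF assms(1,2)])

lemma theon_interp_peons:
  assumes "canonical T1" and I: "open_interpretation T1 T2 I" and N: "theon T2 \<Omega> \<N>"
  shows "theon T1 \<Omega> (interp_peons T1 T2 I \<Omega> \<N>)"
  unfolding theon_def
proof (intro conjI ballI)
  show "theon_space \<Omega>" by (rule theonD(4)[OF N])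
  show "interp_peons T1 T2 I \<Omega> \<N> P \<in> sets (theon_cube {..<arity T1 P} \<Omega>)" if "P \<in> preds T1" for P
    unfolding interp_peons_def using open_interpretationD(1)[OF I that]
    by (intro sets_eval_sampled theonD(1,2)[OF N]) simp_all
  show "AE \<theta> in theon_cube UNIV \<Omega>. model T1 (sampled_struct T1 (interp_peons T1 T2 I \<Omega> \<N>) \<theta>)"
    using AE_sampled_interp_peons[OF assms]
    by eventually_elim (simp add: open_interpretationD(2)[OF I])
qed

text \<open>Outside a null set the first vertices induce a model of \<open>T2\<close>, whose class
  sorts the event for \<open>C\<close> into disjoint events; their measures add up to the sum
  defining \<open>interp_limit\<close>.\<close>

lemma theon_limit_interp_peons:
  assumes can: "canonical T1" and wf: "wf_language T1" "wf_language T2"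
    and I: "open_interpretation T1 T2 I" and N: "theon T2 \<Omega> \<N>"
  shows "theon_limit T1 \<Omega> (interp_peons T1 T2 I \<Omega> \<N>) = interp_limit T1 T2 I (theon_limit T2 \<Omega> \<N>)"
proof
  fix C
  let ?S = "theon_cube UNIV \<Omega>" and ?N' = "interp_peons T1 T2 I \<Omega> \<N>"
  interpret prob_space ?S by (rule prob_space_theon_cube[OF theonD(1)[OF N]])
  show "theon_limit T1 \<Omega> ?N' C = interp_limit T1 T2 I (theon_limit T2 \<Omega> \<N>) C"
  proof (cases "C \<in> iso_classes T1")
    case True
    let ?m = "card (verts (rep C))"
    let ?D = "{D. D \<in> iso_classes T2 \<and> card (verts (rep D)) = ?m \<and> interp_struct T1 I (rep D) \<cong>\<^sub>S rep C}"
    let ?X = "\<lambda>D. {\<theta> \<in> space ?S. induced (sampled_struct T2 \<N> \<theta>) {..<?m} \<cong>\<^sub>S rep D}"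
    let ?Y = "{\<theta> \<in> space ?S. induced (sampled_struct T1 ?N' \<theta>) {..<?m} \<cong>\<^sub>S rep C}"
    have finD: "finite ?D" by (rule finite_subset[OF _ finite_iso_classes_card[OF wf(2), of ?m]]) auto
    have X: "?X D \<in> sets ?S" for D
      by (rule sets_induced_sampled[OF wf(2) theonD(1,2)[OF N]])
    have Y: "?Y \<in> sets ?S"
      by (rule sets_induced_sampled[OF wf(1) theonD(1,2)[OF theon_interp_peons[OF can I N]]])
    have disj: "disjoint_family_on ?X ?D"
      unfolding disjoint_family_on_def
    proof (intro ballI impI)
      fix D D' assume D: "D \<in> ?D" "D' \<in> ?D" "D \<noteq> D'"
      have r: "rep D \<in> finite_models T2" "iso_class T2 (rep D) = D"
        "rep D' \<in> finite_models T2" "iso_class T2 (rep D') = D'"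
        using D rep_in by blast+
      have "\<not> (M \<cong>\<^sub>S rep D \<and> M \<cong>\<^sub>S rep D')" for M
        using iso_class_eq_iff[OF r(1,3)] r D(3) isomorphic_trans isomorphic_sym by metis
      then show "?X D \<inter> ?X D' = {}" by blast
    qed
    have "AE \<theta> in ?S. \<theta> \<in> ?Y \<longleftrightarrow> \<theta> \<in> (\<Union>D\<in>?D. ?X D)"
      using AE_sampled_interp_peons[OF can I N] AE_space
    proof eventually_elim
      case (elim \<theta>)
      let ?K = "induced (sampled_struct T2 \<N> \<theta>) {..<?m}"
      have K: "?K \<in> finite_models T2"
        using elim model_induced[of T2 "sampled_struct T2 \<N> \<theta>"] by (simp add: finite_models_def)
      have eq: "induced (sampled_struct T1 ?N' \<theta>) {..<?m} = interp_struct T1 I ?K"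
        using elim interp_induced[OF I, of "{..<?m}" "sampled_struct T2 \<N> \<theta>"] by simp
      let ?E = "iso_class T2 ?K"
      have E: "?E \<in> iso_classes T2" "rep ?E \<cong>\<^sub>S ?K" by (rule iso_class_in[OF K], rule rep_iso_class[OF K])
      have "?E \<in> ?D" "\<theta> \<in> ?X ?E" if "interp_struct T1 I ?K \<cong>\<^sub>S rep C"
        using E that isomorphic_card[OF E(2)] isomorphic_trans[OF interp_isomorphic[OF I E(2)]]
          isomorphic_sym elim by auto
      moreover have "interp_struct T1 I ?K \<cong>\<^sub>S rep C" if "D \<in> ?D" "\<theta> \<in> ?X D" for D
        using that interp_isomorphic[OF I, of ?K "rep D"] isomorphic_trans by blast
      ultimately show ?case using elim unfolding eq[symmetric] by blast
    qed
    then have "measure ?S ?Y = measure ?S (\<Union>D\<in>?D. ?X D)"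
      using X Y finD by (intro measure_eq_AE sets.finite_UN) auto
    also have "\<dots> = (\<Sum>D\<in>?D. measure ?S (?X D))"
      using X finD disj by (intro finite_measure_finite_Union) auto
    also have "\<dots> = (\<Sum>D\<in>?D. theon_limit T2 \<Omega> \<N> D)"
      by (intro sum.cong) (auto simp: theon_limit_def)
    finally show ?thesis using True by (simp add: theon_limit_def[of T1] interp_limit_def)
  qed (simp add: theon_limit_def interp_limit_def)
qed

section \<open>Coordinates on which interpreted peons depend\<close>

lemma pullback_agree:
  assumes xs: "distinct xs" "set xs \<subseteq> V"
    and xy: "\<And>A. A \<in> fin_subsets V \<Longrightarrow> card A > l \<Longrightarrow> x A = y A"
    and A: "A \<in> fin_subsets {..<length xs}" "card A > l"
  shows "pullback xs x A = pullback xs y A"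
proof -
  have "card ((!) xs ` A) = card A"
    using A xs(1) by (intro card_image inj_on_nth) (auto simp: fin_subsets_def)
  then show ?thesis
    using A xy[OF image_nth_fin_subsets[OF xs(2) A(1)]] by (simp add: pullback_def)
qed

text \<open>Only atoms matter. An injective tuple maps index sets to index sets of the same size, so
  coordinates of size above \<open>l\<close> are read from coordinates of size above
  \<open>l\<close>; non-injective tuples never belong to a sampled relation.\<close>

lemma eval_sampled_independent:
  assumes indep: "\<And>P. P \<in> preds T \<Longrightarrow> peon_independent \<Omega> (arity T P) (\<N> P) l"
    and sp: "x \<in> space (theon_cube V \<Omega>)" "y \<in> space (theon_cube V \<Omega>)"
    and xy: "\<And>A. A \<in> fin_subsets V \<Longrightarrow> card A > l \<Longrightarrow> x A = y A"
    and s: "s ` qf_vars F \<subseteq> V"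
  shows "eval (sampled_struct T \<N> x) s F \<longleftrightarrow> eval (sampled_struct T \<N> y) s F"
  using s
proof (induction F)
  case (Atom P ys)
  let ?ys = "map s ys"
  have V: "set ?ys \<subseteq> V" using Atom by auto
  have "pullback ?ys x \<in> \<N> P \<longleftrightarrow> pullback ?ys y \<in> \<N> P"
    if P: "P \<in> preds T" "length ?ys = arity T P" "distinct ?ys"
  proof -
    let ?G = "{A \<in> fin_subsets {..<arity T P}. card A > l}"
    obtain H where H: "\<N> P = {x \<in> space (theon_cube {..<arity T P} \<Omega>). restrict x ?G \<in> H}"
      using indep[OF P(1)] unfolding peon_independent_def by blast
    have "restrict (pullback ?ys x) ?G = restrict (pullback ?ys y) ?G"
      using P(2) by (intro restrict_ext pullback_agree[where l = l, OF P(3) V xy]) auto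
    moreover have "pullback ?ys x \<in> space (theon_cube {..<arity T P} \<Omega>)"
      "pullback ?ys y \<in> space (theon_cube {..<arity T P} \<Omega>)"
      using pullback_space[OF V] sp P(2) by metis+
    ultimately show ?thesis by (simp add: H)
  qed
  then show ?case by (auto simp: rel_sampled)
qed auto

lemma peon_independent_interp:
  assumes I: "open_interpretation T1 T2 I" and P: "P \<in> preds T1"
    and indep: "\<And>Q. Q \<in> preds T2 \<Longrightarrow> peon_independent \<Omega> (arity T2 Q) (\<N> Q) l"
  shows "peon_independent \<Omega> (arity T1 P) (interp_peons T1 T2 I \<Omega> \<N> P) l"
proof -
  let ?V = "{..<arity T1 P}"
  let ?G = "{A \<in> fin_subsets ?V. card A > l}" and ?N = "interp_peons T1 T2 I \<Omega> \<N> P"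
  let ?S = "space (theon_cube ?V \<Omega>)"
  have sub: "?N \<subseteq> ?S" by (auto simp: interp_peons_def)
  have "x \<in> ?N" if x: "x \<in> ?S" and y: "y \<in> ?N" "restrict x ?G = restrict y ?G" for x y
  proof -
    have "x A = y A" if "A \<in> fin_subsets ?V" "card A > l" for A
      using fun_cong[OF y(2), of A] that by simp
    then have "eval (sampled_struct T2 \<N> x) (\<lambda>i. i) (I P) \<longleftrightarrow> eval (sampled_struct T2 \<N> y) (\<lambda>i. i) (I P)"
      using y(1) x sub open_interpretationD(1)[OF I P]
      by (intro eval_sampled_independent[OF indep, where V = ?V]) auto
    then show ?thesis using x y(1) by (simp add: interp_peons_def)
  qed
  \<comment> \<open>The peon is saturated under agreement on \<open>?G\<close>, so its own
    projection serves as the set \<open>H\<close> in the definition of independence.\<close>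
  then have "?N = {x \<in> ?S. restrict x ?G \<in> (\<lambda>x. restrict x ?G) ` ?N}" using sub by blast
  moreover have "(\<lambda>x. restrict x ?G) ` ?N \<subseteq> ?G \<rightarrow>\<^sub>E space \<Omega>"
    using sub by (auto simp: space_theon_cube PiE_iff extensional_def split: if_splits)
  ultimately show ?thesis unfolding peon_independent_def by blast
qed

theorem Independence_interp:
  assumes "canonical T1" "canonical T2" "open_interpretation T1 T2 I"
    and "Independence TYPE('x) l T2 \<phi>"
  shows "Independence TYPE('x) l T1 (interp_limit T1 T2 I \<phi>)"
proof -
  obtain \<Omega> :: "'x measure" and \<N> where N: "theon T2 \<Omega> \<N>" "theon_limit T2 \<Omega> \<N> = \<phi>"
    "\<And>P. P \<in> preds T2 \<Longrightarrow> peon_independent \<Omega> (arity T2 P) (\<N> P) l"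
    using assms(4) unfolding Independence_def by blast
  have wf: "wf_language T1" "wf_language T2"
    using assms(1,2) by (auto intro: canonical_wf_language)
  let ?N' = "interp_peons T1 T2 I \<Omega> \<N>"
  have "theon T1 \<Omega> ?N'" by (rule theon_interp_peons[OF assms(1,3) N(1)])
  moreover have "theon_limit T1 \<Omega> ?N' = interp_limit T1 T2 I \<phi>"
    using theon_limit_interp_peons[OF assms(1) wf assms(3) N(1)] N(2) by simp
  moreover have "\<forall>P\<in>preds T1. peon_independent \<Omega> (arity T1 P) (?N' P) l"
    using peon_independent_interp[OF assms(3) _ N(3)] by blast
  ultimately show ?thesis unfolding Independence_def by blast
qed

theorem theorem3p3:
  fixes T1 :: "'p univ_theory" and T2 :: "'q univ_theory"
    and I :: "'p \<Rightarrow> 'q qf" and l :: nat and \<phi> :: "'q limit_obj"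
  assumes "canonical T1" and "canonical T2"
    and "open_interpretation T1 T2 I"
    and "\<phi> \<in> Hom_pos T2"
  shows "(\<forall>(T' :: 'r univ_theory) \<psi>. canonical T' \<longrightarrow> \<psi> \<in> Hom_pos T' \<longrightarrow>
            uniquely_coupleable T2 T' \<phi> \<psi> \<longrightarrow>
            uniquely_coupleable T1 T' (interp_limit T1 T2 I \<phi>) \<psi>) \<and>
         (Independence TYPE('x) l T2 \<phi> \<longrightarrow> Independence TYPE('x) l T1 (interp_limit T1 T2 I \<phi>)) \<and>
         (UCouple TYPE('x) l T2 \<phi> \<longrightarrow> UCouple TYPE('x) l T1 (interp_limit T1 T2 I \<phi>)) \<and>
         (UInduce l T2 \<phi> \<longrightarrow> UInduce l T1 (interp_limit T1 T2 I \<phi>))"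
proof (intro conjI allI impI)
  have wf: "wf_language T1" "wf_language T2"
    using assms(1,2) by (auto intro: canonical_wf_language)
  show "uniquely_coupleable T1 T' (interp_limit T1 T2 I \<phi>) \<psi>"
    if "canonical T'" "uniquely_coupleable T2 T' \<phi> \<psi>" for T' :: "'r univ_theory" and \<psi>
    by (rule uniquely_coupleable_interp[OF assms(3) wf canonical_wf_language[OF that(1)] assms(4) that(2)])
  show "Independence TYPE('x) l T1 (interp_limit T1 T2 I \<phi>)" if "Independence TYPE('x) l T2 \<phi>"
    by (rule Independence_interp[OF assms(1-3) that])
  \<comment> \<open>The rank condition concerns \<psi> alone, so unique coupleability is inherited
    for each such \<psi> separately.\<close>
  show "UCouple TYPE('x) l T1 (interp_limit T1 T2 I \<phi>)" if "UCouple TYPE('x) l T2 \<phi>"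
    using that uniquely_coupleable_interp[OF assms(3) wf canonical_wf_language assms(4)]
    unfolding UCouple_def by blast
  show "UInduce l T1 (interp_limit T1 T2 I \<phi>)" if "UInduce l T2 \<phi>"
    by (rule UInduce_interp[OF assms(3) wf assms(4) that])
qed

end
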